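(* Let $M\in\mathcal{O}$. Then, as virtual $\mathfrak{h}$-modules, $$I_{\mathrm{top}}(M)=M\otimes S^+-M\otimes S^-.$$
   Context: Let $\mathfrak{g}$ be a finite-dimensional complex semisimple Lie algebra with Killing form $\langle\cdot,\cdot\rangle$, $\theta$ a Cartan involution of $\mathfrak{g}$, and $\mathfrak{h}\subseteq\mathfrak{g}$ a Lie subalgebra which is reductive, $\theta$-stable, such that $\langle\cdot,\cdot\rangle|_{\mathfrak{h}\times\mathfrak{h}}$ is nondegenerate, and which contains a Cartan subalgebra $\mathfrak{t}$ of $\mathfrak{g}$. Put $\mathfrak{q}=\mathfrak{h}^\perp$, so $\mathfrak{g}=\mathfrak{h}\oplus\mathfrak{q}$. The root system $\Delta=\Delta(\mathfrak{g},\mathfrak{t})$ is the disjoint union of $\Delta_\mathfrak{h}=\Delta(\mathfrak{h},\mathfrak{t})$ and $\Delta_\mathfrak{q}$ (the roots whose root spaces lie in $\mathfrak{q}$). Fix a positive system $\Delta^+$, and put $\Delta_\mathfrak{q}^+=\Delta^+\cap\Delta_\mathfrak{q}$, $\mathfrak{n}=\bigoplus_{\alpha\in\Delta^+}\mathfrak{g}_\alpha$, $\mathfrak{n}_\mathfrak{q}^\pm=\bigoplus_{\beta\in\Delta_\mathfrak{q}^+}\mathfrak{g}_{\pm\beta}$. Category $\mathcal{O}$: finitely generated $U(\mathfrak{g})$-modules which are weight modules for $\mathfrak{t}$ and locally $\mathfrak{n}$-finite. Clifford algebra and spin module: $\mathbf{C}(\mathfrak{q})$ is the quotient of the tensor algebra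 $T(\mathfrak{q})$ by the relations $X\otimes Y+Y\otimes X=\langle X,Y\rangle$. The spin module is $S=\bigwedge\mathfrak{n}_\mathfrak{q}^-$, with Clifford action $\gamma$ in which $\mathfrak{n}_\mathfrak{q}^-$ acts by exterior multiplication and $\mathfrak{n}_\mathfrak{q}^+$ by contraction via $\langle\cdot,\cdot\rangle$. For $a,b\in\mathfrak{q}$ let $R_{a,b}\in\mathfrak{so}(\mathfrak{q})$, $R_{a,b}(v)=\langle b,v\rangle a-\langle a,v\rangle b$; these span $\mathfrak{so}(\mathfrak{q})$ and $\varphi(R_{a,b})=\frac12[\gamma(a),\gamma(b)]$ defines an injective Lie algebra map $\varphi:\mathfrak{so}(\mathfrak{q})\to\mathbf{C}(\mathfrak{q})$. $\mathfrak{h}$ acts on $S$ via $\mathfrak{h}\xrightarrow{\mathrm{ad}}\mathfrak{so}(\mathfrak{q})\xrightarrow{\varphi}\mathbf{C}(\mathfrak{q})\to\mathrm{End}(S)$, and on $M\otimes S$ diagonally. $S=S^+\oplus S^-$ is the splitting into even and odd parts of $\bigwedge\mathfrak{n}_\mathfrak{q}^-$; it is $\mathfrak{h}$-stable. Dirac operator: for a $\mathfrak{g}$-module $(M,\pi)$ and an orthonormal basis $\{Z_j\}$ of $\mathfrak{q}$, $D=D_{\mathfrak{g},\mathfrak{h}}(M)=\sum_j\pi(Z_j)\otimes\gamma(Z_j)-1\otimes\gamma(c)$ acting on $M\otimes S$, where $\gamma(c)=\frac16\sum_{i,j,k}\langle Z_i,[Z_j,Z_k]\rangle\gamma(Z_i)\gamma(Z_j)\gamma(Z_k)$.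 It is independent of the basis, $\mathfrak{h}$-equivariant, and interchanges $M\otimes S^+$ and $M\otimes S^-$. Higher Dirac cohomology and index: for $k\ge0$, $H^k_{\mathrm{top}}(M)=\ker D^{2k+1}/\big((\ker D^{2k+1}\cap\mathrm{im}\,D)+\ker D^{2k}\big)$ and $H_{\mathrm{top}}(M)=\bigoplus_{k\ge0}H^k_{\mathrm{top}}(M)$. These $\mathfrak{h}$-modules are $\mathbb{Z}_2$-graded by $M\otimes S=M\otimes S^+\oplus M\otimes S^-$, giving $H_{\mathrm{top}}(M)=H_{\mathrm{top}}(M)^+\oplus H_{\mathrm{top}}(M)^-$, and $I_{\mathrm{top}}(M)=H_{\mathrm{top}}(M)^+-H_{\mathrm{top}}(M)^-$. Virtual $\mathfrak{h}$-modules are formal differences of $\mathfrak{h}$-modules which are weight modules with finite-dimensional weight spaces; an equality $A-B=C-E$ means equality of formal characters: $\dim A_\mu-\dim B_\mu=\dim C_\mu-\dim E_\mu$ for every $\mu\in\mathfrak{t}^*$. *)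

theory Defs
  imports Complex_Main "HOL-Library.Function_Algebras"
begin

section \<open>Representations with an explicit carrier\<close>

text \<open>Quotients and direct sums of modules live on carriers that are not whole types, so the
  modules entering the formal characters are records. Only the action of the elements of
  the Lie subalgebra under consideration matters in \<open>act\<close>.\<close>

record ('g, 'v) rep =
  car :: "'v set"
  add :: "'v \<Rightarrow> 'v \<Rightarrow> 'v"
  zero :: 'v
  smul :: "complex \<Rightarrow> 'v \<Rightarrow> 'v"
  act :: "'g \<Rightarrow> 'v \<Rightarrow> 'v"

primrec lincomb :: "('g, 'v) rep \<Rightarrow> (nat \<Rightarrow> complex) \<Rightarrow> (nat \<Rightarrow> 'v) \<Rightarrow> nat \<Rightarrow> 'v" where
  "lincomb A c b 0 = zero A"
| "lincomb A c b (Suc n) = add A (lincomb A c b n) (smul A (c n) (b n))"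

definition is_basis :: "('g, 'v) rep \<Rightarrow> 'v set \<Rightarrow> (nat \<Rightarrow> 'v) \<Rightarrow> nat \<Rightarrow> bool" where
  "is_basis A U b n \<longleftrightarrow> (\<forall>i<n. b i \<in> U) \<and>
     (\<forall>v\<in>U. \<exists>!c. (\<forall>i\<ge>n. c i = 0) \<and> v = lincomb A c b n)"

definition finite_dim :: "('g, 'v) rep \<Rightarrow> 'v set \<Rightarrow> bool" where
  "finite_dim A U \<longleftrightarrow> (\<exists>n b. is_basis A U b n)"

definition rep_dim :: "('g, 'v) rep \<Rightarrow> 'v set \<Rightarrow> nat" where
  "rep_dim A U = (THE n. \<exists>b. is_basis A U b n)"

definition sub_rep ::
  "(complex \<Rightarrow> 'v \<Rightarrow> 'v) \<Rightarrow> ('g \<Rightarrow> 'v \<Rightarrow> 'v) \<Rightarrow> 'v set \<Rightarrow> ('g, 'v::ab_group_add) rep" where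
  "sub_rep sc ac V = \<lparr>car = V, add = (+), zero = 0, smul = sc, act = ac\<rparr>"

definition coset :: "'v::ab_group_add set \<Rightarrow> 'v \<Rightarrow> 'v set" where
  "coset W v = {v + w | w. w \<in> W}"

definition quot_rep ::
  "(complex \<Rightarrow> 'v \<Rightarrow> 'v) \<Rightarrow> ('g \<Rightarrow> 'v \<Rightarrow> 'v) \<Rightarrow> 'v set \<Rightarrow> 'v set
    \<Rightarrow> ('g, 'v::ab_group_add set) rep" where
  "quot_rep sc ac V W =
     \<lparr>car = coset W ` V,
      add = (\<lambda>A B. {a + b | a b. a \<in> A \<and> b \<in> B}),
      zero = W,
      smul = (\<lambda>c A. {sc c a + w | a w. a \<in> A \<and> w \<in> W}),
      act = (\<lambda>x A. {ac x a + w | a w. a \<in> A \<and> w \<in> W})\<rparr>"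

definition direct_sum_rep :: "(nat \<Rightarrow> ('g, 'v) rep) \<Rightarrow> ('g, nat \<Rightarrow> 'v) rep" where
  "direct_sum_rep A =
     \<lparr>car = {f. (\<forall>k. f k \<in> car (A k)) \<and> finite {k. f k \<noteq> zero (A k)}},
      add = (\<lambda>f g k. add (A k) (f k) (g k)),
      zero = (\<lambda>k. zero (A k)),
      smul = (\<lambda>c f k. smul (A k) c (f k)),
      act = (\<lambda>x f k. act (A k) x (f k))\<rparr>"


section \<open>Finite-dimensional complex Lie algebras\<close>

locale complex_lie_algebra = vector_space scale
  for scale :: "complex \<Rightarrow> 'g::ab_group_add \<Rightarrow> 'g" (infixr \<open>*s\<close> 75) +
  fixes br :: "'g \<Rightarrow> 'g \<Rightarrow> 'g"
  assumes finite_dimensional: "\<exists>B. finite B \<and> span B = UNIV"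
    and br_add_left: "br (x + y) z = br x z + br y z"
    and br_scale_left: "br (c *s x) z = c *s br x z"
    and br_add_right: "br z (x + y) = br z x + br z y"
    and br_scale_right: "br z (c *s x) = c *s br z x"
    and br_self: "br x x = 0"
    and jacobi: "br x (br y z) + br y (br z x) + br z (br x y) = 0"
begin

definition subalgebra :: "'g set \<Rightarrow> bool" where
  "subalgebra k \<longleftrightarrow> subspace k \<and> (\<forall>x\<in>k. \<forall>y\<in>k. br x y \<in> k)"

definition ideal_of :: "'g set \<Rightarrow> 'g set \<Rightarrow> bool" where
  "ideal_of k I \<longleftrightarrow> subspace I \<and> I \<subseteq> k \<and> (\<forall>x\<in>k. \<forall>y\<in>I. br x y \<in> I)"

definition derived :: "'g set \<Rightarrow> 'g set" where
  "derived k = span {br x y | x y. x \<in> k \<and> y \<in> k}"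

definition solvable :: "'g set \<Rightarrow> bool" where
  "solvable k \<longleftrightarrow> (\<exists>n. (derived ^^ n) k = {0})"

text \<open>The sum of all solvable ideals, which is the largest solvable ideal.\<close>

definition radical :: "'g set \<Rightarrow> 'g set" where
  "radical k = span (\<Union>{I. ideal_of k I \<and> solvable I})"

definition center :: "'g set \<Rightarrow> 'g set" where
  "center k = {x\<in>k. \<forall>y\<in>k. br x y = 0}"

definition semisimple :: bool where
  "semisimple \<longleftrightarrow> radical UNIV = {0}"

definition reductive :: "'g set \<Rightarrow> bool" where
  "reductive k \<longleftrightarrow> subalgebra k \<and> radical k = center k"

definition lin_trace :: "('g \<Rightarrow> 'g) \<Rightarrow> complex" where
  "lin_trace T = (let B = (SOME B. independent B \<and> span B = UNIV)
                  in \<Sum>b\<in>B. representation B (T b) b)"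

definition killing :: "'g \<Rightarrow> 'g \<Rightarrow> complex" where
  "killing x y = lin_trace (\<lambda>z. br x (br y z))"

definition nondegenerate_on :: "'g set \<Rightarrow> bool" where
  "nondegenerate_on k \<longleftrightarrow> (\<forall>x\<in>k. (\<forall>y\<in>k. killing x y = 0) \<longrightarrow> x = 0)"

text \<open>A Cartan involution of the complex Lie algebra, regarded as a real Lie algebra, is a
  real-linear involutive automorphism for which \<open>(x, y) \<mapsto> - B (x, \<theta> y)\<close> is positive definite,
  where \<open>B\<close> is the Killing form of the real Lie algebra; \<open>B = 2 Re (killing)\<close>.\<close>

definition cartan_involution :: "('g \<Rightarrow> 'g) \<Rightarrow> bool" where
  "cartan_involution \<theta> \<longleftrightarrow>
     (\<forall>x y. \<theta> (x + y) = \<theta> x + \<theta> y) \<and>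
     (\<forall>r x. \<theta> (complex_of_real r *s x) = complex_of_real r *s \<theta> x) \<and>
     (\<forall>x y. \<theta> (br x y) = br (\<theta> x) (\<theta> y)) \<and>
     (\<forall>x. \<theta> (\<theta> x) = x) \<and>
     (\<forall>x. x \<noteq> 0 \<longrightarrow> - Re (killing x (\<theta> x)) > 0)"

definition abelian_subalgebra :: "'g set \<Rightarrow> bool" where
  "abelian_subalgebra k \<longleftrightarrow> subspace k \<and> (\<forall>x\<in>k. \<forall>y\<in>k. br x y = 0)"

text \<open>Cartan subalgebras of complex semisimple Lie algebras as in Helgason: maximal abelian
  subalgebras all of whose elements are ad-semisimple.\<close>

definition cartan_subalgebra :: "'g set \<Rightarrow> bool" where
  "cartan_subalgebra t \<longleftrightarrow> abelian_subalgebra t \<and>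
     (\<forall>s. abelian_subalgebra s \<longrightarrow> t \<subseteq> s \<longrightarrow> s = t) \<and>
     (\<forall>H\<in>t. span {x. \<exists>c. br H x = c *s x} = UNIV)"

text \<open>A linear functional on the subspace \<open>t\<close> is represented by its extension by zero to a
  function on the whole type, so that equality of functionals is equality of functions.\<close>

definition dual :: "'g set \<Rightarrow> ('g \<Rightarrow> complex) set" where
  "dual t = {\<mu>. (\<forall>x\<in>t. \<forall>y\<in>t. \<mu> (x + y) = \<mu> x + \<mu> y) \<and>
                (\<forall>c. \<forall>x\<in>t. \<mu> (c *s x) = c * \<mu> x) \<and> (\<forall>x. x \<notin> t \<longrightarrow> \<mu> x = 0)}"

definition root_space :: "'g set \<Rightarrow> ('g \<Rightarrow> complex) \<Rightarrow> 'g set" where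
  "root_space t \<alpha> = {x. \<forall>H\<in>t. br H x = \<alpha> H *s x}"

definition roots :: "'g set \<Rightarrow> ('g \<Rightarrow> complex) set" where
  "roots t = {\<alpha> \<in> dual t. \<alpha> \<noteq> 0 \<and> root_space t \<alpha> \<noteq> {0}}"

definition real_root_span :: "'g set \<Rightarrow> ('g \<Rightarrow> complex) set" where
  "real_root_span t = {(\<lambda>H. \<Sum>\<alpha>\<in>roots t. complex_of_real (c \<alpha>) * \<alpha> H) | c. True}"

text \<open>Positive systems are given by a notion of positivity on the real span of the roots, as
  in Knapp.\<close>

definition positive_system :: "'g set \<Rightarrow> ('g \<Rightarrow> complex) set \<Rightarrow> bool" where
  "positive_system t P \<longleftrightarrow> (\<exists>pos.
     (\<forall>\<phi>\<in>real_root_span t. \<phi> \<noteq> 0 \<longrightarrow> pos \<phi> \<noteq> pos (- \<phi>)) \<and>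
     (\<forall>\<phi>\<in>real_root_span t. \<forall>\<psi>\<in>real_root_span t. pos \<phi> \<longrightarrow> pos \<psi> \<longrightarrow> pos (\<phi> + \<psi>)) \<and>
     (\<forall>\<phi>\<in>real_root_span t. \<forall>r>0. pos \<phi> \<longrightarrow> pos (\<lambda>H. complex_of_real r * \<phi> H)) \<and>
     P = {\<alpha> \<in> roots t. pos \<alpha>})"

definition is_rep :: "'g set \<Rightarrow> ('g, 'v) rep \<Rightarrow> bool" where
  "is_rep k A \<longleftrightarrow>
     zero A \<in> car A \<and>
     (\<forall>u\<in>car A. \<forall>v\<in>car A. add A u v \<in> car A \<and> add A u v = add A v u) \<and>
     (\<forall>u\<in>car A. \<forall>v\<in>car A. \<forall>w\<in>car A. add A (add A u v) w = add A u (add A v w)) \<and>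
     (\<forall>v\<in>car A. add A (zero A) v = v \<and> (\<exists>u\<in>car A. add A u v = zero A)) \<and>
     (\<forall>c. \<forall>v\<in>car A. smul A c v \<in> car A) \<and>
     (\<forall>c. \<forall>u\<in>car A. \<forall>v\<in>car A. smul A c (add A u v) = add A (smul A c u) (smul A c v)) \<and>
     (\<forall>c d. \<forall>v\<in>car A. smul A (c + d) v = add A (smul A c v) (smul A d v)) \<and>
     (\<forall>c d. \<forall>v\<in>car A. smul A c (smul A d v) = smul A (c * d) v) \<and>
     (\<forall>v\<in>car A. smul A 1 v = v) \<and>
     (\<forall>x\<in>k. \<forall>v\<in>car A. act A x v \<in> car A) \<and>
     (\<forall>x\<in>k. \<forall>u\<in>car A. \<forall>v\<in>car A. act A x (add A u v) = add A (act A x u) (act A x v)) \<and>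
     (\<forall>x\<in>k. \<forall>c. \<forall>v\<in>car A. act A x (smul A c v) = smul A c (act A x v)) \<and>
     (\<forall>x\<in>k. \<forall>y\<in>k. \<forall>v\<in>car A. act A (x + y) v = add A (act A x v) (act A y v)) \<and>
     (\<forall>c. \<forall>x\<in>k. \<forall>v\<in>car A. act A (c *s x) v = smul A c (act A x v)) \<and>
     (\<forall>x\<in>k. \<forall>y\<in>k. \<forall>v\<in>car A.
        act A x (act A y v) = add A (act A (br x y) v) (act A y (act A x v)))"

definition rep_weight_space :: "'g set \<Rightarrow> ('g, 'v) rep \<Rightarrow> ('g \<Rightarrow> complex) \<Rightarrow> 'v set" where
  "rep_weight_space t A \<mu> = {v \<in> car A. \<forall>H\<in>t. act A H v = smul A (\<mu> H) v}"

text \<open>The modules admitted in formal differences. Weight spaces for distinct weights are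
  independent, so it suffices to require that they span.\<close>

definition admissible :: "'g set \<Rightarrow> 'g set \<Rightarrow> ('g, 'v) rep \<Rightarrow> bool" where
  "admissible k t A \<longleftrightarrow> is_rep k A \<and>
     (\<forall>v\<in>car A. \<exists>n b. (\<forall>i<n. \<exists>\<mu>\<in>dual t. b i \<in> rep_weight_space t A \<mu>) \<and>
                      v = lincomb A (\<lambda>_. 1) b n) \<and>
     (\<forall>\<mu>\<in>dual t. finite_dim A (rep_weight_space t A \<mu>))"

text \<open>The equality \<open>A - B = C - E\<close> of virtual \<open>k\<close>-modules.\<close>

definition virtual_eq :: "'g set \<Rightarrow> 'g set \<Rightarrow> ('g, 'v) rep \<Rightarrow> ('g, 'v) rep
    \<Rightarrow> ('g, 'w) rep \<Rightarrow> ('g, 'w) rep \<Rightarrow> bool" where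
  "virtual_eq k t A B C E \<longleftrightarrow>
     admissible k t A \<and> admissible k t B \<and> admissible k t C \<and> admissible k t E \<and>
     (\<forall>\<mu>\<in>dual t.
        int (rep_dim A (rep_weight_space t A \<mu>)) - int (rep_dim B (rep_weight_space t B \<mu>)) =
        int (rep_dim C (rep_weight_space t C \<mu>)) - int (rep_dim E (rep_weight_space t E \<mu>)))"

end


section \<open>The pair \<open>(g, h)\<close> and the spin module\<close>

locale dirac_pair = complex_lie_algebra scale br
  for scale :: "complex \<Rightarrow> 'g::ab_group_add \<Rightarrow> 'g" (infixr \<open>*s\<close> 75)
    and br :: "'g \<Rightarrow> 'g \<Rightarrow> 'g" +
  fixes \<theta> :: "'g \<Rightarrow> 'g"
    and h t :: "'g set"
    and \<Delta>p :: "('g \<Rightarrow> complex) set"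
  assumes semisimple: semisimple
    and cartan_involution: "cartan_involution \<theta>"
    and reductive: "reductive h"
    and theta_stable: "\<theta> ` h \<subseteq> h"
    and nondegenerate: "nondegenerate_on h"
    and cartan: "cartan_subalgebra t" "t \<subseteq> h"
    and positive: "positive_system t \<Delta>p"
begin

definition q :: "'g set" where
  "q = {x. \<forall>y\<in>h. killing x y = 0}"

definition roots_q :: "('g \<Rightarrow> complex) set" where
  "roots_q = {\<alpha> \<in> roots t. root_space t \<alpha> \<subseteq> q}"

definition n_plus :: "'g set" where
  "n_plus = span (\<Union>\<alpha>\<in>\<Delta>p. root_space t \<alpha>)"

definition n_q_plus :: "'g set" where
  "n_q_plus = span (\<Union>\<beta>\<in>\<Delta>p \<inter> roots_q. root_space t \<beta>)"

definition n_q_minus :: "'g set" where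
  "n_q_minus = span (\<Union>\<beta>\<in>\<Delta>p \<inter> roots_q. root_space t (- \<beta>))"

end

text \<open>The exterior algebra of \<open>n_q_minus\<close> is written in the basis
  \<open>e\<^sub>I = y\<^sub>i\<^sub>1 \<and> \<dots> \<and> y\<^sub>i\<^sub>r\<close>, \<open>I = {i\<^sub>1 < \<dots> < i\<^sub>r}\<close>, coming from an arbitrary basis \<open>ys\<close> of
  \<open>n_q_minus\<close>. The list \<open>zs\<close> is an arbitrary orthonormal basis of \<open>q\<close>; its independence
  follows from orthonormality.\<close>

locale spin_data = dirac_pair scale br \<theta> h t \<Delta>p
  for scale :: "complex \<Rightarrow> 'g::ab_group_add \<Rightarrow> 'g" (infixr \<open>*s\<close> 75)
    and br :: "'g \<Rightarrow> 'g \<Rightarrow> 'g"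
    and \<theta> :: "'g \<Rightarrow> 'g"
    and h t :: "'g set"
    and \<Delta>p :: "('g \<Rightarrow> complex) set" +
  fixes ys zs :: "'g list"
  assumes basis_ys: "distinct ys" "independent (set ys)" "span (set ys) = n_q_minus"
    and basis_zs: "span (set zs) = q"
    and orthonormal_zs: "i < length zs \<Longrightarrow> j < length zs \<Longrightarrow>
          killing (zs ! i) (zs ! j) = (if i = j then 1 else 0)"
begin

text \<open>An element of the spin module is the function \<open>\<omega>\<close> of coefficients in
  \<open>\<Sum>I\<subseteq>{..<length ys}. \<omega> I e\<^sub>I\<close>; coefficients at other sets are irrelevant and
  are set to zero.\<close>

definition wedge :: "'g \<Rightarrow> (nat set \<Rightarrow> complex) \<Rightarrow> nat set \<Rightarrow> complex" where
  "wedge y \<omega> J = (if J \<subseteq> {..<length ys}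
     then \<Sum>i\<in>J. (-1) ^ card {j\<in>J. j < i} * representation (set ys) y (ys ! i) * \<omega> (J - {i})
     else 0)"

definition contract :: "'g \<Rightarrow> (nat set \<Rightarrow> complex) \<Rightarrow> nat set \<Rightarrow> complex" where
  "contract x \<omega> J = (if J \<subseteq> {..<length ys}
     then \<Sum>i\<in>{..<length ys} - J. (-1) ^ card {j\<in>J. j < i} * killing x (ys ! i) * \<omega> (insert i J)
     else 0)"

definition plus_part :: "'g \<Rightarrow> 'g" where
  "plus_part a = (THE x. x \<in> n_q_plus \<and> a - x \<in> n_q_minus)"

definition \<gamma> :: "'g \<Rightarrow> (nat set \<Rightarrow> complex) \<Rightarrow> nat set \<Rightarrow> complex" where
  "\<gamma> a \<omega> = contract (plus_part a) \<omega> + wedge (a - plus_part a) \<omega>"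

definition \<gamma>_cubic :: "(nat set \<Rightarrow> complex) \<Rightarrow> nat set \<Rightarrow> complex" where
  "\<gamma>_cubic \<omega> = (\<lambda>J. 1/6 * (\<Sum>i<length zs. \<Sum>j<length zs. \<Sum>k<length zs.
     killing (zs ! i) (br (zs ! j) (zs ! k)) * \<gamma> (zs ! i) (\<gamma> (zs ! j) (\<gamma> (zs ! k) \<omega>)) J))"

definition so_elem :: "'g \<Rightarrow> 'g \<Rightarrow> 'g \<Rightarrow> 'g" where
  "so_elem a b v = killing b v *s a - killing a v *s b"

text \<open>The composite of \<open>so(q) \<rightarrow> C(q) \<rightarrow> End(S)\<close>: the linear extension of
  \<open>so_elem a b \<mapsto> 1/2 [\<gamma> a, \<gamma> b]\<close>. Scalars need not appear since \<open>so_elem\<close> is bilinear.\<close>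

definition spin_lift :: "('g \<Rightarrow> 'g) \<Rightarrow> (nat set \<Rightarrow> complex) \<Rightarrow> nat set \<Rightarrow> complex" where
  "spin_lift A = (THE T. \<exists>ps. set ps \<subseteq> q \<times> q \<and>
     (\<forall>v\<in>q. A v = (\<Sum>(a, b)\<leftarrow>ps. so_elem a b v)) \<and>
     T = (\<lambda>\<omega> J. \<Sum>(a, b)\<leftarrow>ps. 1/2 * (\<gamma> a (\<gamma> b \<omega>) J - \<gamma> b (\<gamma> a \<omega>) J)))"

end


section \<open>Modules, Dirac operator and higher Dirac cohomology\<close>

locale dirac_module = spin_data scale br \<theta> h t \<Delta>p ys zs + M: vector_space scaleM
  for scale :: "complex \<Rightarrow> 'g::ab_group_add \<Rightarrow> 'g" (infixr \<open>*s\<close> 75)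
    and br :: "'g \<Rightarrow> 'g \<Rightarrow> 'g"
    and \<theta> :: "'g \<Rightarrow> 'g"
    and h t :: "'g set"
    and \<Delta>p :: "('g \<Rightarrow> complex) set"
    and ys zs :: "'g list"
    and scaleM :: "complex \<Rightarrow> 'm::ab_group_add \<Rightarrow> 'm" (infixr \<open>*m\<close> 75) +
  fixes \<pi> :: "'g \<Rightarrow> 'm \<Rightarrow> 'm"
  assumes act_add_right: "\<pi> x (u + v) = \<pi> x u + \<pi> x v"
    and act_scale_right: "\<pi> x (c *m v) = c *m \<pi> x v"
    and act_add_left: "\<pi> (x + y) v = \<pi> x v + \<pi> y v"
    and act_scale_left: "\<pi> (c *s x) v = c *m \<pi> x v"
    and act_br: "\<pi> (br x y) v = \<pi> x (\<pi> y v) - \<pi> y (\<pi> x v)"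
begin

definition submodule_over :: "'g set \<Rightarrow> 'm set \<Rightarrow> bool" where
  "submodule_over k N \<longleftrightarrow> M.subspace N \<and> (\<forall>x\<in>k. \<forall>v\<in>N. \<pi> x v \<in> N)"

definition generated :: "'g set \<Rightarrow> 'm set \<Rightarrow> 'm set" where
  "generated k G = \<Inter>{N. submodule_over k N \<and> G \<subseteq> N}"

definition weight_space :: "('g \<Rightarrow> complex) \<Rightarrow> 'm set" where
  "weight_space \<mu> = {v. \<forall>H\<in>t. \<pi> H v = \<mu> H *m v}"

definition category_O :: bool where
  "category_O \<longleftrightarrow>
     (\<exists>G. finite G \<and> generated UNIV G = UNIV) \<and>
     M.span (\<Union>\<mu>\<in>dual t. weight_space \<mu>) = UNIV \<and>
     (\<forall>v. \<exists>B. finite B \<and> generated n_plus {v} \<subseteq> M.span B)"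

text \<open>An element \<open>\<Sum>I. F I \<otimes> e\<^sub>I\<close> of the tensor product with the spin module is
  represented by \<open>F\<close>.\<close>

definition tensor_spin :: "(nat set \<Rightarrow> 'm) set" where
  "tensor_spin = {F. \<forall>I. F I \<noteq> 0 \<longrightarrow> I \<subseteq> {..<length ys}}"

definition tensor_spin_even :: "(nat set \<Rightarrow> 'm) set" where
  "tensor_spin_even = {F \<in> tensor_spin. \<forall>I. F I \<noteq> 0 \<longrightarrow> even (card I)}"

definition tensor_spin_odd :: "(nat set \<Rightarrow> 'm) set" where
  "tensor_spin_odd = {F \<in> tensor_spin. \<forall>I. F I \<noteq> 0 \<longrightarrow> odd (card I)}"

definition op_tensor :: "('m \<Rightarrow> 'm) \<Rightarrow> ((nat set \<Rightarrow> complex) \<Rightarrow> nat set \<Rightarrow> complex)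
    \<Rightarrow> (nat set \<Rightarrow> 'm) \<Rightarrow> nat set \<Rightarrow> 'm" where
  "op_tensor A T F = (\<lambda>J. \<Sum>I\<in>Pow {..<length ys}. T (\<lambda>K. if K = I then 1 else 0) J *m A (F I))"

definition tensor_scale :: "complex \<Rightarrow> (nat set \<Rightarrow> 'm) \<Rightarrow> nat set \<Rightarrow> 'm" where
  "tensor_scale c F = (\<lambda>I. c *m F I)"

definition tensor_act :: "'g \<Rightarrow> (nat set \<Rightarrow> 'm) \<Rightarrow> nat set \<Rightarrow> 'm" where
  "tensor_act x F = op_tensor (\<pi> x) id F + op_tensor id (spin_lift (br x)) F"

definition D :: "(nat set \<Rightarrow> 'm) \<Rightarrow> nat set \<Rightarrow> 'm" where
  "D F = (\<Sum>j<length zs. op_tensor (\<pi> (zs ! j)) (\<gamma> (zs ! j)) F) - op_tensor id \<gamma>_cubic F"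

definition ker_D :: "nat \<Rightarrow> (nat set \<Rightarrow> 'm) set" where
  "ker_D r = {F \<in> tensor_spin. (D ^^ r) F = 0}"

definition H_denominator :: "nat \<Rightarrow> (nat set \<Rightarrow> 'm) set" where
  "H_denominator k =
     {F + G | F G. F \<in> ker_D (2 * k + 1) \<inter> D ` tensor_spin \<and> G \<in> ker_D (2 * k)}"

definition H_top_deg :: "nat \<Rightarrow> ('g, (nat set \<Rightarrow> 'm) set) rep" where
  "H_top_deg k = quot_rep tensor_scale tensor_act (ker_D (2 * k + 1)) (H_denominator k)"

definition H_top :: "('g, nat \<Rightarrow> (nat set \<Rightarrow> 'm) set) rep" where
  "H_top = direct_sum_rep H_top_deg"

definition H_top_even :: "('g, nat \<Rightarrow> (nat set \<Rightarrow> 'm) set) rep" where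
  "H_top_even = H_top\<lparr>car := {f \<in> car H_top.
     \<forall>k. f k \<in> coset (H_denominator k) ` (ker_D (2 * k + 1) \<inter> tensor_spin_even)}\<rparr>"

definition H_top_odd :: "('g, nat \<Rightarrow> (nat set \<Rightarrow> 'm) set) rep" where
  "H_top_odd = H_top\<lparr>car := {f \<in> car H_top.
     \<forall>k. f k \<in> coset (H_denominator k) ` (ker_D (2 * k + 1) \<inter> tensor_spin_odd)}\<rparr>"

definition M_S_even :: "('g, nat set \<Rightarrow> 'm) rep" where
  "M_S_even = sub_rep tensor_scale tensor_act tensor_spin_even"

definition M_S_odd :: "('g, nat set \<Rightarrow> 'm) rep" where
  "M_S_odd = sub_rep tensor_scale tensor_act tensor_spin_odd"

end

end

theory Submission
  imports Defs "HOL-Library.Multiset"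
begin

text \<open>The Dirac operator \<open>D\<close> commutes with the diagonal action of \<open>h\<close> and exchanges the two parities, so
  the statement can be checked on the finite-dimensional weight spaces \<open>V\<^sub>\<mu> = V\<^sub>\<mu>\<^sup>+ \<oplus> V\<^sub>\<mu>\<^sup>-\<close> of
  \<open>M \<otimes> S\<close>. Write \<open>sdim\<close> for the difference of the dimensions of the even and the odd part and
  \<open>K\<^sub>r = ker D\<^sup>r\<close>. Applying rank-nullity to \<open>D : K\<^sub>r\<^sub>+\<^sub>1 \<rightarrow> K\<^sub>r \<inter> im D\<close> gives
  \<open>sdim H\<^sup>k = sdim K\<^sub>2\<^sub>k\<^sub>+\<^sub>2 - sdim K\<^sub>2\<^sub>k\<close>, which telescopes to \<open>sdim K\<^sub>2\<^sub>N\<close> for large \<open>N\<close>; and this is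
  \<open>sdim V\<^sub>\<mu>\<close> because \<open>D\<close> is injective and parity reversing on \<open>im D\<^sup>2\<^sup>N\<close>.

  The Cartan involution makes the Killing form nondegenerate, whence the root space decomposition.
  Root spaces are one-dimensional, so each lies in \<open>h\<close> or in \<open>q\<close> and \<open>q\<close> is the sum of the two
  isotropic subspaces on which \<open>\<gamma>\<close> is defined. Finiteness of the weight spaces of \<open>M\<close> follows from
  Dickson's lemma applied to the monomials in the negative root vectors.\<close>

section \<open>Finitely spanned subspaces\<close>

text \<open>The obstacle is that the objects compared live on infinite-dimensional carriers, while a
  count of dimensions needs one finite-dimensional space at a time. Two commutations make the
  reduction legitimate: the part of weight \<mu> of a quotient is the quotient of the parts of
  weight \<mu>, and a denominator element of weight \<mu> can be written with summands of weight
  \<mu>. Both rest on one fact about simultaneous eigenvectors: a stable subspace contains every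
  weight component of its elements. The exponent at which the kernels of the powers of
  \<open>D\<close> stop growing is found separately for each weight, so the direct sum over all
  degrees becomes a finite sum on each weight space without any uniform bound. A second obstacle is
  that the definitions speak of records and of sums over an arbitrary orthonormal basis. Records are
  handled once, by presenting a module as the image of a subspace of a genuine vector space. Basis
  sums are handled by the invariance of the tensor
  \<open>\<Sum>z\<^sub>j \<otimes> z\<^sub>j\<close> under skew maps, which enters the spin
  representation, the invariance of the cubic term and the equivariance of \<open>D\<close>.\<close>

text \<open>A copy of \<^locale>\<open>vector_space\<close>: definitions made in that locale itself would be shadowed by
  their instances for real vector spaces.\<close>

locale vspace = vector_space scale
  for scale :: "'a::field \<Rightarrow> 'b::ab_group_add \<Rightarrow> 'b"
begin

text \<open>Finiteness is attached to a subset because the ambient spaces are infinite-dimensional.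
  It cannot be read off from \<open>dim\<close>, which is 0 when a basis is infinite.\<close>

definition fin_span :: "'b set \<Rightarrow> bool" where
  "fin_span U \<longleftrightarrow> (\<exists>B. finite B \<and> U \<subseteq> span B)"

lemma fin_span_subset: "fin_span U \<Longrightarrow> W \<subseteq> U \<Longrightarrow> fin_span W"
  unfolding fin_span_def by blast

lemma fin_span_independent:
  assumes "fin_span U" "B \<subseteq> U" "independent B"
  shows "finite B"
proof -
  obtain C where "finite C" "U \<subseteq> span C" using assms(1) unfolding fin_span_def by blast
  then show ?thesis using independent_span_bound[of C B] assms by blast
qed

lemma fin_span_sums:
  assumes "fin_span U" "fin_span W"
  shows "fin_span {u + w | u w. u \<in> U \<and> w \<in> W}"
proof -
  obtain B C where "finite B" "U \<subseteq> span B" "finite C" "W \<subseteq> span C"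
    using assms unfolding fin_span_def by blast
  then have "finite (B \<union> C)" "{u + w | u w. u \<in> U \<and> w \<in> W} \<subseteq> span (B \<union> C)"
    unfolding span_Un by blast+
  then show ?thesis unfolding fin_span_def by blast
qed

text \<open>The coordinates of \<open>x\<close> over \<open>C\<close> vanish outside
  \<open>B\<close> and outside \<open>C - B\<close>, hence everywhere. This separates the new
  vectors of an extended basis from the old subspace.\<close>

lemma span_Diff_Int:
  assumes "independent C" "B \<subseteq> C" "x \<in> span B" "x \<in> span (C - B)"
  shows "x = 0"
proof -
  have "representation C x = (\<lambda>_. 0)"
  proof
    fix c
    have "representation C x = representation B x" "representation C x = representation (C - B) x"
      using representation_extend assms by blast+
    then show "representation C x c = 0"
      using representation_ne_zero[of B x c] representation_ne_zero[of "C - B" x c] by auto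
  qed
  moreover have "x \<in> span C" using assms span_mono by blast
  ultimately show ?thesis
    using sum_nonzero_representation_eq[OF assms(1)] by fastforce
qed

text \<open>A basis of \<open>W\<close> is extended to one of \<open>U\<close>; the added vectors
  span the complement. Later it supplies representatives for cohomology classes.\<close>

lemma complement_exists:
  assumes "subspace U" "subspace W" "W \<subseteq> U" "fin_span U"
  shows "\<exists>C. subspace C \<and> C \<subseteq> U \<and> C \<inter> W = {0} \<and> U = {c + w | c w. c \<in> C \<and> w \<in> W} \<and>
    dim C + dim W = dim U"
proof -
  obtain B where B: "B \<subseteq> W" "independent B" "W \<subseteq> span B"
    using maximal_independent_subset by blast
  obtain E where E: "B \<subseteq> E" "E \<subseteq> U" "independent E" "U \<subseteq> span E"
    using maximal_independent_subset_extend[of B U] B assms(3) by blast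
  have sB: "span B = W" using B assms(2) by (simp add: span_subspace)
  have sE: "span E = U" using E assms(1) by (simp add: span_subspace)
  have iE: "independent (E - B)" using E(3) independent_mono by blast
  have "span (E - B) \<inter> W = {0}"
    using span_Diff_Int[OF E(3) E(1)] sB span_zero[of "E - B"] span_zero[of B] by auto
  moreover have "U = {c + w | c w. c \<in> span (E - B) \<and> w \<in> W}"
    using span_Un[of "E - B" B] E(1) sE sB by (simp add: Un_absorb2)
  moreover have "dim (span (E - B)) + dim W = dim U"
  proof -
    have "finite E" using fin_span_independent assms(4) E by blast
    then have "card (E - B) + card B = card E"
      using E(1) by (metis card_Diff_subset card_mono finite_subset le_add_diff_inverse2)
    then show ?thesis
      using dim_span_eq_card_independent[OF iE] dim_span_eq_card_independent[OF B(2)]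
        dim_span_eq_card_independent[OF E(3)] sB sE by simp
  qed
  moreover have "span (E - B) \<subseteq> U" using span_mono[of "E - B" E] sE by blast
  ultimately show ?thesis by blast
qed

end

locale vspace_pair = vs1: vspace s1 + vs2: vspace s2
  for s1 :: "'a::field \<Rightarrow> 'b::ab_group_add \<Rightarrow> 'b"
  and s2 :: "'a::field \<Rightarrow> 'c::ab_group_add \<Rightarrow> 'c"

text \<open>Everything is counted in one basis \<open>E\<close> of \<open>U\<close> that extends a
  basis \<open>B\<close> of the kernel in \<open>U\<close>: \<open>f\<close> is injective on the
  span of \<open>E - B\<close>, and the images of these vectors span the image of
  \<open>U\<close>.\<close>

lemma (in vspace_pair) rank_nullity:
  assumes f: "Vector_Spaces.linear s1 s2 f" and U: "vs1.subspace U" "vs1.fin_span U"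
  shows "vs1.dim U = vs1.dim (U \<inter> {x. f x = 0}) + vs2.dim (f ` U)"
proof -
  interpret f: Vector_Spaces.linear s1 s2 f by fact
  have sub: "vs1.subspace (U \<inter> {x. f x = 0})"
    using vs1.subspace_inter[OF U(1) f.subspace_kernel] .
  obtain B where B: "B \<subseteq> U \<inter> {x. f x = 0}" "vs1.independent B" "U \<inter> {x. f x = 0} \<subseteq> vs1.span B"
    using vs1.maximal_independent_subset by blast
  obtain E where E: "B \<subseteq> E" "E \<subseteq> U" "vs1.independent E" "U \<subseteq> vs1.span E"
    using vs1.maximal_independent_subset_extend[of B U] B by blast
  have fE: "finite E" using vs1.fin_span_independent U E by blast
  have sE: "vs1.span E = U" using E U(1) by (simp add: vs1.span_subspace)
  have iE: "vs1.independent (E - B)" using E(3) vs1.independent_mono by blast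
  have inj: "inj_on f (vs1.span (E - B))"
  proof (subst f.inj_on_iff_eq_0)
    show "vs1.subspace (vs1.span (E - B))" by simp
    show "\<forall>x\<in>vs1.span (E - B). f x = 0 \<longrightarrow> x = 0"
    proof (intro ballI impI)
      fix x assume x: "x \<in> vs1.span (E - B)" "f x = 0"
      have "x \<in> U" using x(1) vs1.span_mono[of "E - B" E] sE by blast
      then have "x \<in> vs1.span B" using B(3) x(2) by blast
      then show "x = 0" using vs1.span_Diff_Int[OF E(3) E(1)] x(1) by blast
    qed
  qed
  have "vs2.independent (f ` (E - B))"
    using f.independent_injective_image[OF iE inj] .
  moreover have "f ` U \<subseteq> vs2.span (f ` (E - B))"
  proof -
    have "f ` E \<subseteq> insert 0 (f ` (E - B))" using B(1) by auto
    then have "vs2.span (f ` E) \<subseteq> vs2.span (f ` (E - B))"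
      using vs2.span_mono vs2.span_insert_0 by metis
    then show ?thesis using f.span_image[of E] sE by simp
  qed
  moreover have "f ` (E - B) \<subseteq> f ` U" using E(2) by blast
  ultimately have "vs2.dim (f ` U) = card (f ` (E - B))" using vs2.basis_card_eq_dim by metis
  also have "\<dots> = card (E - B)"
    by (rule card_image) (rule inj_on_subset[OF inj vs1.span_superset])
  finally have "vs2.dim (f ` U) = card (E - B)" .
  moreover have "vs1.dim (U \<inter> {x. f x = 0}) = card B"
    using vs1.basis_card_eq_dim[OF B(1) B(3) B(2)] by simp
  moreover have "vs1.dim U = card E" using vs1.basis_card_eq_dim[OF E(2) E(4) E(3)] by simp
  moreover have "card E = card B + card (E - B)"
    using fE E(1) by (metis add_diff_inverse_nat card_Diff_subset card_mono finite_subset leD)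
  ultimately show ?thesis by simp
qed

context vspace
begin

lemma vspace_pair_self: "vspace_pair scale scale"
  by unfold_locales

lemmas rank_nullity_self = vspace_pair.rank_nullity[OF vspace_pair_self]

lemma fin_span_image:
  assumes "vspace s2" "Vector_Spaces.linear scale s2 f" "fin_span U"
  shows "vspace.fin_span s2 (f ` U)"
proof -
  interpret vs2: vspace s2 by fact
  interpret f: Vector_Spaces.linear scale s2 f by fact
  obtain B where "finite B" "U \<subseteq> span B" using assms(3) unfolding fin_span_def by blast
  then have "finite (f ` B)" "f ` U \<subseteq> vs2.span (f ` B)" using f.span_image[of B] by auto
  then show ?thesis unfolding vs2.fin_span_def by blast
qed

lemma dim_mono_fin:
  assumes "subspace U" "subspace W" "W \<subseteq> U" "fin_span U"
  shows "dim W \<le> dim U"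
  using complement_exists[OF assms] by auto

text \<open>Every subspace is a kernel. This replaces a quotient space: a dimension count modulo
  \<open>W\<close> becomes rank-nullity for an endomorphism.\<close>

lemma exists_linear_with_kernel:
  assumes "subspace W"
  shows "\<exists>f. Vector_Spaces.linear scale scale f \<and> {x. f x = 0} = W"
proof -
  interpret p: vector_space_pair scale scale by unfold_locales
  obtain B where B: "B \<subseteq> W" "independent B" "W \<subseteq> span B"
    using maximal_independent_subset by blast
  have sB: "span B = W" using B assms by (simp add: span_subspace)
  define E where "E = extend_basis B"
  have E: "B \<subseteq> E" "independent E" "span E = UNIV"
    unfolding E_def using B(2) extend_basis_superset independent_extend_basis by auto
  \<comment> \<open>The projection along \<open>W\<close> onto the span of the added vectors: it
    kills \<open>B\<close> and fixes \<open>E - B\<close>, so that \<open>x - f x\<close> always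
    lies in \<open>W\<close>.\<close>
  define f where "f = p.construct E (\<lambda>b. if b \<in> B then 0 else b)"
  have lin: "Vector_Spaces.linear scale scale f"
    unfolding f_def by (rule p.linear_construct[OF E(2)])
  interpret f: Vector_Spaces.linear scale scale f by (rule lin)
  have fb: "f b = (if b \<in> B then 0 else b)" if "b \<in> E" for b
    unfolding f_def using p.construct_basis[OF E(2) that] .
  have "x - f x \<in> W" for x
  proof -
    have "x \<in> span E" using E(3) by simp
    then show ?thesis
    proof (induct rule: span_induct_alt)
      case base
      show ?case using assms subspace_0 by simp
    next
      case (step c x y)
      have "x - f x \<in> W" using fb[OF step(1)] B(1) assms subspace_0 by auto
      then have "scale c (x - f x) + (y - f y) \<in> W"
        using step(2) assms subspace_add subspace_scale by blast
      then show ?case by (simp add: f.add f.scale scale_right_diff_distrib algebra_simps)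
    qed
  qed
  then have "{x. f x = 0} \<subseteq> W" by (metis (mono_tags, lifting) diff_zero mem_Collect_eq subsetI)
  moreover have "f x = 0" if "x \<in> W" for x
  proof (rule f.eq_0_on_span)
    show "x \<in> span B" using sB that by simp
    show "\<And>b. b \<in> B \<Longrightarrow> f b = 0" using fb E(1) by auto
  qed
  ultimately show ?thesis using lin by blast
qed

text \<open>For a map with kernel \<open>B\<close>, the sum of the two spaces and \<open>A\<close>
  have the same image, while their kernels are \<open>B\<close> and \<open>A \<inter> B\<close>;
  comparing the two rank formulas gives the claim.\<close>

lemma dim_sums_Int_fin:
  assumes "subspace A" "subspace B" "fin_span A" "fin_span B"
  shows "dim {a + b | a b. a \<in> A \<and> b \<in> B} + dim (A \<inter> B) = dim A + dim B"
proof -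
  obtain f where f: "Vector_Spaces.linear scale scale f" "{x. f x = 0} = B"
    using exists_linear_with_kernel[OF assms(2)] by blast
  interpret f: Vector_Spaces.linear scale scale f by fact
  let ?S = "{a + b | a b. a \<in> A \<and> b \<in> B}"
  have S: "subspace ?S" using subspace_sums assms by blast
  have SB: "?S \<inter> B = B"
  proof
    show "B \<subseteq> ?S \<inter> B"
    proof
      fix b assume "b \<in> B"
      moreover from this have "0 + b \<in> ?S" using subspace_0[OF assms(1)] by blast
      ultimately show "b \<in> ?S \<inter> B" by simp
    qed
  qed simp
  have "f ` ?S = f ` A"
  proof
    have "f (a + b) = f a" if "b \<in> B" for a b using that f(2) f.add by auto
    then show "f ` ?S \<subseteq> f ` A" by auto
    show "f ` A \<subseteq> f ` ?S"
      using subspace_0[OF assms(2)] by (force intro!: imageI)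
  qed
  moreover have "dim ?S = dim B + dim (f ` ?S)"
    using rank_nullity_self[OF f(1) S] fin_span_sums[OF assms(3,4)] f(2) SB by simp
  moreover have "dim A = dim (A \<inter> B) + dim (f ` A)"
    using rank_nullity_self[OF f(1) assms(1,3)] f(2) by simp
  ultimately show ?thesis by simp
qed

end


section \<open>Weight vectors of families of operators\<close>

text \<open>Instances are the actions of \<open>t\<close> on the Lie algebra, on the module, on its
  tensor product with the spin module and on sequences in the latter, and also a single operator
  with its eigenvalues as weights.\<close>

locale weight_ops = vspace scale
  for scale :: "'a::field \<Rightarrow> 'b::ab_group_add \<Rightarrow> 'b" +
  fixes opr :: "'h \<Rightarrow> 'b \<Rightarrow> 'b" and T :: "'h set" and \<Lambda> :: "('h \<Rightarrow> 'a) set"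
  assumes lin: "H \<in> T \<Longrightarrow> Vector_Spaces.linear scale scale (opr H)"
    and sep: "a \<in> \<Lambda> \<Longrightarrow> b \<in> \<Lambda> \<Longrightarrow> (\<And>H. H \<in> T \<Longrightarrow> a H = b H) \<Longrightarrow> a = b"
begin

definition wt :: "('h \<Rightarrow> 'a) \<Rightarrow> 'b set" where
  "wt \<mu> = {x. \<forall>H\<in>T. opr H x = scale (\<mu> H) x}"

lemma subspace_wt: "subspace (wt \<mu>)"
proof (rule subspaceI)
  show "0 \<in> wt \<mu>"
    unfolding wt_def using module_hom.zero[OF Vector_Spaces.linear.axioms(3)[OF lin]] by simp
qed (auto simp: wt_def scale_right_distrib Vector_Spaces.linear_iff[THEN iffD1, OF lin]
     scale_left_commute)

definition stable :: "'b set \<Rightarrow> bool" where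
  "stable N \<longleftrightarrow> subspace N \<and> (\<forall>H\<in>T. \<forall>x\<in>N. opr H x \<in> N)"

text \<open>Subtracting from an operator its eigenvalue on \<open>v c\<close> removes that summand,
  rescales the others and keeps the sum in \<open>N\<close>. The operator is chosen so that the
  factor at the wanted summand is not 0.\<close>

lemma stable_wt_component:
  assumes "finite A" "A \<subseteq> \<Lambda>" "stable N"
    and "\<And>a. a \<in> A \<Longrightarrow> v a \<in> wt a" "(\<Sum>a\<in>A. v a) \<in> N" "a \<in> A"
  shows "v a \<in> N"
  using assms(1,2,4,5,6)
proof (induction A arbitrary: v a rule: finite_induct)
  case (insert c A)
  have N: "subspace N" using assms(3) unfolding stable_def by blast
  have *: "v b \<in> N" if b: "b \<in> A" for b
  proof -
    have "b \<noteq> c" using b insert.hyps by blast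
    then obtain H where H: "H \<in> T" "b H \<noteq> c H" using sep insert.prems(1) b by blast
    interpret H: Vector_Spaces.linear scale scale "opr H" by (rule lin[OF H(1)])
    have w: "opr H (v d) = scale (d H) (v d)" if "d \<in> insert c A" for d
      using insert.prems(2)[OF that] H(1) unfolding wt_def by blast
    let ?S = "\<Sum>a\<in>insert c A. v a"
    have "opr H ?S - scale (c H) ?S \<in> N"
      using insert.prems(3) assms(3) H(1) N subspace_diff subspace_scale unfolding stable_def by blast
    moreover have "opr H ?S - scale (c H) ?S = (\<Sum>d\<in>insert c A. scale (d H - c H) (v d))"
      unfolding H.sum scale_sum_right sum_subtractf[symmetric]
      by (rule sum.cong) (simp_all add: w scale_left_diff_distrib)
    ultimately have "(\<Sum>d\<in>A. scale (d H - c H) (v d)) \<in> N" using insert.hyps by simp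
    moreover have "scale (d H - c H) (v d) \<in> wt d" if "d \<in> A" for d
      using subspace_wt insert.prems(2) that subspace_scale by blast
    ultimately have "scale (b H - c H) (v b) \<in> N"
      using insert.IH[of "\<lambda>d. scale (d H - c H) (v d)" b] insert.prems(1) b by blast
    then have "scale (inverse (b H - c H)) (scale (b H - c H) (v b)) \<in> N"
      using N subspace_scale by blast
    then show ?thesis using H(2) by simp
  qed
  have "v c = (\<Sum>a\<in>insert c A. v a) - (\<Sum>a\<in>A. v a)" using insert.hyps by simp
  moreover have "(\<Sum>a\<in>A. v a) \<in> N" using * N subspace_sum by blast
  ultimately have "v c \<in> N" using insert.prems(3) N subspace_diff by metis
  then show ?case using * insert.prems(4) by blast
qed simp

text \<open>Grouping a linear combination by weight keeps each component in the span of the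
  generators of that very weight. This is sharper than a decomposition into weight vectors and is
  what bounds weight spaces.\<close>

lemma span_wt_decomposition:
  assumes "G \<subseteq> (\<Union>\<nu>\<in>\<Lambda>. wt \<nu>)" "x \<in> span G"
  shows "\<exists>A v. finite A \<and> A \<subseteq> \<Lambda> \<and> (\<forall>a\<in>A. v a \<in> span (G \<inter> wt a)) \<and> x = (\<Sum>a\<in>A. v a)"
proof -
  obtain F c where F: "finite F" "F \<subseteq> G" "x = (\<Sum>g\<in>F. scale (c g) g)"
    using assms(2) unfolding span_explicit by blast
  have "\<forall>g\<in>F. \<exists>\<nu>. \<nu> \<in> \<Lambda> \<and> g \<in> wt \<nu>" using F(2) assms(1) by blast
  then obtain w where w: "\<And>g. g \<in> F \<Longrightarrow> w g \<in> \<Lambda> \<and> g \<in> wt (w g)" by metis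
  define v where "v \<nu> = (\<Sum>g\<in>{g\<in>F. w g = \<nu>}. scale (c g) g)" for \<nu>
  have "x = (\<Sum>a\<in>w ` F. v a)"
    unfolding F(3) v_def by (rule sum.image_gen[OF F(1)])
  moreover have "v a \<in> span (G \<inter> wt a)" for a
    unfolding v_def using w F(2) by (intro span_sum span_scale span_base) auto
  moreover have "w ` F \<subseteq> \<Lambda>" using w by blast
  ultimately show ?thesis using F(1) by blast
qed

lemma wt_Int:
  assumes "a \<in> \<Lambda>" "b \<in> \<Lambda>" "x \<in> wt a" "x \<in> wt b" "a \<noteq> b"
  shows "x = 0"
proof -
  obtain H where H: "H \<in> T" "a H \<noteq> b H" using sep assms by blast
  then have "scale (a H) x = scale (b H) x" using assms(3,4) unfolding wt_def by auto
  then show ?thesis using H by simp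
qed

lemma stable_wt: "stable (wt \<mu>)"
  unfolding stable_def using subspace_wt subspace_scale unfolding wt_def
  by (auto simp: Vector_Spaces.linear_iff[THEN iffD1, OF lin])

text \<open>The ambient space provides weight components of a vector of \<open>N\<close>; stability
  puts each of them back into \<open>N\<close>.\<close>

lemma stable_subset_span:
  assumes "stable N" "G \<subseteq> (\<Union>\<nu>\<in>\<Lambda>. wt \<nu>)" "N \<subseteq> span G"
  shows "N \<subseteq> span (\<Union>\<nu>\<in>\<Lambda>. N \<inter> wt \<nu>)"
proof
  fix x assume x: "x \<in> N"
  obtain A v where A: "finite A" "A \<subseteq> \<Lambda>" "\<forall>a\<in>A. v a \<in> span (G \<inter> wt a)" "x = (\<Sum>a\<in>A. v a)"
    using span_wt_decomposition[OF assms(2)] x assms(3) by blast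
  have v: "v a \<in> wt a" if "a \<in> A" for a
    using A(3) that span_minimal[of "G \<inter> wt a" "wt a"] subspace_wt by blast
  have "v a \<in> N" if "a \<in> A" for a
    using stable_wt_component[OF A(1,2) assms(1)] v that x A(4) by blast
  then show "x \<in> span (\<Union>\<nu>\<in>\<Lambda>. N \<inter> wt \<nu>)"
    unfolding A(4) using v A(2) by (intro span_sum span_base) blast
qed

text \<open>All components of \<open>x\<close> lie in the stable subspace \<open>wt \<mu>\<close>,
  so those of other weights are 0 and only generators of weight \<mu> remain. In this way a weight
  space inherits finiteness from a spanning set.\<close>

lemma wt_subset_span:
  assumes "G \<subseteq> (\<Union>\<nu>\<in>\<Lambda>. wt \<nu>)" "\<mu> \<in> \<Lambda>" "x \<in> span G" "x \<in> wt \<mu>"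
  shows "x \<in> span (G \<inter> wt \<mu>)"
proof -
  obtain A v where A: "finite A" "A \<subseteq> \<Lambda>" "\<forall>a\<in>A. v a \<in> span (G \<inter> wt a)" "x = (\<Sum>a\<in>A. v a)"
    using span_wt_decomposition[OF assms(1,3)] by blast
  have v: "v a \<in> wt a" if "a \<in> A" for a
    using A(3) that span_minimal[of "G \<inter> wt a" "wt a"] subspace_wt by blast
  have "v a \<in> wt \<mu>" if "a \<in> A" for a
    using stable_wt_component[OF A(1,2) stable_wt] v that assms(4) A(4) by blast
  then have 0: "v a = 0" if "a \<in> A" "a \<noteq> \<mu>" for a
    using wt_Int v that A(2) assms(2) by blast
  have "x = (\<Sum>a\<in>A \<inter> {\<mu>}. v a)"
    unfolding A(4) by (rule sum.mono_neutral_right) (use A(1) 0 in auto)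
  also have "\<dots> \<in> span (G \<inter> wt \<mu>)" using A(3) by (intro span_sum) auto
  finally show ?thesis .
qed

end


section \<open>The index of an odd operator\<close>

locale odd_operator = vspace scale
  for scale :: "'a::field \<Rightarrow> 'b::ab_group_add \<Rightarrow> 'b" +
  fixes V :: "bool \<Rightarrow> 'b set" and D :: "'b \<Rightarrow> 'b"
  assumes lin: "Vector_Spaces.linear scale scale D"
    and subspace_V: "subspace (V s)" and fin_V: "fin_span (V s)"
    and odd: "x \<in> V s \<Longrightarrow> D x \<in> V (\<not> s)"
begin

sublocale D: Vector_Spaces.linear scale scale D by (rule lin)

definition K :: "nat \<Rightarrow> bool \<Rightarrow> 'b set" where
  "K r s = V s \<inter> {x. (D ^^ r) x = 0}"

text \<open>The denominator of degree \<open>k\<close> cut down to one parity; the boundaries come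
  from the opposite parity because \<open>D\<close> is odd.\<close>

definition den :: "nat \<Rightarrow> bool \<Rightarrow> 'b set" where
  "den k s = {x + y | x y. x \<in> K (2 * k + 1) s \<inter> D ` V (\<not> s) \<and> y \<in> K (2 * k) s}"

lemma linear_funpow: "Vector_Spaces.linear scale scale (D ^^ r)"
proof (induction r)
  case 0
  show ?case using linear_id by (simp add: id_def)
next
  case (Suc r)
  show ?case using Vector_Spaces.linear_compose[OF Suc lin] by (simp add: comp_def)
qed

lemma subspace_K: "subspace (K r s)"
proof -
  interpret r: Vector_Spaces.linear scale scale "D ^^ r" by (rule linear_funpow)
  show ?thesis unfolding K_def using subspace_inter[OF subspace_V r.subspace_kernel] .
qed

lemma fin_K: "fin_span (K r s)"
  using fin_V fin_span_subset unfolding K_def by blast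

lemma K_0: "K 0 s = {0}"
  unfolding K_def using subspace_0[OF subspace_V] by auto

lemma K_Suc_mono: "K r s \<subseteq> K (Suc r) s"
  unfolding K_def by (auto simp: D.zero)

text \<open>The kernel of \<open>D\<close> on the source is \<open>K 1 s\<close> for every
  \<open>r\<close>, a constant that cancels when two consecutive cases are subtracted.\<close>

lemma dim_K_Suc: "dim (K (Suc r) s) = dim (K 1 s) + dim (K r (\<not> s) \<inter> D ` V s)"
proof -
  have "K (Suc r) s \<inter> {x. D x = 0} = K 1 s"
  proof -
    have "(D ^^ r) 0 = 0" by (induction r) (simp_all add: D.zero)
    then show ?thesis unfolding K_def by (auto simp: funpow_Suc_right simp del: funpow.simps)
  qed
  moreover have "D ` K (Suc r) s = K r (\<not> s) \<inter> D ` V s"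
    unfolding K_def using odd by (auto simp: funpow_Suc_right simp del: funpow.simps)
  ultimately show ?thesis
    using rank_nullity_self[OF lin subspace_K fin_K, of "Suc r" s] by simp
qed

text \<open>The two summands of \<open>den\<close> meet in the part of \<open>K (2 * k) s\<close>
  that lies in the image of \<open>D\<close>. Both intersections with this image are measured by
  \<open>dim_K_Suc\<close> at the opposite parity, for \<open>2 * k\<close> and
  \<open>2 * k + 1\<close>, and the two copies of the dimension of \<open>K 1\<close>
  cancel.\<close>

lemma dim_den:
  "dim (den k s) + dim (K (2 * k + 1) (\<not> s)) = dim (K (2 * k + 2) (\<not> s)) + dim (K (2 * k) s)"
proof -
  have sub: "subspace (D ` V s)" for s using D.subspace_image[OF subspace_V] .
  have "K (2 * k + 1) s \<inter> D ` V (\<not> s) \<inter> K (2 * k) s = K (2 * k) s \<inter> D ` V (\<not> s)"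
    using K_Suc_mono[of "2 * k" s] by auto
  then have "dim (den k s) + dim (K (2 * k) s \<inter> D ` V (\<not> s)) =
      dim (K (2 * k + 1) s \<inter> D ` V (\<not> s)) + dim (K (2 * k) s)"
    unfolding den_def
    using dim_sums_Int_fin[of "K (2 * k + 1) s \<inter> D ` V (\<not> s)" "K (2 * k) s",
      OF subspace_inter[OF subspace_K sub] subspace_K fin_span_subset[OF fin_K Int_lower1] fin_K]
    by simp
  then show ?thesis
    using dim_K_Suc[of "2 * k" "\<not> s"] dim_K_Suc[of "2 * k + 1" "\<not> s"] by simp
qed

lemma subspace_den: "subspace (den k s)"
  unfolding den_def
  by (intro subspace_sums subspace_inter subspace_K D.subspace_image subspace_V)

lemma den_subset: "den k s \<subseteq> K (2 * k + 1) s"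
proof
  fix z assume "z \<in> den k s"
  then obtain x y where "z = x + y" "x \<in> K (2 * k + 1) s" "y \<in> K (2 * k) s"
    unfolding den_def by blast
  then show "z \<in> K (2 * k + 1) s"
    using K_Suc_mono[of "2 * k" s] subspace_add[OF subspace_K] by auto
qed

lemma K_mono: "r \<le> r' \<Longrightarrow> K r s \<subseteq> K r' s"
  using lift_Suc_mono_le[of "\<lambda>r. K r s"] K_Suc_mono by blast

text \<open>The dimensions are bounded by that of \<open>V s\<close>; where the maximum is reached,
  a complement of \<open>K R s\<close> in a later kernel has dimension 0. The larger of two indices
  serves both parities.\<close>

lemma K_stabilizes: "\<exists>R. \<forall>r\<ge>R. \<forall>s. K r s = K R s"
proof -
  have "\<exists>R. \<forall>r\<ge>R. K r s = K R s" for s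
  proof -
    have fin: "finite (range (\<lambda>r. dim (K r s)))"
    proof (rule finite_subset)
      show "range (\<lambda>r. dim (K r s)) \<subseteq> {..dim (V s)}"
        using dim_mono_fin[OF subspace_V subspace_K] fin_V unfolding K_def by auto
    qed simp
    then have "Max (range (\<lambda>r. dim (K r s))) \<in> range (\<lambda>r. dim (K r s))" using Max_in by blast
    then obtain R where R: "dim (K R s) = Max (range (\<lambda>r. dim (K r s)))" by (auto simp del: Max_in)
    have "K r s = K R s" if le: "r \<ge> R" for r
    proof -
      have "dim (K r s) \<le> dim (K R s)" unfolding R using fin by simp
      moreover obtain C where C: "subspace C" "C \<subseteq> K r s" "K r s = {c + w |c w. c \<in> C \<and> w \<in> K R s}"
        "dim C + dim (K R s) = dim (K r s)"
        using complement_exists[OF subspace_K subspace_K _ fin_K, of R s r s] K_mono[OF le] by blast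
      ultimately have "dim C = 0" by simp
      then have "C \<subseteq> {0}"
      proof -
        obtain B where B: "B \<subseteq> C" "independent B" "C \<subseteq> span B" "card B = dim C"
          using basis_exists by blast
        have "finite B" using fin_span_independent[OF fin_K] B C(2) by blast
        then have "B = {}" using B(4) \<open>dim C = 0\<close> by simp
        then show ?thesis using B(3) by simp
      qed
      then have "C = {0}" using C(1) subspace_0 by blast
      then show ?thesis using C(3) by simp
    qed
    then show ?thesis by blast
  qed
  then obtain R where R: "\<And>s r. r \<ge> R s \<Longrightarrow> K r s = K (R s) s" by metis
  have "K r s = K (max (R True) (R False)) s" if "r \<ge> max (R True) (R False)" for r s
    using that R[of s r] R[of s "max (R True) (R False)"] by (cases s) auto
  then show ?thesis by blast
qed

text \<open>By the first clause the degrees from \<open>N\<close> on contribute nothing, so the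
  finite sums are the full index. The truncated subtraction is harmless because \<open>den\<close>
  is a subspace of the kernel.\<close>

theorem index_formula:
  "\<exists>N. (\<forall>k\<ge>N. \<forall>s. den k s = K (2 * k + 1) s) \<and>
    (\<Sum>k<N. int (dim (K (2 * k + 1) s) - dim (den k s))) -
    (\<Sum>k<N. int (dim (K (2 * k + 1) (\<not> s)) - dim (den k (\<not> s)))) =
      int (dim (V s)) - int (dim (V (\<not> s)))"
proof -
  obtain R where R: "\<And>r s. r \<ge> R \<Longrightarrow> K r s = K R s" using K_stabilizes by blast
  have "den k s = K (2 * k + 1) s" if "k \<ge> R" for k s
  proof -
    have "K (2 * k) s \<subseteq> den k s"
    proof
      fix y assume "y \<in> K (2 * k) s"
      moreover have "0 \<in> K (2 * k + 1) s \<inter> D ` V (\<not> s)"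
        using subspace_0 subspace_K D.subspace_image[OF subspace_V] by blast
      ultimately have "0 + y \<in> den k s" unfolding den_def by blast
      then show "y \<in> den k s" by simp
    qed
    moreover have "K (2 * k) s = K (2 * k + 1) s" using R[of "2 * k" s] R[of "2 * k + 1" s] that by simp
    ultimately show ?thesis using den_subset by blast
  qed
  moreover
  have step: "int (dim (K (2 * k + 1) s) - dim (den k s)) -
      int (dim (K (2 * k + 1) (\<not> s)) - dim (den k (\<not> s))) =
      (int (dim (K (2 * Suc k) s)) - int (dim (K (2 * Suc k) (\<not> s)))) -
      (int (dim (K (2 * k) s)) - int (dim (K (2 * k) (\<not> s))))" for k
    using dim_den[of k s] dim_den[of k "\<not> s"] dim_mono_fin[OF subspace_K subspace_den den_subset fin_K, of k s]
      dim_mono_fin[OF subspace_K subspace_den den_subset fin_K, of k "\<not> s"]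
    by (simp add: of_nat_diff)
  have "(\<Sum>k<N. int (dim (K (2 * k + 1) s) - dim (den k s))) -
      (\<Sum>k<N. int (dim (K (2 * k + 1) (\<not> s)) - dim (den k (\<not> s)))) =
      int (dim (K (2 * N) s)) - int (dim (K (2 * N) (\<not> s)))" for N
  proof (induction N)
    case 0
    show ?case by (simp add: K_0)
  next
    case (Suc N)
    then show ?case using step[of N] by simp
  qed
  moreover have "int (dim (K (2 * R) s)) - int (dim (K (2 * R) (\<not> s))) =
      int (dim (V s)) - int (dim (V (\<not> s)))"
  proof -
    let ?E = "D ^^ (2 * R)"
    interpret E: Vector_Spaces.linear scale scale ?E by (rule linear_funpow)
    have dV: "dim (V s) = dim (K (2 * R) s) + dim (?E ` V s)" for s
      using rank_nullity_self[OF linear_funpow subspace_V fin_V] unfolding K_def .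
    have sub: "subspace (?E ` V s)" for s using E.subspace_image[OF subspace_V] .
    have fin: "fin_span (?E ` V s)" for s
      using fin_span_image[OF vspace_axioms linear_funpow fin_V] .
    \<comment> \<open>\<open>D\<close> maps the image of \<open>?E\<close> in one parity injectively
      into that of the other; the inequality for \<open>s\<close> and for its negation gives
      equality.\<close>
    have "dim (?E ` V s) \<le> dim (?E ` V (\<not> s))" for s
    proof -
      have "?E ` V s \<inter> {x. D x = 0} = {0}"
      proof -
        \<comment> \<open>If \<open>D\<close> kills \<open>?E v\<close>, then \<open>v\<close> lies
          in the next kernel; the kernels have stopped growing, so \<open>?E v\<close> was already
          0.\<close>
        have "?E v = 0" if "v \<in> V s" "D (?E v) = 0" for v
        proof -
          have "v \<in> K (Suc (2 * R)) s" using that unfolding K_def by simp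
          then have "v \<in> K (2 * R) s" using R[of "Suc (2 * R)" s] R[of "2 * R" s] by simp
          then show ?thesis unfolding K_def by simp
        qed
        then show ?thesis using subspace_0[OF sub] by (auto simp: D.zero)
      qed
      moreover have "dim {0} = 0" using dim_span_eq_card_independent[OF independent_empty] by simp
      ultimately have "dim (?E ` V s) = dim (D ` ?E ` V s)"
        using rank_nullity_self[OF lin sub fin, of s] by simp
      also have "\<dots> \<le> dim (?E ` V (\<not> s))"
      proof (rule dim_mono_fin[OF sub _ _ fin])
        show "subspace (D ` ?E ` V s)" using D.subspace_image[OF sub] .
        have "D (?E v) = ?E (D v)" for v by (simp add: funpow_swap1)
        then show "D ` ?E ` V s \<subseteq> ?E ` V (\<not> s)" using odd by auto
      qed
      finally show ?thesis .
    qed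
    from this[of s] this[of "\<not> s"] dV[of s] dV[of "\<not> s"] show ?thesis by simp
  qed
  ultimately show ?thesis by (intro exI[of _ R]) auto
qed

end


section \<open>Dickson's lemma\<close>

text \<open>There is a monotone subsequence, and a decreasing one in the naturals is constant from
  the place of its minimum on.\<close>

lemma nat_seq_incseq_subseq:
  fixes s :: "nat \<Rightarrow> nat"
  shows "\<exists>r. strict_mono r \<and> incseq (\<lambda>n. s (r n))"
proof -
  obtain r :: "nat \<Rightarrow> nat" where r: "strict_mono r" "monoseq (\<lambda>n. s (r n))"
    using seq_monosub by blast
  show ?thesis
  proof (cases "incseq (\<lambda>n. s (r n))")
    case False
    then have dec: "\<And>m n. m \<le> n \<Longrightarrow> s (r n) \<le> s (r m)"
      using r(2) unfolding monoseq_iff decseq_def by blast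
    obtain N where N: "\<And>n. s (r N) \<le> s (r n)"
      using ex_has_least_nat[of "\<lambda>_. True" 0 "\<lambda>n. s (r n)"] by blast
    have "s (r (n + N)) = s (r N)" for n using N[of "n + N"] dec[of N "n + N"] by simp
    moreover have "strict_mono (\<lambda>n. r (n + N))"
      using r(1) unfolding strict_mono_def by simp
    ultimately show ?thesis by (auto intro!: exI[of _ "\<lambda>n. r (n + N)"] simp: incseq_def)
  qed (use r in blast)
qed

lemma common_incseq_subseq:
  fixes f :: "nat \<Rightarrow> 'x \<Rightarrow> nat"
  assumes "finite A"
  shows "\<exists>r. strict_mono r \<and> (\<forall>a\<in>A. incseq (\<lambda>n. f (r n) a))"
  using assms
proof (induction A rule: finite_induct)
  case empty
  show ?case using strict_mono_id by (auto intro!: exI[of _ id])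
next
  case (insert b A)
  then obtain r where r: "strict_mono r" "\<forall>a\<in>A. incseq (\<lambda>n. f (r n) a)" by blast
  obtain r' where r': "strict_mono r'" "incseq (\<lambda>n. f (r (r' n)) b)"
    using nat_seq_incseq_subseq[of "\<lambda>n. f (r n) b"] by blast
  have "strict_mono (\<lambda>n. r (r' n))" using r(1) r'(1) by (simp add: strict_mono_def)
  moreover have "incseq (\<lambda>n. f (r (r' n)) a)" if "a \<in> A" for a
    using r(2) that strict_mono_mono[OF r'(1)] by (simp add: incseq_def mono_def)
  ultimately show ?case using r'(2) by blast
qed

text \<open>An infinite family would have a sequence of distinct members along which every
  multiplicity weakly increases, and two terms of it would be comparable.\<close>

lemma finite_multiset_antichain:
  assumes "finite A" "\<And>M. M \<in> S \<Longrightarrow> set_mset M \<subseteq> A"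
    and antichain: "\<And>M N. M \<in> S \<Longrightarrow> N \<in> S \<Longrightarrow> M \<subseteq># N \<Longrightarrow> M = N"
  shows "finite S"
proof (rule ccontr)
  assume "infinite S"
  then obtain f :: "nat \<Rightarrow> 'a multiset" where f: "inj f" "range f \<subseteq> S"
    using infinite_countable_subset by blast
  obtain r where r: "strict_mono r" "\<forall>a\<in>A. incseq (\<lambda>n. count (f (r n)) a)"
    using common_incseq_subseq[OF assms(1), of "\<lambda>n. count (f n)"] by blast
  have "f (r 0) \<subseteq># f (r 1)"
  proof (rule mset_subset_eqI)
    fix a
    show "count (f (r 0)) a \<le> count (f (r 1)) a"
    proof (cases "a \<in> A")
      case True
      then show ?thesis using r(2) by (simp add: incseq_def)
    next
      case False
      then have "a \<notin># f (r 0)" using assms(2) f(2) by blast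
      then show ?thesis by (simp add: not_in_iff)
    qed
  qed
  then have "f (r 0) = f (r 1)" using antichain f(2) by blast
  then have "r 0 = r 1" using f(1) by (simp add: inj_def)
  then show False using strict_monoD[OF r(1), of 0 1] by simp
qed


section \<open>Trace and Killing form\<close>

context complex_lie_algebra
begin

sublocale vs: vspace scale by unfold_locales

lemma br_zero [simp]: "br x 0 = 0" "br 0 x = 0"
  using br_scale_right[of x 0 0] br_scale_left[of 0 0 x] by simp_all

lemma br_anti: "br x y = - br y x"
proof -
  have "br (x + y) (x + y) = br x x + br y y + (br x y + br y x)"
    by (simp add: br_add_left br_add_right algebra_simps)
  then show ?thesis by (simp add: br_self eq_neg_iff_add_eq_0)
qed

lemma linear_br: "Vector_Spaces.linear scale scale (br x)"
  by unfold_locales (simp_all add: br_add_right br_scale_right)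

lemma br_minus_left: "br (- x) y = - br x y"
  using br_scale_left[of "-1" x y] by simp

lemma br_minus_right: "br x (- y) = - br x y"
  using br_scale_right[of x "-1" y] by simp

lemma br_diff_right: "br y (x - x') = br y x - br y x'"
  using br_add_right[of y x "- x'"] by (simp add: br_minus_right)

lemma br_br: "br (br x y) z = br x (br y z) - br y (br x z)"
proof -
  have "br z (br x y) = - br (br x y) z" "br y (br z x) = - br y (br x z)"
    using br_anti[of z "br x y"] br_anti[of z x] br_minus_right by simp_all
  then show ?thesis using jacobi[of x y z] by (simp add: algebra_simps)
qed

text \<open>The basis chosen inside \<open>lin_trace\<close>, named so that traces can be computed;
  every trace uses this same basis.\<close>

definition trace_basis :: "'g set" where
  "trace_basis = (SOME B. independent B \<and> span B = UNIV)"

lemma trace_basis: "independent trace_basis" "span trace_basis = UNIV" "finite trace_basis"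
proof -
  have "\<exists>B. independent B \<and> span B = UNIV"
    using maximal_independent_subset[of UNIV] by (metis top.extremum_uniqueI)
  then have "independent trace_basis \<and> span trace_basis = UNIV"
    unfolding trace_basis_def by (rule someI_ex)
  moreover obtain C where "finite C" "span C = UNIV" using finite_dimensional by blast
  ultimately show "independent trace_basis" "span trace_basis = UNIV" "finite trace_basis"
    using independent_span_bound by auto
qed

lemma fin_span_any: "vs.fin_span U"
  unfolding vs.fin_span_def using trace_basis by auto

lemma lin_trace_eq: "lin_trace T = (\<Sum>b\<in>trace_basis. representation trace_basis (T b) b)"
  unfolding lin_trace_def trace_basis_def Let_def ..

lemma representation_add': "representation trace_basis (x + y) b =
    representation trace_basis x b + representation trace_basis y b"
  using representation_add[OF trace_basis(1), of y x] trace_basis(2) by simp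

lemma representation_scale': "representation trace_basis (c *s x) b =
    c * representation trace_basis x b"
  using representation_scale[OF trace_basis(1), of x c] trace_basis(2) by simp

lemma lin_trace_add: "lin_trace (\<lambda>z. S z + T z) = lin_trace S + lin_trace T"
  unfolding lin_trace_eq by (simp add: representation_add' sum.distrib)

lemma lin_trace_scale: "lin_trace (\<lambda>z. c *s T z) = c * lin_trace T"
  unfolding lin_trace_eq by (simp add: representation_scale' sum_distrib_left)

text \<open>Expanding \<open>T b\<close> in the basis writes the trace as a double sum of products
  of matrix entries, which is symmetric in the two maps.\<close>

lemma lin_trace_commute:
  assumes "Vector_Spaces.linear scale scale S" "Vector_Spaces.linear scale scale T"
  shows "lin_trace (\<lambda>z. S (T z)) = lin_trace (\<lambda>z. T (S z))"
proof -
  let ?B = trace_basis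
  let ?r = "representation ?B"
  have eq: "lin_trace (\<lambda>z. S (T z)) = (\<Sum>b\<in>?B. \<Sum>c\<in>?B. ?r (T b) c * ?r (S c) b)"
    if "Vector_Spaces.linear scale scale S" for S T
  proof -
    interpret S: Vector_Spaces.linear scale scale S by fact
    have "?r (S (T b)) b = (\<Sum>c\<in>?B. ?r (T b) c * ?r (S c) b)" for b
    proof -
      have "(\<Sum>c\<in>?B. ?r (T b) c *s c) = T b"
        using sum_representation_eq[OF trace_basis(1) _ trace_basis(3) order_refl, of "T b"]
          trace_basis(2) by simp
      then have "S (T b) = (\<Sum>c\<in>?B. ?r (T b) c *s S c)"
        using S.sum[of "\<lambda>c. ?r (T b) c *s c" ?B] by (simp add: S.scale)
      then show ?thesis
        using representation_sum[OF trace_basis(1), of ?B "\<lambda>c. ?r (T b) c *s S c"]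
        by (simp add: trace_basis(2) representation_scale')
    qed
    then show ?thesis unfolding lin_trace_eq by simp
  qed
  show ?thesis
    unfolding eq[OF assms(1)] eq[OF assms(2)]
    by (subst sum.swap) (simp add: mult.commute)
qed

lemma killing_add_left: "killing (x + x') y = killing x y + killing x' y"
  unfolding killing_def by (simp add: br_add_left lin_trace_add)

lemma killing_scale_left: "killing (c *s x) y = c * killing x y"
  unfolding killing_def by (simp add: br_scale_left lin_trace_scale)

lemma killing_sym: "killing x y = killing y x"
  unfolding killing_def by (rule lin_trace_commute[OF linear_br linear_br])

lemma killing_add_right: "killing y (x + x') = killing y x + killing y x'"
  using killing_add_left killing_sym by simp

lemma killing_scale_right: "killing y (c *s x) = c * killing y x"
  using killing_scale_left killing_sym by simp

text \<open>The adjoint map of \<open>br x y\<close> is a commutator, and under the trace the factor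
  belonging to \<open>y\<close> can be moved cyclically from the front to the end.\<close>

lemma killing_br: "killing (br x y) z = killing x (br y z)"
proof -
  have neg: "lin_trace (\<lambda>w. S w - T w) = lin_trace S - lin_trace T" for S T
    using lin_trace_add[of S "\<lambda>w. (-1) *s T w"] lin_trace_scale[of "-1" T] by simp
  have yz: "Vector_Spaces.linear scale scale (\<lambda>w. br x (br z w))"
    using Vector_Spaces.linear_compose[OF linear_br linear_br] by (simp add: comp_def)
  have "killing (br x y) z = lin_trace (\<lambda>w. br x (br y (br z w))) - lin_trace (\<lambda>w. br y (br x (br z w)))"
    unfolding killing_def by (simp add: br_br neg)
  also have "lin_trace (\<lambda>w. br y (br x (br z w))) = lin_trace (\<lambda>w. br x (br z (br y w)))"
    by (rule lin_trace_commute[OF linear_br yz])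
  also have "lin_trace (\<lambda>w. br x (br y (br z w))) - lin_trace (\<lambda>w. br x (br z (br y w))) =
      killing x (br y z)"
    unfolding killing_def by (simp add: br_br br_diff_right neg)
  finally show ?thesis .
qed

lemma killing_zero [simp]: "killing 0 y = 0" "killing y 0 = 0"
  using killing_scale_left[of 0 0 y] killing_scale_right[of y 0 0] by simp_all

lemma killing_minus: "killing (- x) y = - killing x y" "killing y (- x) = - killing y x"
  using killing_scale_left[of "-1" x y] killing_scale_right[of y "-1" x] by simp_all

lemma killing_diff: "killing (x - x') y = killing x y - killing x' y"
    "killing y (x - x') = killing y x - killing y x'"
  using killing_add_left[of x "- x'" y] killing_add_right[of y x "- x'"]
  by (simp_all add: killing_minus)

lemma killing_sum: "killing (sum f A) y = (\<Sum>a\<in>A. killing (f a) y)"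
    "killing y (sum f A) = (\<Sum>a\<in>A. killing y (f a))"
  by (induction A rule: infinite_finite_induct) (simp_all add: killing_add_left killing_add_right)

lemma killing_span_zero:
  assumes "\<And>a. a \<in> S \<Longrightarrow> killing x a = 0" "y \<in> span S"
  shows "killing x y = 0"
proof -
  have "subspace {y. killing x y = 0}"
    by (rule subspaceI) (simp_all add: killing_add_right killing_scale_right)
  moreover have "S \<subseteq> {y. killing x y = 0}" using assms(1) by blast
  ultimately have "span S \<subseteq> {y. killing x y = 0}" by (rule span_minimal[rotated])
  then show ?thesis using assms(2) by blast
qed

lemma killing_skew: "killing (br x y) z = - killing y (br x z)"
  using killing_br[of y x z] br_anti[of x y] by (simp add: killing_minus)

text \<open>The computation in \<open>sl\<^sub>2\<close> (or, for \<open>a = 0\<close>, in the Heisenberg algebra) showing that a string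
  started at a vector annihilated by \<open>x\<close> cannot stop as long as the coefficients do not vanish.\<close>

lemma br_string:
  assumes "br (br x y) y = (- a) *s y" "br x v = 0" "br (br x y) v = l *s v"
  shows "br (br x y) ((br y ^^ n) v) = (l - of_nat n * a) *s (br y ^^ n) v"
    and "br x ((br y ^^ Suc n) v) = (\<Sum>k\<le>n. l - of_nat k * a) *s (br y ^^ n) v"
proof -
  have 1: "br (br x y) ((br y ^^ n) v) = (l - of_nat n * a) *s (br y ^^ n) v" for n
  proof (induction n)
    case (Suc n)
    have "br (br x y) (br y u) = br (br (br x y) y) u + br y (br (br x y) u)" for u
      using br_br[of "br x y" y u] by simp
    then have "br (br x y) ((br y ^^ Suc n) v) =
        (- a) *s (br y ^^ Suc n) v + (l - of_nat n * a) *s (br y ^^ Suc n) v"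
      using Suc by (simp add: assms(1) br_scale_left br_scale_right br_minus_left)
    moreover have "l - of_nat (Suc n) * a = - a + (l - of_nat n * a)" by (simp add: algebra_simps)
    ultimately show ?case by (simp only: scale_left_distrib)
  qed (simp add: assms)
  show "br (br x y) ((br y ^^ n) v) = (l - of_nat n * a) *s (br y ^^ n) v" by (rule 1)
  have xy: "br x (br y u) = br (br x y) u + br y (br x u)" for u
    using br_br[of x y u] by simp
  show "br x ((br y ^^ Suc n) v) = (\<Sum>k\<le>n. l - of_nat k * a) *s (br y ^^ n) v"
  proof (induction n)
    case 0
    show ?case by (simp add: xy assms)
  next
    case (Suc n)
    have "br x ((br y ^^ Suc (Suc n)) v) =
        br (br x y) ((br y ^^ Suc n) v) + br y (br x ((br y ^^ Suc n) v))"
      using xy[of "(br y ^^ Suc n) v"] by simp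
    then show ?case
      unfolding 1 Suc by (simp add: br_scale_right scale_left_distrib)
  qed
qed

text \<open>Applying \<open>x\<close> to the next vector of the string returns a nonzero multiple of
  the present one, so the string never stops. This is used to contradict the finiteness of the set
  of weights.\<close>

lemma br_string_nonzero:
  assumes "br (br x y) y = (- a) *s y" "br x v = 0" "br (br x y) v = l *s v" "v \<noteq> 0"
    and "\<And>n. (\<Sum>k\<le>n. l - of_nat k * a) \<noteq> 0"
  shows "(br y ^^ n) v \<noteq> 0"
proof (induction n)
  case (Suc n)
  then show ?case
    using br_string(2)[OF assms(1-3), of n] assms(5)[of n] by (metis br_zero(1) scale_eq_0_iff)
qed (simp add: assms)

end


section \<open>The root space decomposition\<close>

context dirac_pair
begin

lemma dual_ext:
  assumes "a \<in> dual t" "b \<in> dual t" "\<And>H. H \<in> t \<Longrightarrow> a H = b H"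
  shows "a = b"
proof
  fix H show "a H = b H" using assms unfolding dual_def by (cases "H \<in> t") auto
qed

lemma dual_zero: "0 \<in> dual t"
  unfolding dual_def by simp

lemma dual_add: "a \<in> dual t \<Longrightarrow> b \<in> dual t \<Longrightarrow> a + b \<in> dual t"
  unfolding dual_def by (auto simp: algebra_simps)

lemma dual_minus: "a \<in> dual t \<Longrightarrow> - a \<in> dual t"
  unfolding dual_def by auto

lemma dual_nat: "a \<in> dual t \<Longrightarrow> (\<lambda>H. of_nat n * a H) \<in> dual t"
  unfolding dual_def by (auto simp: ring_distribs)

sublocale ad: weight_ops scale br t "dual t"
  by unfold_locales (auto simp: br_add_right br_scale_right intro: dual_ext)

lemma wt_eq_root_space: "ad.wt \<mu> = root_space t \<mu>"
  unfolding ad.wt_def root_space_def ..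

lemma subspace_root_space: "subspace (root_space t \<mu>)"
  using ad.subspace_wt unfolding wt_eq_root_space .

section \<open>Simultaneous diagonalization of the Cartan subalgebra\<close>

lemma subspace_t: "subspace t"
  using cartan(1) unfolding cartan_subalgebra_def abelian_subalgebra_def by blast

lemma br_t: "H \<in> t \<Longrightarrow> H' \<in> t \<Longrightarrow> br H H' = 0"
  using cartan(1) unfolding cartan_subalgebra_def abelian_subalgebra_def by blast

text \<open>A joint eigenspace of \<open>S\<close> is stable under \<open>br H\<close>, because
  \<open>H\<close> commutes with \<open>S\<close>, and therefore splits into eigenspaces of the
  diagonalizable map \<open>br H\<close>.\<close>

lemma joint_eigenvectors_span:
  assumes "finite S" "S \<subseteq> t"
  shows "span {x. \<forall>H\<in>S. \<exists>c. br H x = c *s x} = UNIV"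
  using assms
proof (induction S rule: finite_induct)
  case (insert H S)
  let ?E = "{x. \<forall>K\<in>insert H S. \<exists>c. br K x = c *s x}"
  \<comment> \<open>A single operator as a family indexed by the unit type, so that its eigenspaces
    are weight spaces.\<close>
  interpret w: weight_ops scale "\<lambda>_::unit. br H" UNIV UNIV
    by unfold_locales (simp_all add: br_add_right br_scale_right fun_eq_iff)
  have H: "span {x. \<exists>c. br H x = c *s x} = UNIV"
    using cartan(1) insert.prems unfolding cartan_subalgebra_def by auto
  have "{x. \<forall>K\<in>S. \<exists>c. br K x = c *s x} \<subseteq> span ?E"
  proof
    fix x assume "x \<in> {x. \<forall>K\<in>S. \<exists>c. br K x = c *s x}"
    then have "\<forall>K\<in>S. \<exists>c. br K x = c *s x" by simp
    from bchoice[OF this] obtain c where "\<forall>K\<in>S. br K x = c K *s x" by blast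
    then have c: "\<And>K. K \<in> S \<Longrightarrow> br K x = c K *s x" by blast
    \<comment> \<open>The eigenvalues are fixed to those of \<open>x\<close>; with varying
      eigenvalues this would not be a subspace.\<close>
    define N where "N = {z. \<forall>K\<in>S. br K z = c K *s z}"
    have "subspace N"
      unfolding N_def by (rule subspaceI)
        (auto simp: br_add_right br_scale_right scale_right_distrib scale_left_commute)
    moreover have "br K (br H z) = c K *s br H z" if "z \<in> N" "K \<in> S" for K z
    proof -
      have "br K H = 0" using br_t insert.prems that by blast
      then show ?thesis
        using br_br[of K H z] that unfolding N_def by (simp add: br_scale_right)
    qed
    ultimately have "w.stable N" unfolding w.stable_def N_def by auto
    moreover have "{x. \<exists>c. br H x = c *s x} \<subseteq> (\<Union>\<nu>\<in>UNIV. w.wt \<nu>)"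
    proof
      fix y assume "y \<in> {x. \<exists>c. br H x = c *s x}"
      then obtain d where "br H y = d *s y" by blast
      then have "y \<in> w.wt (\<lambda>_. d)" unfolding w.wt_def by simp
      then show "y \<in> (\<Union>\<nu>\<in>UNIV. w.wt \<nu>)" by blast
    qed
    ultimately have "N \<subseteq> span (\<Union>\<nu>\<in>UNIV. N \<inter> w.wt \<nu>)"
      using w.stable_subset_span H by blast
    also have "\<dots> \<subseteq> span ?E"
    proof (rule span_mono)
      show "(\<Union>\<nu>\<in>UNIV. N \<inter> w.wt \<nu>) \<subseteq> ?E"
        unfolding N_def w.wt_def by auto
    qed
    finally show "x \<in> span ?E" unfolding N_def using c by blast
  qed
  then have "span {x. \<forall>K\<in>S. \<exists>c. br K x = c *s x} \<subseteq> span ?E"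
    using span_minimal subspace_span by blast
  then show ?case using insert by auto
qed simp

text \<open>A finite basis of \<open>t\<close> is diagonalized, and an eigenvector for the basis is
  one for all of \<open>t\<close>. The eigenvalues on a nonzero vector depend linearly on
  \<open>H\<close>, which makes them an element of \<open>dual t\<close>.\<close>

lemma root_spaces_span: "span (\<Union>\<alpha>\<in>dual t. root_space t \<alpha>) = UNIV"
proof -
  obtain S where S: "S \<subseteq> t" "independent S" "t \<subseteq> span S" using maximal_independent_subset by blast
  have "finite S" using vs.fin_span_independent[OF fin_span_any S(1,2)] .
  have "{x. \<forall>H\<in>S. \<exists>c. br H x = c *s x} \<subseteq> (\<Union>\<alpha>\<in>dual t. root_space t \<alpha>)"
  proof
    fix x assume "x \<in> {x. \<forall>H\<in>S. \<exists>c. br H x = c *s x}"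
    then have x: "\<And>H. H \<in> S \<Longrightarrow> \<exists>c. br H x = c *s x" by blast
    have ex: "\<exists>c. br H x = c *s x" if "H \<in> t" for H
    proof -
      have "H \<in> span S" using S that by blast
      then show ?thesis
      proof (induct rule: span_induct_alt)
        case base
        show ?case by (intro exI[of _ 0]) simp
      next
        case (step c y z)
        obtain d e where "br y x = d *s x" "br z x = e *s x" using x[OF step(1)] step(2) by blast
        then have "br (c *s y + z) x = (c * d + e) *s x"
          by (simp add: br_add_left br_scale_left scale_left_distrib)
        then show ?case by blast
      qed
    qed
    show "x \<in> (\<Union>\<alpha>\<in>dual t. root_space t \<alpha>)"
    proof (cases "x = 0")
      case True
      then show ?thesis using dual_zero subspace_0[OF subspace_root_space] by blast
    next
      case False
      have "\<forall>H\<in>t. \<exists>c. br H x = c *s x" using ex by blast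
      from bchoice[OF this] obtain c where "\<forall>H\<in>t. br H x = c H *s x" by blast
      then have c: "\<And>H. H \<in> t \<Longrightarrow> br H x = c H *s x" by blast
      define \<alpha> where "\<alpha> H = (if H \<in> t then c H else 0)" for H
      have "\<alpha> (H + K) = \<alpha> H + \<alpha> K" if "H \<in> t" "K \<in> t" for H K
      proof -
        have "c (H + K) *s x = (c H + c K) *s x"
          using c[of "H + K"] c[of H] c[of K] that subspace_add[OF subspace_t that]
          by (simp add: br_add_left scale_left_distrib)
        then show ?thesis
          using False that subspace_add[OF subspace_t that] unfolding \<alpha>_def
          by (metis scale_right_imp_eq)
      qed
      moreover have "\<alpha> (d *s H) = d * \<alpha> H" if "H \<in> t" for H d
      proof -
        have "c (d *s H) *s x = (d * c H) *s x"
          using c[of "d *s H"] c[of H] that subspace_scale[OF subspace_t that, of d]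
          by (metis br_scale_left scale_scale)
        then show ?thesis
          using False that subspace_scale[OF subspace_t that, of d] unfolding \<alpha>_def
          by (metis scale_right_imp_eq)
      qed
      ultimately have "\<alpha> \<in> dual t" unfolding dual_def by (auto simp: \<alpha>_def)
      moreover have "x \<in> root_space t \<alpha>" unfolding root_space_def \<alpha>_def using c by simp
      ultimately show ?thesis by blast
    qed
  qed
  from span_mono[OF this] show ?thesis
    unfolding joint_eigenvectors_span[OF \<open>finite S\<close> S(1)] by blast
qed

text \<open>An element commuting with \<open>t\<close> can be adjoined to \<open>t\<close> without
  losing commutativity, so maximality puts it into \<open>t\<close>.\<close>

lemma root_space_zero: "root_space t 0 = t"
proof
  show "t \<subseteq> root_space t 0" unfolding root_space_def using br_t by auto
  show "root_space t 0 \<subseteq> t"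
  proof
    fix x assume x: "x \<in> root_space t 0"
    have xt: "br H x = 0" if "H \<in> t" for H
    proof -
      have "br H x = 0 H *s x" using x that unfolding root_space_def by blast
      then show ?thesis by simp
    qed
    define s where "s = {H + c *s x | H c. H \<in> t}"
    have "s = span (insert x t)"
    proof -
      have "y \<in> s \<longleftrightarrow> (\<exists>k. y - k *s x \<in> t)" for y
      proof
        assume "\<exists>k. y - k *s x \<in> t"
        then obtain k where "y - k *s x \<in> t" by blast
        moreover have "y = (y - k *s x) + k *s x" by simp
        ultimately show "y \<in> s" unfolding s_def by (intro CollectI exI conjI)
      next
        assume "y \<in> s"
        then obtain H c where "H \<in> t" "y = H + c *s x" unfolding s_def by blast
        then show "\<exists>k. y - k *s x \<in> t" by (intro exI[of _ c]) simp
      qed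
      moreover have st: "span t = t" using subspace_t by simp
      ultimately show ?thesis unfolding span_insert st by blast
    qed
    then have "subspace s" by simp
    moreover have "br a b = 0" if ab: "a \<in> s" "b \<in> s" for a b
    proof -
      obtain H c K d where "a = H + c *s x" "b = K + d *s x" "H \<in> t" "K \<in> t"
        using ab unfolding s_def by blast
      then show ?thesis
        using xt[of H] xt[of K] br_t[of H K] br_anti[of x K]
        by (simp add: br_add_left br_add_right br_scale_left br_scale_right br_self)
    qed
    ultimately have "abelian_subalgebra s" unfolding abelian_subalgebra_def by blast
    moreover have "t \<subseteq> s"
    proof
      fix H assume "H \<in> t"
      moreover have "H = H + 0 *s x" by simp
      ultimately show "H \<in> s" unfolding s_def by blast
    qed
    ultimately have "s = t" using cartan(1) unfolding cartan_subalgebra_def by blast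
    moreover have "x = 0 + 1 *s x" by simp
    then have "x \<in> s" unfolding s_def using subspace_0[OF subspace_t] by blast
    ultimately show "x \<in> t" by simp
  qed
qed

section \<open>The Killing form on root spaces\<close>

lemma br_root_space:
  assumes "x \<in> root_space t a" "y \<in> root_space t b"
  shows "br x y \<in> root_space t (a + b)"
  unfolding root_space_def
proof (intro CollectI ballI)
  fix H assume H: "H \<in> t"
  have "br H (br x y) = br (br H x) y + br x (br H y)" using br_br[of H x y] by simp
  then show "br H (br x y) = (a + b) H *s br x y"
    using assms H unfolding root_space_def
    by (simp add: br_scale_left br_scale_right scale_left_distrib)
qed

text \<open>Invariance gives \<open>(a H + b H) * killing x y = 0\<close> for all \<open>H\<close>
  in \<open>t\<close>, and some \<open>H\<close> makes the first factor nonzero.\<close>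

lemma killing_root_spaces_orthogonal:
  assumes "a \<in> dual t" "b \<in> dual t" "b \<noteq> - a" "x \<in> root_space t a" "y \<in> root_space t b"
  shows "killing x y = 0"
proof -
  obtain H where H: "H \<in> t" "b H \<noteq> - a H"
    using dual_ext[OF assms(2) dual_minus[OF assms(1)]] assms(3) by auto
  have "a H * killing x y = - (b H * killing x y)"
    using killing_skew[of H x y] assms(4,5) H(1) unfolding root_space_def
    by (simp add: killing_scale_left killing_scale_right)
  then have "(a H + b H) * killing x y = 0" by (simp add: algebra_simps)
  then show ?thesis using H(2) by (simp add: add_eq_0_iff)
qed

lemma killing_nondegenerate:
  assumes "\<And>y. killing x y = 0"
  shows "x = 0"
proof (rule ccontr)
  assume "x \<noteq> 0"
  then have "- Re (killing x (\<theta> x)) > 0"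
    using cartan_involution unfolding cartan_involution_def by blast
  then show False using assms by simp
qed

text \<open>The root spaces for weights other than \<open>- a\<close> are orthogonal to
  \<open>x\<close> anyway; if that for \<open>- a\<close> were too, nondegeneracy would
  fail.\<close>

lemma killing_root_pairing:
  assumes "a \<in> dual t" "x \<in> root_space t a" "x \<noteq> 0"
  shows "\<exists>y\<in>root_space t (- a). killing x y \<noteq> 0"
proof (rule ccontr)
  assume "\<not> (\<exists>y\<in>root_space t (- a). killing x y \<noteq> 0)"
  then have neg: "killing x y = 0" if "y \<in> root_space t (- a)" for y using that by blast
  have "killing x y = 0" for y
  proof (rule killing_span_zero)
    show "y \<in> span (\<Union>\<alpha>\<in>dual t. root_space t \<alpha>)" using root_spaces_span by simp
    fix z assume "z \<in> (\<Union>\<alpha>\<in>dual t. root_space t \<alpha>)"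
    then obtain b where b: "b \<in> dual t" "z \<in> root_space t b" by blast
    show "killing x z = 0"
    proof (cases "b = - a")
      case True
      then show ?thesis using neg b(2) by simp
    next
      case False
      then show ?thesis using killing_root_spaces_orthogonal[OF assms(1) b(1) _ assms(2) b(2)] by simp
    qed
  qed
  then show False using killing_nondegenerate[of x] assms(3) by simp
qed


text \<open>A basis made of root vectors meets every nonzero root space, and different ones share
  only 0, so the weights inject into a finite basis. The zero weight is included because strings may
  pass through it.\<close>

lemma finite_weights: "finite {a \<in> dual t. root_space t a \<noteq> {0}}"
proof -
  obtain B where B: "B \<subseteq> (\<Union>\<alpha>\<in>dual t. root_space t \<alpha>)" "independent B"
    "(\<Union>\<alpha>\<in>dual t. root_space t \<alpha>) \<subseteq> span B"
    using maximal_independent_subset by blast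
  have fB: "finite B" using vs.fin_span_independent[OF fin_span_any subset_UNIV B(2)] .
  have "span B = UNIV" using span_minimal[OF B(3) subspace_span] unfolding root_spaces_span by blast
  have "\<exists>b. b \<in> B \<inter> root_space t a" if a: "a \<in> dual t" and nz: "root_space t a \<noteq> {0}" for a
  proof -
    obtain x where x: "x \<in> root_space t a" "x \<noteq> 0"
      using nz subspace_0[OF subspace_root_space] by blast
    then have "x \<in> span (B \<inter> root_space t a)"
      using ad.wt_subset_span[of B a x] a B(1) \<open>span B = UNIV\<close>
      unfolding wt_eq_root_space by blast
    then show ?thesis using x(2) by (cases "B \<inter> root_space t a = {}") auto
  qed
  then obtain b where b: "\<And>a. a \<in> dual t \<Longrightarrow> root_space t a \<noteq> {0} \<Longrightarrow> b a \<in> B \<inter> root_space t a"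
    by metis
  have "inj_on b {a \<in> dual t. root_space t a \<noteq> {0}}"
  proof (rule inj_onI, rule ccontr)
    fix a a' assume *: "a \<in> {a \<in> dual t. root_space t a \<noteq> {0}}"
      "a' \<in> {a \<in> dual t. root_space t a \<noteq> {0}}" "b a = b a'" "a \<noteq> a'"
    then have "b a = 0"
      using ad.wt_Int[of a a' "b a"] b[of a] b[of a'] unfolding wt_eq_root_space by auto
    moreover have "b a \<in> B" using b[of a] * by blast
    ultimately show False using dependent_zero B(2) by metis
  qed
  moreover have "b ` {a \<in> dual t. root_space t a \<noteq> {0}} \<subseteq> B" using b by blast
  ultimately show ?thesis using fB finite_imageD finite_subset by blast
qed

section \<open>Root strings and one-dimensional root spaces\<close>

lemma finite_roots: "finite (roots t)"
  by (rule finite_subset[OF _ finite_weights]) (auto simp: roots_def)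

text \<open>The vectors of the string have the weights \<open>b + n a\<close>, which are pairwise
  different, and only finitely many weights have nonzero vectors.\<close>

lemma string_terminates:
  assumes "a \<in> dual t" "a \<noteq> 0" "b \<in> dual t" "y \<in> root_space t a" "v \<in> root_space t b"
  shows "\<exists>n. (br y ^^ n) v = 0"
proof (rule ccontr)
  assume neg: "\<nexists>n. (br y ^^ n) v = 0"
  define w where "w n = b + (\<lambda>H. of_nat n * a H)" for n :: nat
  have "(br y ^^ n) v \<in> root_space t (w n)" for n
  proof (induction n)
    case 0
    have "w 0 = b" unfolding w_def by (rule ext) simp
    then show ?case using assms(5) by simp
  next
    case (Suc n)
    have "a + w n = w (Suc n)" unfolding w_def by (simp add: fun_eq_iff algebra_simps)
    then show ?case using br_root_space[OF assms(4) Suc] by simp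
  qed
  then have "range w \<subseteq> {c \<in> dual t. root_space t c \<noteq> {0}}"
    using neg dual_add[OF assms(3) dual_nat[OF assms(1)]] unfolding w_def by fastforce
  then have "finite (range w)" using finite_weights finite_subset by blast
  moreover have "inj w"
  proof (rule injI)
    fix m n assume "w m = w n"
    moreover obtain H where "a H \<noteq> 0" using assms(2) by (auto simp: fun_eq_iff)
    ultimately show "m = n" unfolding w_def by (auto simp: fun_eq_iff)
  qed
  ultimately show False using finite_imageD[of w UNIV] by simp
qed

lemma br_opposite_roots_in_t:
  assumes "x \<in> root_space t a" "y \<in> root_space t (- a)"
  shows "br x y \<in> t"
  using br_root_space[OF assms] root_space_zero by simp

text \<open>Together with nondegeneracy on \<open>t\<close> this determines \<open>br x y\<close> as
  \<open>killing x y\<close> times the vector of \<open>t\<close> that represents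
  \<open>a\<close>.\<close>

lemma killing_br_opposite_roots:
  assumes "y \<in> root_space t (- a)" "H \<in> t"
  shows "killing (br x y) H = a H * killing x y"
proof -
  have "br H y = (- a) H *s y" using assms unfolding root_space_def by blast
  then have "br y H = a H *s y" using br_anti[of y H] by simp
  then show ?thesis by (simp add: killing_br killing_scale_right)
qed

lemma killing_t_nondegenerate:
  assumes "x \<in> t" "\<And>H. H \<in> t \<Longrightarrow> killing x H = 0"
  shows "x = 0"
proof -
  have "x \<in> root_space t 0" using assms(1) root_space_zero by simp
  then show ?thesis
    using killing_root_pairing[OF dual_zero, of x] assms(2) root_space_zero by auto
qed

text \<open>Otherwise \<open>x\<close>, \<open>y\<close> and \<open>br x y\<close> satisfy the
  Heisenberg relations, and a weight not vanishing on \<open>br x y\<close> yields a string that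
  never ends. So \<open>br x y\<close> acts by 0 on all root spaces, hence lies in the radical of
  the form, which forces \<open>a = 0\<close>.\<close>

lemma root_coroot_nonzero:
  assumes a: "a \<in> roots t" and x: "x \<in> root_space t a" and y: "y \<in> root_space t (- a)"
    and xy: "killing x y \<noteq> 0"
  shows "a (br x y) \<noteq> 0"
proof
  assume 0: "a (br x y) = 0"
  let ?h = "br x y"
  have a': "a \<in> dual t" "a \<noteq> 0" using a unfolding roots_def by auto
  have h: "?h \<in> t" using br_opposite_roots_in_t[OF x y] .
  have "b ?h = 0" if b: "b \<in> dual t" "root_space t b \<noteq> {0}" for b
  proof (rule ccontr)
    assume c: "b ?h \<noteq> 0"
    obtain v where v: "v \<in> root_space t b" "v \<noteq> 0"
      using b(2) subspace_0[OF subspace_root_space] by blast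
    obtain n0 where "(br x ^^ n0) v = 0" using string_terminates[OF a' b(1) x v(1)] by blast
    \<comment> \<open>The last nonzero vector of the \<open>x\<close>-string is killed by
      \<open>x\<close>, as the string computation requires of its starting vector.\<close>
    then obtain n where n: "(br x ^^ n) v \<noteq> 0" "br x ((br x ^^ n) v) = 0"
      using v(2) by (induction n0) auto
    have w: "(br x ^^ n) v \<in> root_space t (b + (\<lambda>H. of_nat n * a H))" for n
    proof (induction n)
      case 0
      have "b + (\<lambda>H. of_nat 0 * a H) = b" by (rule ext) simp
      then show ?case using v(1) by (simp only: funpow.simps id_apply)
    next
      case (Suc n)
      have "a + (b + (\<lambda>H. of_nat n * a H)) = b + (\<lambda>H. of_nat (Suc n) * a H)"
        by (simp add: fun_eq_iff algebra_simps)
      then show ?case using br_root_space[OF x Suc] by (simp only: funpow.simps comp_apply)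
    qed
    have "(br y ^^ m) ((br x ^^ n) v) \<noteq> 0" for m
    \<comment> \<open>With \<open>a = 0\<close> the coefficient sum is \<open>m + 1\<close> times
      \<open>b (br x y)\<close>, which is nonzero in characteristic 0.\<close>
    proof (rule br_string_nonzero[where a = 0 and l = "b ?h"])
      show "br (br x y) y = (- 0) *s y" using y h 0 unfolding root_space_def by simp
      show "br (br x y) ((br x ^^ n) v) = b ?h *s (br x ^^ n) v"
        using w[of n] h 0 unfolding root_space_def by simp
      show "(\<Sum>k\<le>m. b (br x y) - of_nat k * 0) \<noteq> 0" for m
        using c by (simp del: of_nat_Suc)
    qed (rule n)+
    moreover have "\<exists>m. (br y ^^ m) ((br x ^^ n) v) = 0"
      using string_terminates[OF dual_minus[OF a'(1)] _ dual_add[OF b(1) dual_nat[OF a'(1)]] y w] a'(2)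
      by simp
    ultimately show False by blast
  qed
  then have "br ?h z = 0" if "z \<in> (\<Union>\<alpha>\<in>dual t. root_space t \<alpha>)" for z
    using that h unfolding root_space_def by fastforce
  then have hz: "br ?h z = 0" for z
    using module_hom.eq_0_on_span[OF Vector_Spaces.linear.axioms(3)[OF linear_br], of "\<Union>\<alpha>\<in>dual t. root_space t \<alpha>" ?h z]
      root_spaces_span by auto
  have "killing ?h z = 0" for z
    unfolding killing_def using hz lin_trace_scale[of 0 "\<lambda>z. z"] by simp
  then have "a H * killing x y = 0" if "H \<in> t" for H
    using killing_br_opposite_roots[OF y that] by metis
  then have "a = 0" using dual_ext[OF a'(1) dual_zero] xy by auto
  then show False using a'(2) by simp
qed

text \<open>Subtracting a multiple of \<open>x\<close> from \<open>z\<close> makes the remainder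
  \<open>u\<close> orthogonal to \<open>y\<close>, and then \<open>u\<close> commutes with
  \<open>y\<close>. Were \<open>u\<close> nonzero, its string under \<open>br x\<close> would never
  end.\<close>

lemma root_space_one_dimensional:
  assumes a: "a \<in> roots t" and x: "x \<in> root_space t a" "x \<noteq> 0"
  shows "root_space t a = span {x}"
proof
  have a': "a \<in> dual t" "a \<noteq> 0" using a unfolding roots_def by auto
  show "span {x} \<subseteq> root_space t a"
    using span_minimal subspace_root_space x(1) by blast
  obtain y where y: "y \<in> root_space t (- a)" "killing x y \<noteq> 0"
    using killing_root_pairing[OF a'(1) x] by blast
  show "root_space t a \<subseteq> span {x}"
  proof
    fix z assume z: "z \<in> root_space t a"
    define c where "c = killing z y / killing x y"
    define u where "u = z - c *s x"
    have u: "u \<in> root_space t a"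
      unfolding u_def using z x(1) subspace_root_space subspace_diff subspace_scale by blast
    have "killing u y = 0" unfolding u_def c_def using y(2) by (simp add: killing_diff killing_scale_left)
    then have "br u y = 0"
      using killing_t_nondegenerate[OF br_opposite_roots_in_t[OF u y(1)]]
        killing_br_opposite_roots[OF y(1), of _ u] by simp
    then have yu: "br y u = 0" using br_anti[of y u] by simp
    have h: "br y x \<in> t" using br_opposite_roots_in_t[OF x(1) y(1)] br_anti[of y x] subspace_neg[OF subspace_t] by auto
    define l where "l = a (br x y)"
    have l: "l \<noteq> 0" unfolding l_def using root_coroot_nonzero[OF a x(1) y] .
    have al: "br (br y x) w = (- l) *s w" if "w \<in> root_space t a" for w
    proof -
      have "br (br x y) w = l *s w"
        using that br_opposite_roots_in_t[OF x(1) y(1)] unfolding root_space_def l_def by blast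
      then show ?thesis using br_anti[of y x] by (simp add: br_minus_left)
    qed
    have "u = 0"
    proof (rule ccontr)
      assume "u \<noteq> 0"
      have "(br x ^^ n) u \<noteq> 0" for n
      \<comment> \<open>The roles of \<open>x\<close> and \<open>y\<close> are exchanged:
        \<open>u\<close> is killed by \<open>y\<close> and has eigenvalue \<open>- l\<close> under
        \<open>br y x\<close>, so the coefficient sums are \<open>- l\<close> times
        \<open>1 + 2 + ... + (n + 1)\<close>.\<close>
      proof (rule br_string_nonzero[where a = l and l = "- l"])
        show "(\<Sum>k\<le>n. - l - of_nat k * l) \<noteq> 0" for n
        proof -
          have "(\<Sum>k\<le>n. - l - of_nat k * l) = - l * of_nat (\<Sum>k\<le>n. Suc k)"
            unfolding of_nat_sum sum_distrib_left by (rule sum.cong) (simp_all add: algebra_simps)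
          moreover have "(\<Sum>k\<le>n. Suc k) \<noteq> 0" by auto
          ultimately show ?thesis using l by (metis mult_eq_0_iff neg_equal_0_iff_equal of_nat_eq_0_iff)
        qed
      qed (rule al[OF x(1)] yu al[OF u] \<open>u \<noteq> 0\<close>)+
      then show False using string_terminates[OF a' a'(1) x(1) u] by blast
    qed
    then have "z = c *s x" unfolding u_def by simp
    then show "z \<in> span {x}" by (simp add: span_base span_scale)
  qed
qed

lemma neg_root: "a \<in> roots t \<Longrightarrow> - a \<in> roots t"
proof -
  assume a: "a \<in> roots t"
  then obtain x where x: "x \<in> root_space t a" "x \<noteq> 0"
    unfolding roots_def using subspace_0[OF subspace_root_space] by blast
  obtain y where y: "y \<in> root_space t (- a)" "killing x y \<noteq> 0"
    using killing_root_pairing[of a x] a x unfolding roots_def by blast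
  then have "y \<noteq> 0" by auto
  then show "- a \<in> roots t" using y(1) a dual_minus[of a] unfolding roots_def by auto
qed

section \<open>Root spaces inside \<open>h\<close> and inside its orthogonal complement\<close>

lemma subalgebra_h: "subalgebra h"
  using reductive unfolding reductive_def by (rule conjunct1)

lemma subspace_h: "subspace h"
  using subalgebra_h unfolding subalgebra_def by (rule conjunct1)

lemma br_h: "X \<in> h \<Longrightarrow> Y \<in> h \<Longrightarrow> br X Y \<in> h"
  using subalgebra_h unfolding subalgebra_def by blast

lemma subspace_q: "subspace q"
  unfolding q_def by (rule subspaceI) (simp_all add: killing_add_left killing_scale_left)

lemma br_h_q: "X \<in> h \<Longrightarrow> v \<in> q \<Longrightarrow> br X v \<in> q"
  unfolding q_def using br_h by (auto simp: killing_skew)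

lemma h_Int_q: "x \<in> h \<Longrightarrow> x \<in> q \<Longrightarrow> x = 0"
  using nondegenerate[unfolded nondegenerate_on_def, rule_format, of x] unfolding q_def by blast

text \<open>A line meeting \<open>h\<close> outside 0 lies in \<open>h\<close>. In the other case
  \<open>h\<close> has no nonzero vector of weight \<open>- a\<close> either, since such a vector
  would be orthogonal to all of \<open>h\<close>; hence every weight component of an element of
  \<open>h\<close> is orthogonal to the root space of \<open>a\<close>.\<close>

lemma root_space_h_or_q:
  assumes a: "a \<in> roots t"
  shows "root_space t a \<subseteq> h \<or> root_space t a \<subseteq> q"
proof (cases "root_space t a \<inter> h \<subseteq> {0}")
  case False
  then obtain x where x: "x \<in> root_space t a" "x \<noteq> 0" "x \<in> h" by blast
  then show ?thesis
    using root_space_one_dimensional[OF a x(1,2)] span_minimal[of "{x}" h] subspace_h by auto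
next
  case True
  have a': "a \<in> dual t" using a unfolding roots_def by auto
  have st: "ad.stable h" unfolding ad.stable_def using subspace_h br_h cartan(2) by blast
  have hs: "h \<subseteq> span (\<Union>\<nu>\<in>dual t. h \<inter> root_space t \<nu>)"
    using ad.stable_subset_span[OF st, of "\<Union>\<alpha>\<in>dual t. root_space t \<alpha>"] root_spaces_span
    unfolding wt_eq_root_space by blast
  have orth: "killing x y = 0" if "b \<in> dual t" "b \<noteq> - a" "x \<in> root_space t a" "y \<in> root_space t b" for x y b
    using killing_root_spaces_orthogonal[OF a' that] .
  have zero: "y = 0" if y: "y \<in> h" "y \<in> root_space t (- a)" for y
  proof -
    have "killing y z = 0" if "z \<in> h" for z
    proof (rule killing_span_zero)
      show "z \<in> span (\<Union>\<nu>\<in>dual t. h \<inter> root_space t \<nu>)" using hs that by blast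
      fix w assume "w \<in> (\<Union>\<nu>\<in>dual t. h \<inter> root_space t \<nu>)"
      then obtain \<nu> where w: "\<nu> \<in> dual t" "w \<in> h" "w \<in> root_space t \<nu>" by blast
      show "killing y w = 0"
      proof (cases "\<nu> = a")
        case True
        then show ?thesis using w \<open>root_space t a \<inter> h \<subseteq> {0}\<close> by auto
      next
        case False
        then show ?thesis
          using killing_root_spaces_orthogonal[OF dual_minus[OF a'] w(1) _ y(2) w(3)] by simp
      qed
    qed
    then show ?thesis using nondegenerate y(1) unfolding nondegenerate_on_def by blast
  qed
  have "killing x z = 0" if "x \<in> root_space t a" "z \<in> h" for x z
  proof (rule killing_span_zero)
    show "z \<in> span (\<Union>\<nu>\<in>dual t. h \<inter> root_space t \<nu>)" using hs that by blast
    fix w assume "w \<in> (\<Union>\<nu>\<in>dual t. h \<inter> root_space t \<nu>)"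
    then obtain \<nu> where w: "\<nu> \<in> dual t" "w \<in> h" "w \<in> root_space t \<nu>" by blast
    show "killing x w = 0"
      using orth[OF w(1) _ that(1) w(3)] zero[OF w(2)] w(3) by (cases "\<nu> = - a") auto
  qed
  then show ?thesis unfolding q_def by blast
qed

text \<open>A vector of weight \<open>- a\<close> that pairs nontrivially with an element of
  \<open>q\<close> cannot lie in \<open>h\<close>.\<close>

lemma neg_roots_q: "a \<in> roots_q \<Longrightarrow> - a \<in> roots_q"
proof -
  assume "a \<in> roots_q"
  then have a: "a \<in> roots t" "root_space t a \<subseteq> q" unfolding roots_q_def by auto
  obtain x where x: "x \<in> root_space t a" "x \<noteq> 0"
    using a(1) unfolding roots_def using subspace_0[OF subspace_root_space] by blast
  obtain y where y: "y \<in> root_space t (- a)" "killing x y \<noteq> 0"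
    using killing_root_pairing[of a x] a x unfolding roots_def by blast
  then have "y \<notin> h" using a(2) x(1) unfolding q_def by blast
  then show "- a \<in> roots_q"
    using root_space_h_or_q[OF neg_root[OF a(1)]] y(1) neg_root[OF a(1)] unfolding roots_q_def by blast
qed

text \<open>Being stable under \<open>t\<close>, the space \<open>q\<close> is spanned by its weight
  vectors; weight 0 contributes nothing because \<open>t\<close> lies in \<open>h\<close>.\<close>

lemma q_subset_span_roots_q: "q \<subseteq> span (\<Union>\<alpha>\<in>roots_q. root_space t \<alpha>)"
proof -
  have st: "ad.stable q" unfolding ad.stable_def using subspace_q br_h_q cartan(2) by blast
  have "q \<subseteq> span (\<Union>\<nu>\<in>dual t. q \<inter> root_space t \<nu>)"
    using ad.stable_subset_span[OF st, of "\<Union>\<alpha>\<in>dual t. root_space t \<alpha>"] root_spaces_span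
    unfolding wt_eq_root_space by blast
  also have "\<dots> \<subseteq> span (insert 0 (\<Union>\<alpha>\<in>roots_q. root_space t \<alpha>))"
  proof (rule span_mono, rule subsetI)
    fix z assume "z \<in> (\<Union>\<nu>\<in>dual t. q \<inter> root_space t \<nu>)"
    then obtain \<nu> where z: "\<nu> \<in> dual t" "z \<in> q" "z \<in> root_space t \<nu>" by blast
    show "z \<in> insert 0 (\<Union>\<alpha>\<in>roots_q. root_space t \<alpha>)"
    proof (cases "z = 0")
      case False
      then have "z \<notin> h" using h_Int_q z by blast
      then have "\<nu> \<noteq> 0" using z(3) root_space_zero cartan(2) by auto
      then have r: "\<nu> \<in> roots t" using z False unfolding roots_def by auto
      then have "\<nu> \<in> roots_q"
        using root_space_h_or_q[OF r] \<open>z \<notin> h\<close> z(3) unfolding roots_q_def by blast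
      then show ?thesis using z by blast
    qed simp
  qed
  finally show ?thesis by simp
qed

text \<open>Each root space lies in \<open>h\<close> or in \<open>q\<close>, so a vector orthogonal
  to both is orthogonal to everything, and orthogonality to \<open>h\<close> is built into
  \<open>q\<close>.\<close>

lemma killing_q_nondegenerate:
  assumes "x \<in> q" "\<And>y. y \<in> q \<Longrightarrow> killing x y = 0"
  shows "x = 0"
proof (rule killing_nondegenerate)
  fix y
  show "killing x y = 0"
  proof (rule killing_span_zero)
    show "y \<in> span (\<Union>\<alpha>\<in>dual t. root_space t \<alpha>)" using root_spaces_span by simp
    fix z assume "z \<in> (\<Union>\<alpha>\<in>dual t. root_space t \<alpha>)"
    then obtain \<nu> where z: "\<nu> \<in> dual t" "z \<in> root_space t \<nu>" by blast
    have "z \<in> h \<or> z \<in> q"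
    proof (cases "\<nu> = 0 \<or> z = 0")
      case True
      then show ?thesis using z root_space_zero cartan(2) subspace_0[OF subspace_h] by auto
    next
      case False
      then have "\<nu> \<in> roots t" using z unfolding roots_def by auto
      then show ?thesis using root_space_h_or_q z by blast
    qed
    then show "killing x z = 0" using assms unfolding q_def by blast
  qed
qed


subsection \<open>Positivity\<close>

lemma real_root_span_add:
  assumes "\<phi> \<in> real_root_span t" "\<psi> \<in> real_root_span t"
  shows "\<phi> + \<psi> \<in> real_root_span t"
proof -
  obtain c d where "\<phi> = (\<lambda>H. \<Sum>\<alpha>\<in>roots t. complex_of_real (c \<alpha>) * \<alpha> H)"
    "\<psi> = (\<lambda>H. \<Sum>\<alpha>\<in>roots t. complex_of_real (d \<alpha>) * \<alpha> H)"
    using assms unfolding real_root_span_def by blast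
  then have "\<phi> + \<psi> = (\<lambda>H. \<Sum>\<alpha>\<in>roots t. complex_of_real (c \<alpha> + d \<alpha>) * \<alpha> H)"
    by (auto simp: fun_eq_iff sum.distrib[symmetric] algebra_simps)
  then obtain e where e: "\<phi> + \<psi> = (\<lambda>H. \<Sum>\<alpha>\<in>roots t. complex_of_real (e \<alpha>) * \<alpha> H)" by meson
  then show ?thesis unfolding real_root_span_def e by blast
qed

lemma root_in_real_root_span:
  assumes "a \<in> roots t"
  shows "a \<in> real_root_span t"
proof -
  let ?c = "\<lambda>\<alpha>. if \<alpha> = a then 1 else 0 :: real"
  have "(\<Sum>\<alpha>\<in>roots t. complex_of_real (?c \<alpha>) * \<alpha> H) = a H" for H
  proof -
    have "(\<Sum>\<alpha>\<in>roots t. complex_of_real (?c \<alpha>) * \<alpha> H) = (\<Sum>\<alpha>\<in>roots t. if \<alpha> = a then a H else 0)"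
      by (rule sum.cong) auto
    then show ?thesis using assms finite_roots by (simp only: sum.delta if_True)
  qed
  then have eq: "(\<lambda>H. \<Sum>\<alpha>\<in>roots t. complex_of_real (?c \<alpha>) * \<alpha> H) = a" by blast
  have mem: "(\<lambda>H. \<Sum>\<alpha>\<in>roots t. complex_of_real (c \<alpha>) * \<alpha> H) \<in> real_root_span t" for c
    unfolding real_root_span_def by blast
  show ?thesis using mem[of ?c] unfolding eq .
qed

lemma positive_roots_subset: "\<Delta>p \<subseteq> roots t"
  using positive unfolding positive_system_def by blast

definition positivity :: "(('g \<Rightarrow> complex) \<Rightarrow> bool) \<Rightarrow> bool" where
  "positivity pos \<longleftrightarrow> (\<forall>\<phi>\<in>real_root_span t. \<phi> \<noteq> 0 \<longrightarrow> pos \<phi> \<noteq> pos (- \<phi>)) \<and>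
     (\<forall>\<phi>\<in>real_root_span t. \<forall>\<psi>\<in>real_root_span t. pos \<phi> \<longrightarrow> pos \<psi> \<longrightarrow> pos (\<phi> + \<psi>)) \<and>
     \<Delta>p = {\<alpha> \<in> roots t. pos \<alpha>}"

lemma positivity_exists: "\<exists>pos. positivity pos"
  using positive unfolding positive_system_def positivity_def by (elim exE) (rule exI, elim conjE, intro conjI)

lemma positivityD:
  assumes "positivity pos"
  shows "\<phi> \<in> real_root_span t \<Longrightarrow> \<phi> \<noteq> 0 \<Longrightarrow> pos \<phi> \<longleftrightarrow> \<not> pos (- \<phi>)"
    and "\<phi> \<in> real_root_span t \<Longrightarrow> \<psi> \<in> real_root_span t \<Longrightarrow> pos \<phi> \<Longrightarrow> pos \<psi> \<Longrightarrow> pos (\<phi> + \<psi>)"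
    and "b \<in> \<Delta>p \<longleftrightarrow> b \<in> roots t \<and> pos b"
proof -
  note p = assms[unfolded positivity_def]
  note pos = p[THEN conjunct1] p[THEN conjunct2, THEN conjunct1] p[THEN conjunct2, THEN conjunct2]
  show "pos \<phi> \<longleftrightarrow> \<not> pos (- \<phi>)" if "\<phi> \<in> real_root_span t" "\<phi> \<noteq> 0"
    using pos(1)[rule_format, OF that] by (cases "pos \<phi>") simp_all
  show "pos (\<phi> + \<psi>)" if "\<phi> \<in> real_root_span t" "\<psi> \<in> real_root_span t" "pos \<phi>" "pos \<psi>"
    using pos(2)[rule_format, OF that] .
  show "b \<in> \<Delta>p \<longleftrightarrow> b \<in> roots t \<and> pos b" unfolding pos(3) by blast
qed

lemma positive_or_negative:
  assumes "a \<in> roots t"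
  shows "a \<in> \<Delta>p \<or> - a \<in> \<Delta>p"
proof -
  obtain pos where p: "positivity pos" using positivity_exists by blast
  have "a \<noteq> 0" using assms unfolding roots_def by blast
  then show ?thesis
    using positivityD(1)[OF p root_in_real_root_span[OF assms]] assms neg_root[OF assms]
    unfolding positivityD(3)[OF p] by blast
qed

text \<open>If the list had a first entry \<open>b\<close>, the remaining entries would sum to
  \<open>- b\<close>, and both \<open>b\<close> and \<open>- b\<close> would be positive.\<close>

lemma sum_list_positive_roots:
  assumes "set bs \<subseteq> \<Delta>p" "sum_list bs = 0"
  shows "bs = []"
proof (rule ccontr)
  assume ne: "bs \<noteq> []"
  obtain pos where p: "positivity pos" using positivity_exists by blast
  note pos = positivityD[OF p]
  have posD: "b \<in> roots t \<and> pos b" if "b \<in> \<Delta>p" for b using that pos(3) by simp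
  have psum: "pos (sum_list cs) \<and> sum_list cs \<in> real_root_span t" if "cs \<noteq> []" "set cs \<subseteq> \<Delta>p" for cs
    using that
  proof (induction cs rule: list_nonempty_induct)
    case (single c)
    then have "c \<in> \<Delta>p" by simp
    moreover have "sum_list [c] = c" by simp
    ultimately show ?case using posD[of c] root_in_real_root_span[of c] by (simp only:)
  next
    case (cons c cs)
    then have "c \<in> real_root_span t" "pos c" "pos (sum_list cs)" "sum_list cs \<in> real_root_span t"
      using posD[of c] root_in_real_root_span[of c] by simp_all
    then show ?case using pos(2) real_root_span_add by (simp only: sum_list.Cons)
  qed
  obtain b cs where bs: "bs = b # cs" using ne by (meson neq_Nil_conv)
  have b: "b \<in> roots t" "pos b" using assms(1) bs posD[of b] by simp_all
  have b0: "b \<noteq> 0" using b(1) unfolding roots_def by blast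
  have "b + sum_list cs = 0" using assms(2) bs by simp
  then have cs: "sum_list cs = - b" by (metis add_eq_0_iff)
  then have "cs \<noteq> []" using b0 by auto
  then have "pos (- b)" using psum[of cs] assms(1) bs cs by auto
  then show False using pos(1)[OF root_in_real_root_span[OF b(1)] b0] b(2) by blast
qed

lemma not_positive_and_negative:
  assumes "a \<in> \<Delta>p"
  shows "- a \<notin> \<Delta>p"
proof
  assume "- a \<in> \<Delta>p"
  then have "set [a, - a] \<subseteq> \<Delta>p" using assms by (simp only: list.set insert_subset empty_subsetI simp_thms)
  moreover have "sum_list [a, - a] = 0"
    by (simp only: sum_list.Cons sum_list.Nil add_0_right add.right_inverse)
  ultimately have "[a, - a] = []" by (rule sum_list_positive_roots)
  then show False by (simp only: list.distinct)
qed

text \<open>Two comparable multisets of positive roots with equal sum coincide, since their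
  difference sums to 0. Dickson's lemma then bounds the sizes, so the lists have bounded length over
  a finite alphabet. This takes the place of a height function.\<close>

lemma finite_partitions: "finite {bs. set bs \<subseteq> \<Delta>p \<and> sum_list bs = \<mu>}"
proof -
  have fin: "finite \<Delta>p" by (rule finite_subset[OF positive_roots_subset finite_roots])
  define S where "S = {M. set_mset M \<subseteq> \<Delta>p \<and> sum_mset M = \<mu>}"
  have "finite S"
  proof (rule finite_multiset_antichain[OF fin])
    fix M N assume M: "M \<in> S" and N: "N \<in> S" and sub: "M \<subseteq># N"
    obtain bs where bs: "mset bs = N - M" using ex_mset by blast
    have "sum_mset (N - M) + sum_mset M = sum_mset N"
      using sub by (metis subset_mset.diff_add sum_mset.union)
    then have "sum_list bs = 0" using M N bs unfolding S_def sum_mset_sum_list[symmetric] by simp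
    moreover have "set_mset (N - M) \<subseteq> \<Delta>p" using N unfolding S_def by (auto dest: in_diffD)
    then have "set bs \<subseteq> \<Delta>p" using bs by (metis set_mset_mset)
    ultimately have "bs = []" using sum_list_positive_roots by blast
    then show "M = N" using bs sub by (simp add: Diff_eq_empty_iff_mset subset_mset.antisym)
  qed (simp add: S_def)
  then have "finite (size ` S)" by simp
  have "{bs. set bs \<subseteq> \<Delta>p \<and> sum_list bs = \<mu>} \<subseteq> {bs. set bs \<subseteq> \<Delta>p \<and> length bs \<le> Max (size ` S)}"
  proof
    fix bs assume bs: "bs \<in> {bs. set bs \<subseteq> \<Delta>p \<and> sum_list bs = \<mu>}"
    then have "mset bs \<in> S" unfolding S_def by (simp add: sum_mset_sum_list)
    then have "length bs \<in> size ` S" by (metis imageI size_mset)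
    then have "length bs \<le> Max (size ` S)" using \<open>finite (size ` S)\<close> by simp
    then show "bs \<in> {bs. set bs \<subseteq> \<Delta>p \<and> length bs \<le> Max (size ` S)}" using bs by simp
  qed
  then show ?thesis using finite_lists_length_le[OF fin] finite_subset by blast
qed

lemma triangular_decomposition:
  "span ((\<Union>\<beta>\<in>\<Delta>p. root_space t (- \<beta>)) \<union> t \<union> (\<Union>\<beta>\<in>\<Delta>p. root_space t \<beta>)) = UNIV"
proof -
  have "(\<Union>\<alpha>\<in>dual t. root_space t \<alpha>) \<subseteq>
      (\<Union>\<beta>\<in>\<Delta>p. root_space t (- \<beta>)) \<union> t \<union> (\<Union>\<beta>\<in>\<Delta>p. root_space t \<beta>)"
  proof
    fix z assume "z \<in> (\<Union>\<alpha>\<in>dual t. root_space t \<alpha>)"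
    then obtain \<nu> where z: "\<nu> \<in> dual t" "z \<in> root_space t \<nu>" by blast
    show "z \<in> (\<Union>\<beta>\<in>\<Delta>p. root_space t (- \<beta>)) \<union> t \<union> (\<Union>\<beta>\<in>\<Delta>p. root_space t \<beta>)"
    proof (cases "\<nu> = 0 \<or> z = 0")
      case True
      then show ?thesis using z root_space_zero subspace_0[OF subspace_t] by auto
    next
      case False
      then have "\<nu> \<in> roots t" using z unfolding roots_def by auto
      from positive_or_negative[OF this] show ?thesis
      proof
        assume "- \<nu> \<in> \<Delta>p"
        moreover have "z \<in> root_space t (- (- \<nu>))" using z by simp
        ultimately show ?thesis by blast
      qed (use z in blast)
    qed
  qed
  from span_mono[OF this] show ?thesis unfolding root_spaces_span by blast
qed


subsection \<open>The polarization of the orthogonal complement\<close>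

lemma root_space_n_q_plus: "b \<in> \<Delta>p \<inter> roots_q \<Longrightarrow> x \<in> root_space t b \<Longrightarrow> x \<in> n_q_plus"
  unfolding n_q_plus_def by (rule span_base) blast

lemma root_space_n_q_minus: "b \<in> \<Delta>p \<inter> roots_q \<Longrightarrow> x \<in> root_space t (- b) \<Longrightarrow> x \<in> n_q_minus"
  unfolding n_q_minus_def by (rule span_base) blast

lemma n_q_plus_subset: "n_q_plus \<subseteq> q"
  unfolding n_q_plus_def
  by (rule span_minimal) (auto simp: roots_q_def subspace_q)

lemma n_q_minus_subset: "n_q_minus \<subseteq> q"
  unfolding n_q_minus_def using neg_roots_q
  by (intro span_minimal) (auto simp: roots_q_def subspace_q)

lemma subspace_n_q: "subspace n_q_plus" "subspace n_q_minus"
  unfolding n_q_plus_def n_q_minus_def by simp_all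

lemma killing_span_span_zero:
  assumes "\<And>a b. a \<in> S \<Longrightarrow> b \<in> S' \<Longrightarrow> killing a b = 0" "x \<in> span S" "y \<in> span S'"
  shows "killing x y = 0"
proof (rule killing_span_zero[OF _ assms(3)])
  fix b assume "b \<in> S'"
  then have "killing b a = 0" if "a \<in> S" for a using assms(1)[OF that] killing_sym[of b a] by simp
  then show "killing x b = 0" using killing_span_zero[of S b x] assms(2) killing_sym[of x b] by simp
qed

text \<open>Two positive roots never add up to 0, so their root spaces are orthogonal.\<close>

lemma killing_n_q_plus: "x \<in> n_q_plus \<Longrightarrow> y \<in> n_q_plus \<Longrightarrow> killing x y = 0"
  unfolding n_q_plus_def
proof (rule killing_span_span_zero)
  fix a b assume "a \<in> (\<Union>\<beta>\<in>\<Delta>p \<inter> roots_q. root_space t \<beta>)" "b \<in> (\<Union>\<beta>\<in>\<Delta>p \<inter> roots_q. root_space t \<beta>)"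
  then obtain \<beta> \<beta>' where *: "\<beta> \<in> \<Delta>p" "\<beta>' \<in> \<Delta>p" "a \<in> root_space t \<beta>" "b \<in> root_space t \<beta>'" by blast
  then have "\<beta> \<in> dual t" "\<beta>' \<in> dual t" "\<beta>' \<noteq> - \<beta>"
    using positive_roots_subset not_positive_and_negative unfolding roots_def by blast+
  then show "killing a b = 0" using killing_root_spaces_orthogonal * by blast
qed

lemma killing_n_q_minus: "x \<in> n_q_minus \<Longrightarrow> y \<in> n_q_minus \<Longrightarrow> killing x y = 0"
  unfolding n_q_minus_def
proof (rule killing_span_span_zero)
  fix a b assume "a \<in> (\<Union>\<beta>\<in>\<Delta>p \<inter> roots_q. root_space t (- \<beta>))" "b \<in> (\<Union>\<beta>\<in>\<Delta>p \<inter> roots_q. root_space t (- \<beta>))"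
  then obtain \<beta> \<beta>' where *: "\<beta> \<in> \<Delta>p" "\<beta>' \<in> \<Delta>p" "a \<in> root_space t (- \<beta>)" "b \<in> root_space t (- \<beta>')" by blast
  then have "- \<beta> \<in> dual t" "- \<beta>' \<in> dual t" "- \<beta>' \<noteq> - (- \<beta>)"
    using positive_roots_subset not_positive_and_negative dual_minus unfolding roots_def by force+
  then show "killing a b = 0" using killing_root_spaces_orthogonal * by blast
qed

lemma q_decomposition: "a \<in> q \<Longrightarrow> \<exists>x. x \<in> n_q_plus \<and> a - x \<in> n_q_minus"
proof -
  assume "a \<in> q"
  have "(\<Union>\<alpha>\<in>roots_q. root_space t \<alpha>) \<subseteq>
    (\<Union>\<beta>\<in>\<Delta>p \<inter> roots_q. root_space t \<beta>) \<union> (\<Union>\<beta>\<in>\<Delta>p \<inter> roots_q. root_space t (- \<beta>))"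
  proof
    fix z assume "z \<in> (\<Union>\<alpha>\<in>roots_q. root_space t \<alpha>)"
    then obtain \<nu> where z: "\<nu> \<in> roots_q" "z \<in> root_space t \<nu>" by blast
    then have "\<nu> \<in> roots t" unfolding roots_q_def by blast
    from positive_or_negative[OF this]
    show "z \<in> (\<Union>\<beta>\<in>\<Delta>p \<inter> roots_q. root_space t \<beta>) \<union> (\<Union>\<beta>\<in>\<Delta>p \<inter> roots_q. root_space t (- \<beta>))"
    proof
      assume "- \<nu> \<in> \<Delta>p"
      moreover have "z \<in> root_space t (- (- \<nu>))" "- \<nu> \<in> roots_q" using z neg_roots_q by simp_all
      ultimately show ?thesis by blast
    qed (use z in blast)
  qed
  then have "a \<in> span ((\<Union>\<beta>\<in>\<Delta>p \<inter> roots_q. root_space t \<beta>) \<union> (\<Union>\<beta>\<in>\<Delta>p \<inter> roots_q. root_space t (- \<beta>)))"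
    using q_subset_span_roots_q \<open>a \<in> q\<close> span_mono by blast
  then obtain x y where "a = x + y" "x \<in> n_q_plus" "y \<in> n_q_minus"
    unfolding span_Un n_q_plus_def n_q_minus_def by blast
  then show ?thesis by (intro exI[of _ x]) simp
qed

text \<open>Such a vector is orthogonal to both isotropic halves, hence to all of
  \<open>q\<close>.\<close>

lemma n_q_Int:
  assumes "x \<in> n_q_plus" "x \<in> n_q_minus"
  shows "x = 0"
proof (rule killing_q_nondegenerate)
  show "x \<in> q" using n_q_plus_subset assms(1) by blast
  fix y assume "y \<in> q"
  then obtain z where "z \<in> n_q_plus" "y - z \<in> n_q_minus" using q_decomposition by blast
  then have "killing x z = 0" "killing x (y - z) = 0"
    using killing_n_q_plus killing_n_q_minus assms by blast+
  then show "killing x y = 0" by (simp add: killing_diff)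
qed

lemma br_t_n_q_plus:
  assumes "H \<in> t" "y \<in> n_q_plus"
  shows "br H y \<in> n_q_plus"
  using assms(2) unfolding n_q_plus_def
proof (induct rule: span_induct_alt)
  case (step c x y)
  then obtain b where b: "b \<in> \<Delta>p \<inter> roots_q" "x \<in> root_space t b" by blast
  then have "br H x = b H *s x" using assms(1) unfolding root_space_def by simp
  moreover have "x \<in> span (\<Union>\<beta>\<in>\<Delta>p \<inter> roots_q. root_space t \<beta>)"
    using root_space_n_q_plus[OF b] unfolding n_q_plus_def .
  ultimately show ?case using step(2)
    by (simp only: br_add_right br_scale_right span_add span_scale)
qed (simp add: span_zero)

end


section \<open>Creation and annihilation operators\<close>

text \<open>The sign of moving \<open>y\<^sub>i\<close> past the factors of \<open>e\<^sub>J\<close>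
  with smaller index.\<close>

definition sg :: "nat \<Rightarrow> nat set \<Rightarrow> complex" where
  "sg i J = (-1) ^ card {j\<in>J. j < i}"

lemma sg_insert:
  assumes "finite J" "j \<notin> J"
  shows "sg i (insert j J) = (if j < i then - sg i J else sg i J)"
proof (cases "j < i")
  case True
  then have "{k \<in> insert j J. k < i} = insert j {k \<in> J. k < i}" by auto
  then show ?thesis unfolding sg_def using True assms by simp
next
  case False
  then have "{k \<in> insert j J. k < i} = {k \<in> J. k < i}" by auto
  then show ?thesis unfolding sg_def using False by simp
qed

lemma sg_remove:
  assumes "finite J" "j \<in> J"
  shows "sg i (J - {j}) = (if j < i then - sg i J else sg i J)"
  using sg_insert[of "J - {j}" j i] assms by (simp add: insert_absorb split: if_splits)

lemma sg_square: "sg i J * sg i J = 1"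
  unfolding sg_def by (simp add: power_mult_distrib[symmetric])

definition delta :: "nat set \<Rightarrow> nat set \<Rightarrow> complex" where
  "delta I = (\<lambda>K. if K = I then 1 else 0)"

definition fscale :: "complex \<Rightarrow> (nat set \<Rightarrow> complex) \<Rightarrow> nat set \<Rightarrow> complex" where
  "fscale c \<omega> = (\<lambda>J. c * \<omega> J)"

lemma sum_fun_apply: "(\<Sum>a\<in>A. f a) x = (\<Sum>a\<in>A. f a x)"
  by (induction A rule: infinite_finite_induct) simp_all

global_interpretation fs: vspace fscale
  by unfold_locales (simp_all add: fscale_def fun_eq_iff algebra_simps)

text \<open>The identity of the spin module inside the larger type of all coefficient functions; it
  is the identity operator of the Clifford relation.\<close>

definition res :: "nat \<Rightarrow> (nat set \<Rightarrow> complex) \<Rightarrow> nat set \<Rightarrow> complex" where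
  "res n \<omega> J = (if J \<subseteq> {..<n} then \<omega> J else 0)"

text \<open>The flag \<open>s\<close> selects annihilation (\<open>True\<close>) or creation (\<open>False\<close>) of the index \<open>i\<close>.\<close>

definition elem_op :: "nat \<Rightarrow> bool \<Rightarrow> nat \<Rightarrow> (nat set \<Rightarrow> complex) \<Rightarrow> nat set \<Rightarrow> complex" where
  "elem_op n s i \<omega> J = (if J \<subseteq> {..<n} \<and> i < n \<and> (i \<in> J \<longleftrightarrow> \<not> s)
     then sg i J * \<omega> (if s then insert i J else J - {i}) else 0)"

text \<open>The canonical anticommutation relations. For \<open>i \<noteq> j\<close> both orders
  reach the same index set, and exactly one of the two signs is flipped, the one belonging to the
  larger index.\<close>

lemma elem_op_anticommute:
  assumes "i < n" "j < n"
  shows "elem_op n s i (elem_op n r j \<omega>) J + elem_op n r j (elem_op n s i \<omega>) J =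
    (if i = j \<and> s \<noteq> r then 1 else 0) * res n \<omega> J"
proof (cases "J \<subseteq> {..<n}")
  case True
  then have fin: "finite J" using finite_subset by blast
  have sub: "insert i J \<subseteq> {..<n}" "insert j J \<subseteq> {..<n}" "J - {i} \<subseteq> {..<n}" "J - {j} \<subseteq> {..<n}"
    using True assms by auto
  show ?thesis
  proof (cases "i = j")
    case eq: True
    show ?thesis
      using True fin sub assms eq sg_square[of j J] 
      by (cases s; cases r; cases "j \<in> J")
        (auto simp: elem_op_def res_def sg_insert sg_remove insert_absorb mult.assoc[symmetric])
  next
    case False
    have comm: "insert i (insert j J) = insert j (insert i J)" "J - {i} - {j} = J - {j} - {i}"
      "insert i (J - {j}) = insert i J - {j}" "insert j (J - {i}) = insert j J - {i}"
      using False by auto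
    show ?thesis
      using True fin sub assms False comm
      by (cases s; cases r; cases "i \<in> J"; cases "j \<in> J"; cases "i < j")
        (auto simp: elem_op_def res_def sg_insert sg_remove)
  qed
next
  case False
  then show ?thesis by (simp add: elem_op_def res_def)
qed


subsection \<open>Operators given by matrices\<close>

text \<open>Endomorphisms of the spin module as functions on all coefficient families: they ignore
  the irrelevant coefficients of the argument and produce none. Linearity is contained in the matrix
  formula.\<close>

definition spin_op :: "nat \<Rightarrow> ((nat set \<Rightarrow> complex) \<Rightarrow> nat set \<Rightarrow> complex) \<Rightarrow> bool" where
  "spin_op n T \<longleftrightarrow> (\<forall>\<omega> J. T \<omega> J = (\<Sum>I\<in>Pow {..<n}. \<omega> I * T (delta I) J)) \<and>
     (\<forall>\<omega> J. \<not> J \<subseteq> {..<n} \<longrightarrow> T \<omega> J = 0)"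

lemma spin_op_matrix: "spin_op n T \<Longrightarrow> T \<omega> J = (\<Sum>I\<in>Pow {..<n}. \<omega> I * T (delta I) J)"
  unfolding spin_op_def by blast

lemma spin_op_outside: "spin_op n T \<Longrightarrow> \<not> J \<subseteq> {..<n} \<Longrightarrow> T \<omega> J = 0"
  unfolding spin_op_def by blast

lemma spin_op_res [simp]: "spin_op n T \<Longrightarrow> T (res n \<omega>) = T \<omega>"
  by (rule ext) (simp add: spin_op_matrix[of n T "res n \<omega>"] spin_op_matrix[of n T \<omega>] res_def)

lemma spin_op_sum:
  assumes "spin_op n T"
  shows "T (\<lambda>J. \<Sum>x\<in>A. a x * \<omega> x J) J = (\<Sum>x\<in>A. a x * T (\<omega> x) J)"
proof -
  have "T (\<lambda>J. \<Sum>x\<in>A. a x * \<omega> x J) J =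
      (\<Sum>I\<in>Pow {..<n}. \<Sum>x\<in>A. a x * \<omega> x I * T (delta I) J)"
    by (subst spin_op_matrix[OF assms]) (simp add: sum_distrib_right)
  also have "\<dots> = (\<Sum>x\<in>A. \<Sum>I\<in>Pow {..<n}. a x * \<omega> x I * T (delta I) J)"
    by (rule sum.swap)
  also have "\<dots> = (\<Sum>x\<in>A. a x * T (\<omega> x) J)"
    by (rule sum.cong[OF refl], subst (2) spin_op_matrix[OF assms])
      (simp add: sum_distrib_left mult.assoc)
  finally show ?thesis .
qed

lemma spin_op_add:
  assumes "spin_op n T"
  shows "T (\<lambda>J. \<omega> J + \<omega>' J) J = T \<omega> J + T \<omega>' J"
  by (simp add: spin_op_matrix[OF assms, of "\<lambda>J. \<omega> J + \<omega>' J"] spin_op_matrix[OF assms, of \<omega>]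
      spin_op_matrix[OF assms, of \<omega>'] sum.distrib distrib_right)

lemma spin_op_scale:
  assumes "spin_op n T"
  shows "T (\<lambda>J. c * \<omega> J) J = c * T \<omega> J"
  by (simp add: spin_op_matrix[OF assms, of "\<lambda>J. c * \<omega> J"] spin_op_matrix[OF assms, of \<omega>]
      sum_distrib_left mult.assoc)

lemma spin_op_diff:
  assumes "spin_op n T"
  shows "T (\<lambda>J. \<omega> J - \<omega>' J) J = T \<omega> J - T \<omega>' J"
  using spin_op_add[OF assms, of \<omega> "\<lambda>J. (-1) * \<omega>' J"] spin_op_scale[OF assms, of "-1" \<omega>']
  by simp

lemma spin_op_linear: "spin_op n T \<Longrightarrow> Vector_Spaces.linear fscale fscale T"
  by unfold_locales
    (simp_all add: fscale_def plus_fun_def spin_op_add spin_op_scale fun_eq_iff)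

lemma spin_opI:
  assumes "\<And>\<omega> J. J \<subseteq> {..<n} \<Longrightarrow> T \<omega> J = (\<Sum>I\<in>Pow {..<n}. \<omega> I * T (delta I) J)"
    and "\<And>\<omega> J. \<not> J \<subseteq> {..<n} \<Longrightarrow> T \<omega> J = 0"
  shows "spin_op n T"
  unfolding spin_op_def using assms by (metis (no_types, lifting) mult_zero_right sum.neutral)

lemma spin_op_elem_op: "spin_op n (elem_op n s i)"
proof (rule spin_opI)
  fix \<omega> J assume J: "J \<subseteq> {..<n}"
  let ?K = "if s then insert i J else J - {i}"
  show "elem_op n s i \<omega> J = (\<Sum>I\<in>Pow {..<n}. \<omega> I * elem_op n s i (delta I) J)"
  proof (cases "i < n \<and> (i \<in> J \<longleftrightarrow> \<not> s)")
    case True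
    then have K: "?K \<in> Pow {..<n}" using J by auto
    have "(\<Sum>I\<in>Pow {..<n}. \<omega> I * elem_op n s i (delta I) J) =
        (\<Sum>I\<in>Pow {..<n}. if ?K = I then sg i J * \<omega> ?K else 0)"
      using True J by (intro sum.cong) (auto simp: elem_op_def delta_def)
    also have "\<dots> = sg i J * \<omega> ?K" using K by (subst sum.delta') auto
    finally show ?thesis using True J by (simp add: elem_op_def)
  qed (auto simp: elem_op_def)
qed (simp add: elem_op_def)

lemma spin_op_res_op: "spin_op n (res n)"
proof (rule spin_opI)
  fix \<omega> J assume J: "J \<subseteq> {..<n}"
  have "(\<Sum>I\<in>Pow {..<n}. \<omega> I * res n (delta I) J) = (\<Sum>I\<in>Pow {..<n}. if J = I then \<omega> J else 0)"
    using J by (intro sum.cong) (auto simp: res_def delta_def)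
  also have "\<dots> = \<omega> J" using J by (subst sum.delta') auto
  finally show "res n \<omega> J = (\<Sum>I\<in>Pow {..<n}. \<omega> I * res n (delta I) J)" using J by (simp add: res_def)
qed (simp add: res_def)

lemma spin_op_comp:
  assumes "spin_op n S" "spin_op n T"
  shows "spin_op n (\<lambda>\<omega>. S (T \<omega>))"
proof (rule spin_opI)
  fix \<omega> J
  have "T \<omega> = (\<lambda>J. \<Sum>I\<in>Pow {..<n}. \<omega> I * T (delta I) J)"
    by (rule ext) (rule spin_op_matrix[OF assms(2)])
  then show "S (T \<omega>) J = (\<Sum>I\<in>Pow {..<n}. \<omega> I * S (T (delta I)) J)"
    using spin_op_sum[OF assms(1), of \<omega> "\<lambda>I. T (delta I)" "Pow {..<n}" J] by (simp only:)
qed (rule spin_op_outside[OF assms(1)])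

lemma spin_op_lincomb:
  assumes "\<And>x. x \<in> A \<Longrightarrow> spin_op n (T x)"
  shows "spin_op n (\<lambda>\<omega> J. \<Sum>x\<in>A. a x * T x \<omega> J)"
proof (rule spin_opI)
  fix \<omega> J
  have "(\<Sum>x\<in>A. a x * T x \<omega> J) = (\<Sum>x\<in>A. \<Sum>I\<in>Pow {..<n}. a x * (\<omega> I * T x (delta I) J))"
    by (rule sum.cong) (simp_all add: spin_op_matrix[OF assms, of _ \<omega>] sum_distrib_left)
  also have "\<dots> = (\<Sum>I\<in>Pow {..<n}. \<omega> I * (\<Sum>x\<in>A. a x * T x (delta I) J))"
    by (subst sum.swap) (simp add: sum_distrib_left mult.left_commute)
  finally show "(\<Sum>x\<in>A. a x * T x \<omega> J) = (\<Sum>I\<in>Pow {..<n}. \<omega> I * (\<Sum>x\<in>A. a x * T x (delta I) J))" .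
qed (simp add: spin_op_outside[OF assms])

lemma spin_op_minus:
  assumes "spin_op n S" "spin_op n T"
  shows "spin_op n (\<lambda>\<omega> J. S \<omega> J - T \<omega> J)"
proof (rule spin_opI)
  fix \<omega> J
  show "S \<omega> J - T \<omega> J = (\<Sum>I\<in>Pow {..<n}. \<omega> I * (S (delta I) J - T (delta I) J))"
    using spin_op_matrix[OF assms(1), of \<omega> J] spin_op_matrix[OF assms(2), of \<omega> J]
    by (simp add: right_diff_distrib sum_subtractf)
qed (simp add: spin_op_outside[OF assms(1)] spin_op_outside[OF assms(2)])

text \<open>The flag \<open>p\<close> is True for operators preserving the parity of the degree and
  False for those reversing it; the flag of a composite is then \<open>p = r\<close>.\<close>

definition parity :: "nat \<Rightarrow> bool \<Rightarrow> ((nat set \<Rightarrow> complex) \<Rightarrow> nat set \<Rightarrow> complex) \<Rightarrow> bool" where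
  "parity n p T \<longleftrightarrow> (\<forall>I J. I \<subseteq> {..<n} \<longrightarrow> T (delta I) J \<noteq> 0 \<longrightarrow> (even (card I) \<longleftrightarrow> even (card J)) = p)"

lemma parity_comp:
  assumes "spin_op n S" "spin_op n T" "parity n p S" "parity n r T"
  shows "parity n (p = r) (\<lambda>\<omega>. S (T \<omega>))"
  unfolding parity_def
proof (intro allI impI)
  fix I J assume I: "I \<subseteq> {..<n}" and nz: "S (T (delta I)) J \<noteq> 0"
  then obtain K where K: "K \<in> Pow {..<n}" "T (delta I) K * S (delta K) J \<noteq> 0"
    unfolding spin_op_matrix[OF assms(1), of "T (delta I)" J] by (meson sum.neutral)
  then have "T (delta I) K \<noteq> 0" "S (delta K) J \<noteq> 0" by auto
  then have "(even (card I) \<longleftrightarrow> even (card K)) = r" "(even (card K) \<longleftrightarrow> even (card J)) = p"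
    using assms(3,4) I K(1) unfolding parity_def by blast+
  then show "(even (card I) \<longleftrightarrow> even (card J)) = (p = r)" by auto
qed

lemma parity_lincomb:
  assumes "\<And>x. x \<in> A \<Longrightarrow> parity n p (T x)"
  shows "parity n p (\<lambda>\<omega> J. \<Sum>x\<in>A. a x * T x \<omega> J)"
  unfolding parity_def
proof (intro allI impI)
  fix I J assume I: "I \<subseteq> {..<n}" and nz: "(\<Sum>x\<in>A. a x * T x (delta I) J) \<noteq> 0"
  then obtain x where "x \<in> A" "a x * T x (delta I) J \<noteq> 0" by (meson sum.neutral)
  then have "x \<in> A" "T x (delta I) J \<noteq> 0" by auto
  then show "(even (card I) \<longleftrightarrow> even (card J)) = p"
    using assms[of x] I unfolding parity_def by blast
qed

lemma parity_minus:
  assumes "parity n p S" "parity n p T"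
  shows "parity n p (\<lambda>\<omega> J. S \<omega> J - T \<omega> J)"
  unfolding parity_def
proof (intro allI impI)
  fix I J assume I: "I \<subseteq> {..<n}" and nz: "S (delta I) J - T (delta I) J \<noteq> 0"
  then have "S (delta I) J \<noteq> 0 \<or> T (delta I) J \<noteq> 0" by auto
  then show "(even (card I) \<longleftrightarrow> even (card J)) = p"
    using assms I unfolding parity_def by blast
qed

lemma parity_elem_op: "parity n False (elem_op n s i)"
  unfolding parity_def
proof (intro allI impI)
  fix I J assume I: "I \<subseteq> {..<n}" and nz: "elem_op n s i (delta I) J \<noteq> 0"
  then have J: "J \<subseteq> {..<n}" "i \<in> J \<longleftrightarrow> \<not> s" "I = (if s then insert i J else J - {i})"
    by (auto simp: elem_op_def delta_def split: if_splits)
  then have "finite J" using finite_subset by blast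
  then have "card I = Suc (card J) \<or> Suc (card I) = card J"
    using J(2,3) card_Suc_Diff1[of J i] by (cases s) auto
  then show "(even (card I) \<longleftrightarrow> even (card J)) = False" by (metis even_Suc)
qed

lemma parity_res: "parity n True (res n)"
  unfolding parity_def res_def delta_def by auto


section \<open>The Clifford action\<close>

context spin_data
begin

abbreviation n :: nat where "n \<equiv> length ys"
abbreviation m :: nat where "m \<equiv> length zs"
abbreviation z :: "nat \<Rightarrow> 'g" where "z j \<equiv> zs ! j"

text \<open>Linearity is asked on \<open>q\<close> only, because \<open>plus_part\<close>, and with
  it \<open>\<gamma>\<close>, is a definite description that is meaningful only there.\<close>

definition q_linear :: "(complex \<Rightarrow> 'v \<Rightarrow> 'v) \<Rightarrow> ('g \<Rightarrow> 'v::ab_group_add) \<Rightarrow> bool" where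
  "q_linear s f \<longleftrightarrow> (\<forall>u\<in>q. \<forall>v\<in>q. f (u + v) = f u + f v) \<and> (\<forall>c. \<forall>u\<in>q. f (c *s u) = s c (f u))"

lemma q_linearD:
  assumes "q_linear s f"
  shows "u \<in> q \<Longrightarrow> v \<in> q \<Longrightarrow> f (u + v) = f u + f v" "u \<in> q \<Longrightarrow> f (c *s u) = s c (f u)"
  using assms unfolding q_linear_def by blast+

lemma z_in_q: "j < m \<Longrightarrow> z j \<in> q"
  using basis_zs span_superset[of "set zs"] nth_mem by blast

lemma q_expansion:
  assumes "v \<in> q"
  shows "v = (\<Sum>i<m. killing (z i) v *s z i)"
proof -
  have "v \<in> span (set zs)" using assms basis_zs by simp
  then show ?thesis
  proof (induct rule: span_induct_alt)
    case (step c x y)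
    then obtain j where j: "j < m" "x = z j" by (metis in_set_conv_nth)
    have "(\<Sum>i<m. killing (z i) (c *s x + y) *s z i) =
        (\<Sum>i<m. (c * killing (z i) x) *s z i) + (\<Sum>i<m. killing (z i) y *s z i)"
      by (simp add: killing_add_right killing_scale_right scale_left_distrib sum.distrib)
    also have "(\<Sum>i<m. (c * killing (z i) x) *s z i) = (\<Sum>i<m. if i = j then c *s z j else 0)"
      using j orthonormal_zs by (intro sum.cong) auto
    also have "\<dots> = c *s x" using j by simp
    finally show ?case using step(2) by simp
  qed simp
qed

lemma q_linear_sum:
  assumes "vector_space s" "q_linear s f" "\<And>i. i \<in> A \<Longrightarrow> u i \<in> q"
  shows "f (\<Sum>i\<in>A. c i *s u i) = (\<Sum>i\<in>A. s (c i) (f (u i)))"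
  using assms(3)
proof (induction A rule: infinite_finite_induct)
  case (insert x A)
  have "(\<Sum>i\<in>A. c i *s u i) \<in> q" using insert.prems subspace_q by (intro subspace_sum subspace_scale) auto
  moreover have "c x *s u x \<in> q" using insert.prems subspace_q by (intro subspace_scale) auto
  ultimately show ?case
    using insert q_linearD[OF assms(2)] by simp
next
  case empty
  have "f (0 *s 0) = s 0 (f 0)" using q_linearD(2)[OF assms(2) subspace_0[OF subspace_q]] .
  then show ?case using assms(1) by (simp add: module.scale_zero_left[of s] module_iff_vector_space)
next
  case (infinite A)
  have "f (0 *s 0) = s 0 (f 0)" using q_linearD(2)[OF assms(2) subspace_0[OF subspace_q]] .
  then show ?case using infinite assms(1) by (simp add: module.scale_zero_left[of s] module_iff_vector_space)
qed

lemma q_linear_expansion: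
  assumes "vector_space s" "q_linear s f" "v \<in> q"
  shows "f v = (\<Sum>i<m. s (killing (z i) v) (f (z i)))"
  using q_linear_sum[OF assms(1,2), of "{..<m}" z "\<lambda>i. killing (z i) v"] z_in_q
    q_expansion[OF assms(3)] by simp

text \<open>Expanding \<open>A z\<^sub>j\<close> in the orthonormal basis gives a skew matrix, and
  transposing it moves \<open>A\<close> to the other slot. With \<open>A = br X\<close> this is
  applied to the spin action, to the cubic element and to \<open>D\<close>.\<close>

lemma skew_switch:
  assumes "vector_space s" "\<And>v. v \<in> q \<Longrightarrow> q_linear s (\<lambda>u. \<Psi> u v)" "\<And>u. u \<in> q \<Longrightarrow> q_linear s (\<Psi> u)"
    and A: "\<And>u. u \<in> q \<Longrightarrow> A u \<in> q" "\<And>u v. u \<in> q \<Longrightarrow> v \<in> q \<Longrightarrow> killing (A u) v = - killing u (A v)"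
  shows "(\<Sum>j<m. \<Psi> (A (z j)) (z j)) = - (\<Sum>j<m. \<Psi> (z j) (A (z j)))"
proof -
  interpret s: vector_space s by fact
  have "(\<Sum>j<m. \<Psi> (A (z j)) (z j)) = (\<Sum>j<m. \<Sum>i<m. s (killing (z i) (A (z j))) (\<Psi> (z i) (z j)))"
    using q_linear_expansion[OF assms(1) assms(2)[OF z_in_q] A(1)[OF z_in_q]]
    by (intro sum.cong) auto
  also have "\<dots> = (\<Sum>j<m. \<Sum>i<m. s (- killing (z j) (A (z i))) (\<Psi> (z i) (z j)))"
  proof (intro sum.cong refl)
    fix i j assume "i \<in> {..<m}" "j \<in> {..<m}"
    then have "killing (z i) (A (z j)) = - killing (z j) (A (z i))"
      using A(2)[of "z i" "z j"] z_in_q killing_sym[of "A (z i)" "z j"] by simp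
    then show "s (killing (z i) (A (z j))) (\<Psi> (z i) (z j)) = s (- killing (z j) (A (z i))) (\<Psi> (z i) (z j))"
      by simp
  qed
  also have "\<dots> = (\<Sum>i<m. \<Sum>j<m. s (- killing (z j) (A (z i))) (\<Psi> (z i) (z j)))"
    by (rule sum.swap)
  also have "\<dots> = (\<Sum>i<m. - \<Psi> (z i) (A (z i)))"
    using q_linear_expansion[OF assms(1) assms(3)[OF z_in_q] A(1)[OF z_in_q]]
    by (intro sum.cong) (auto simp: sum_negf)
  finally show ?thesis by (simp add: sum_negf)
qed

lemma vector_space_mult: "vector_space ((*) :: complex \<Rightarrow> complex \<Rightarrow> complex)"
  by unfold_locales (simp_all add: algebra_simps)

section \<open>The polarization of \<open>q\<close> and the Clifford relation\<close>

lemma plus_part_eq: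
  assumes "x \<in> n_q_plus" "a - x \<in> n_q_minus"
  shows "plus_part a = x"
  unfolding plus_part_def
proof (rule the_equality)
  show "x \<in> n_q_plus \<and> a - x \<in> n_q_minus" using assms by blast
  fix y assume y: "y \<in> n_q_plus \<and> a - y \<in> n_q_minus"
  have "y - x \<in> n_q_plus" using y assms subspace_diff[OF subspace_n_q(1)] by blast
  moreover have "(a - x) - (a - y) \<in> n_q_minus" using y assms subspace_diff[OF subspace_n_q(2)] by blast
  then have "y - x \<in> n_q_minus" by simp
  ultimately show "y = x" using n_q_Int by fastforce
qed

lemma plus_part:
  assumes "a \<in> q"
  shows "plus_part a \<in> n_q_plus" "a - plus_part a \<in> n_q_minus"
proof -
  obtain x where "x \<in> n_q_plus" "a - x \<in> n_q_minus" using q_decomposition[OF assms] by blast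
  then show "plus_part a \<in> n_q_plus" "a - plus_part a \<in> n_q_minus" using plus_part_eq by auto
qed

lemma plus_part_add:
  assumes "a \<in> q" "b \<in> q"
  shows "plus_part (a + b) = plus_part a + plus_part b"
proof (rule plus_part_eq)
  show "plus_part a + plus_part b \<in> n_q_plus"
    using plus_part assms subspace_add[OF subspace_n_q(1)] by blast
  have "(a - plus_part a) + (b - plus_part b) \<in> n_q_minus"
    using plus_part assms subspace_add[OF subspace_n_q(2)] by blast
  then show "a + b - (plus_part a + plus_part b) \<in> n_q_minus" by (simp add: algebra_simps)
qed

lemma plus_part_scale:
  assumes "a \<in> q"
  shows "plus_part (c *s a) = c *s plus_part a"
proof (rule plus_part_eq)
  show "c *s plus_part a \<in> n_q_plus"
    using plus_part assms subspace_scale[OF subspace_n_q(1)] by blast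
  have "c *s (a - plus_part a) \<in> n_q_minus"
    using plus_part assms subspace_scale[OF subspace_n_q(2)] by blast
  then show "c *s a - c *s plus_part a \<in> n_q_minus" by (simp add: scale_right_diff_distrib)
qed

definition coef :: "'g \<Rightarrow> bool \<Rightarrow> nat \<Rightarrow> complex" where
  "coef a s i = (if s then killing (plus_part a) (ys ! i)
     else representation (set ys) (a - plus_part a) (ys ! i))"

lemma contract_eq: "contract x \<omega> J = (\<Sum>i<n. killing x (ys ! i) * elem_op n True i \<omega> J)"
proof (cases "J \<subseteq> {..<n}")
  case True
  have "(\<Sum>i\<in>{..<n} - J. (-1) ^ card {j \<in> J. j < i} * killing x (ys ! i) * \<omega> (insert i J)) =
      (\<Sum>i\<in>{..<n} - J. killing x (ys ! i) * elem_op n True i \<omega> J)"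
    using True by (intro sum.cong) (auto simp: elem_op_def sg_def)
  also have "\<dots> = (\<Sum>i<n. killing x (ys ! i) * elem_op n True i \<omega> J)"
    by (rule sum.mono_neutral_left) (auto simp: elem_op_def)
  finally show ?thesis using True unfolding contract_def by simp
qed (simp add: contract_def elem_op_def)

lemma wedge_eq: "wedge y \<omega> J = (\<Sum>i<n. representation (set ys) y (ys ! i) * elem_op n False i \<omega> J)"
proof (cases "J \<subseteq> {..<n}")
  case True
  have "(\<Sum>i\<in>J. (-1) ^ card {j \<in> J. j < i} * representation (set ys) y (ys ! i) * \<omega> (J - {i})) =
      (\<Sum>i\<in>J. representation (set ys) y (ys ! i) * elem_op n False i \<omega> J)"
    using True by (intro sum.cong) (auto simp: elem_op_def sg_def)
  also have "\<dots> = (\<Sum>i<n. representation (set ys) y (ys ! i) * elem_op n False i \<omega> J)"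
    using True by (intro sum.mono_neutral_left) (auto simp: elem_op_def)
  finally show ?thesis using True unfolding wedge_def by simp
qed (simp add: wedge_def elem_op_def)

lemma gamma_eq: "\<gamma> a \<omega> J = (\<Sum>(s, i)\<in>UNIV \<times> {..<n}. coef a s i * elem_op n s i \<omega> J)"
proof -
  have "(\<Sum>(s, i)\<in>UNIV \<times> {..<n}. coef a s i * elem_op n s i \<omega> J) =
      (\<Sum>s\<in>UNIV. \<Sum>i<n. coef a s i * elem_op n s i \<omega> J)"
    by (simp add: sum.cartesian_product)
  then show ?thesis unfolding \<gamma>_def by (simp add: UNIV_bool contract_eq wedge_eq coef_def)
qed

lemma spin_op_gamma: "spin_op n (\<gamma> a)"
proof -
  have "\<gamma> a = (\<lambda>\<omega> J. \<Sum>x\<in>UNIV \<times> {..<n}. coef a (fst x) (snd x) * elem_op n (fst x) (snd x) \<omega> J)"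
    by (intro ext) (simp add: gamma_eq case_prod_unfold)
  then show ?thesis using spin_op_lincomb[of "UNIV \<times> {..<n}" n "\<lambda>x. elem_op n (fst x) (snd x)"] spin_op_elem_op by simp
qed

lemma parity_gamma: "parity n False (\<gamma> a)"
proof -
  have "\<gamma> a = (\<lambda>\<omega> J. \<Sum>x\<in>UNIV \<times> {..<n}. coef a (fst x) (snd x) * elem_op n (fst x) (snd x) \<omega> J)"
    by (intro ext) (simp add: gamma_eq case_prod_unfold)
  then show ?thesis using parity_lincomb[of "UNIV \<times> {..<n}" n False "\<lambda>x. elem_op n (fst x) (snd x)"] parity_elem_op by simp
qed

lemma res_gamma: "res n (\<gamma> a \<omega>) = \<gamma> a \<omega>"
  by (rule ext) (auto simp: res_def spin_op_outside[OF spin_op_gamma])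

lemma coef_add:
  assumes "a \<in> q" "b \<in> q"
  shows "coef (a + b) s i = coef a s i + coef b s i"
proof -
  have eq: "a + b - (plus_part a + plus_part b) = (a - plus_part a) + (b - plus_part b)"
    by (simp add: algebra_simps)
  show ?thesis
    using representation_add[OF basis_ys(2), of "b - plus_part b" "a - plus_part a"]
      plus_part(2)[OF assms(1)] plus_part(2)[OF assms(2)]
    unfolding coef_def basis_ys(3) plus_part_add[OF assms] eq by (simp add: killing_add_left)
qed

lemma coef_scale:
  assumes "a \<in> q"
  shows "coef (c *s a) s i = c * coef a s i"
proof -
  have "c *s a - plus_part (c *s a) = c *s (a - plus_part a)"
    unfolding plus_part_scale[OF assms] by (simp add: scale_right_diff_distrib)
  then show ?thesis
    using representation_scale[OF basis_ys(2), of "a - plus_part a" c] plus_part(2)[OF assms(1)]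
    unfolding coef_def basis_ys(3) plus_part_scale[OF assms] by (simp add: killing_scale_left)
qed

lemma q_linear_gamma: "q_linear (*) (\<lambda>a. \<gamma> a \<omega> J)"
  unfolding q_linear_def
  by (auto simp: gamma_eq coef_add coef_scale sum.distrib[symmetric] sum_distrib_left distrib_right
      mult.assoc case_prod_unfold intro!: sum.cong)

text \<open>Only the mixed terms survive isotropy, and expanding the part in
  \<open>n_q_minus\<close> over \<open>ys\<close> turns each of them into a sum of products of
  coordinates.\<close>

lemma killing_eq_coef:
  assumes "a \<in> q" "b \<in> q"
  shows "killing a b = (\<Sum>i<n. coef a True i * coef b False i) + (\<Sum>i<n. coef a False i * coef b True i)"
proof -
  have minus: "killing x (b - plus_part b) = (\<Sum>i<n. killing x (ys ! i) * coef b False i)" if "b \<in> q" for x b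
  proof -
    have "b - plus_part b \<in> span (set ys)" using plus_part(2)[OF that] basis_ys(3) by simp
    then have "b - plus_part b = (\<Sum>y\<in>set ys. representation (set ys) (b - plus_part b) y *s y)"
      using sum_representation_eq[OF basis_ys(2), of "b - plus_part b" "set ys"] by simp
    then have "killing x (b - plus_part b) =
        (\<Sum>y\<in>set ys. representation (set ys) (b - plus_part b) y * killing x y)"
      by (metis (no_types, lifting) killing_scale_right killing_sum(2) sum.cong)
    also have "\<dots> = (\<Sum>i<n. representation (set ys) (b - plus_part b) (ys ! i) * killing x (ys ! i))"
      by (rule sum.reindex_bij_betw[symmetric, OF bij_betw_nth]) (simp_all add: basis_ys)
    finally show ?thesis unfolding coef_def by (simp add: mult.commute)
  qed
  have "killing a b = killing (plus_part a + (a - plus_part a)) (plus_part b + (b - plus_part b))" by simp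
  also have "\<dots> = killing (plus_part a) (b - plus_part b) + killing (a - plus_part a) (plus_part b)"
    unfolding killing_add_left killing_add_right
    using killing_n_q_plus killing_n_q_minus plus_part assms by simp
  also have "killing (a - plus_part a) (plus_part b) = killing (plus_part b) (a - plus_part a)"
    by (rule killing_sym)
  finally show ?thesis
    unfolding minus[OF assms(2)] minus[OF assms(1)] coef_def by (simp add: mult.commute)
qed

text \<open>Bilinearity reduces the anticommutator to those of the elementary operators. Only
  creation and annihilation of the same index contribute, and the surviving coefficients add up to
  the form.\<close>

lemma clifford_relation:
  assumes "a \<in> q" "b \<in> q"
  shows "\<gamma> a (\<gamma> b \<omega>) J + \<gamma> b (\<gamma> a \<omega>) J = killing a b * res n \<omega> J"
proof -
  let ?X = "UNIV \<times> {..<n} :: (bool \<times> nat) set"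
  let ?E = "\<lambda>x. elem_op n (fst x) (snd x)"
  let ?c = "\<lambda>a x. coef a (fst x) (snd x)"
  have g: "\<gamma> a \<omega> = (\<lambda>J. \<Sum>x\<in>?X. ?c a x * ?E x \<omega> J)" for a \<omega>
    by (rule ext) (simp add: gamma_eq case_prod_unfold)
  have gg: "\<gamma> a (\<gamma> b \<omega>) J = (\<Sum>x\<in>?X. \<Sum>y\<in>?X. ?c a x * ?c b y * ?E x (?E y \<omega>) J)" for a b
  proof -
    have "\<gamma> a (\<gamma> b \<omega>) J = (\<Sum>x\<in>?X. ?c a x * ?E x (\<gamma> b \<omega>) J)" by (subst g) simp
    also have "\<dots> = (\<Sum>x\<in>?X. ?c a x * (\<Sum>y\<in>?X. ?c b y * ?E x (?E y \<omega>) J))"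
      by (rule sum.cong[OF refl]) (simp only: g[of b] spin_op_sum[OF spin_op_elem_op])
    finally show ?thesis by (simp add: sum_distrib_left mult.assoc)
  qed
  have "\<gamma> a (\<gamma> b \<omega>) J + \<gamma> b (\<gamma> a \<omega>) J =
      (\<Sum>x\<in>?X. \<Sum>y\<in>?X. ?c a x * ?c b y * (?E x (?E y \<omega>) J + ?E y (?E x \<omega>) J))"
  proof -
    have "\<gamma> b (\<gamma> a \<omega>) J = (\<Sum>x\<in>?X. \<Sum>y\<in>?X. ?c b y * ?c a x * ?E y (?E x \<omega>) J)"
      unfolding gg by (rule sum.swap)
    then show ?thesis unfolding gg[of a b] by (simp add: sum.distrib[symmetric] algebra_simps)
  qed
  also have "\<dots> = (\<Sum>x\<in>?X. \<Sum>y\<in>?X. if y = (\<not> fst x, snd x) then ?c a x * ?c b y * res n \<omega> J else 0)"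
    by (intro sum.cong refl) (subst elem_op_anticommute, auto)
  also have "\<dots> = (\<Sum>x\<in>?X. ?c a x * coef b (\<not> fst x) (snd x) * res n \<omega> J)"
  proof (rule sum.cong[OF refl])
    fix x assume "x \<in> ?X"
    then have "(\<not> fst x, snd x) \<in> ?X" by auto
    then show "(\<Sum>y\<in>?X. if y = (\<not> fst x, snd x) then ?c a x * ?c b y * res n \<omega> J else 0) =
        ?c a x * coef b (\<not> fst x) (snd x) * res n \<omega> J"
      by (subst sum.delta) auto
  qed
  also have "\<dots> = (\<Sum>x\<in>?X. ?c a x * coef b (\<not> fst x) (snd x)) * res n \<omega> J"
    by (simp add: sum_distrib_right)
  also have "(\<Sum>x\<in>?X. ?c a x * coef b (\<not> fst x) (snd x)) = killing a b"
  proof -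
    have "(\<Sum>x\<in>?X. ?c a x * coef b (\<not> fst x) (snd x)) =
        (\<Sum>s\<in>UNIV. \<Sum>i<n. coef a s i * coef b (\<not> s) i)"
      by (simp add: sum.cartesian_product case_prod_unfold)
    then show ?thesis unfolding killing_eq_coef[OF assms] by (simp add: UNIV_bool)
  qed
  finally show ?thesis .
qed


subsection \<open>The spin representation\<close>

definition comm :: "'g \<Rightarrow> 'g \<Rightarrow> (nat set \<Rightarrow> complex) \<Rightarrow> nat set \<Rightarrow> complex" where
  "comm a b \<omega> J = \<gamma> a (\<gamma> b \<omega>) J - \<gamma> b (\<gamma> a \<omega>) J"

text \<open>A closed form for the spin action of \<open>br X\<close>. A skew \<open>A\<close> on
  \<open>q\<close> is \<open>1/2\<close> of the sum of the
  \<open>so_elem (A z\<^sub>j) z\<^sub>j\<close>, and lifting \<open>so_elem\<close> brings another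
  \<open>1/2\<close>.\<close>

definition sp :: "'g \<Rightarrow> (nat set \<Rightarrow> complex) \<Rightarrow> nat set \<Rightarrow> complex" where
  "sp X \<omega> J = (\<Sum>j<m. 1/4 * comm (br X (z j)) (z j) \<omega> J)"

lemma comm_anti: "comm a b \<omega> J = - comm b a \<omega> J"
  unfolding comm_def by simp

lemma gamma_gamma_linear: "q_linear (*) (\<lambda>b. \<gamma> a (\<gamma> b \<omega>) J)"
proof -
  have "\<gamma> a (\<gamma> (u + v) \<omega>) J = \<gamma> a (\<gamma> u \<omega>) J + \<gamma> a (\<gamma> v \<omega>) J" if "u \<in> q" "v \<in> q" for u v
  proof -
    have "\<gamma> (u + v) \<omega> = (\<lambda>J. \<gamma> u \<omega> J + \<gamma> v \<omega> J)"
      by (rule ext) (rule q_linearD(1)[OF q_linear_gamma that])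
    then show ?thesis using spin_op_add[OF spin_op_gamma] by simp
  qed
  moreover have "\<gamma> a (\<gamma> (c *s u) \<omega>) J = c * \<gamma> a (\<gamma> u \<omega>) J" if "u \<in> q" for u c
  proof -
    have "\<gamma> (c *s u) \<omega> = (\<lambda>J. c * \<gamma> u \<omega> J)"
      by (rule ext) (rule q_linearD(2)[OF q_linear_gamma that])
    then show ?thesis using spin_op_scale[OF spin_op_gamma] by simp
  qed
  ultimately show ?thesis unfolding q_linear_def by blast
qed

lemma q_linear_diff:
  assumes "q_linear (*) f" "q_linear (*) g"
  shows "q_linear (*) (\<lambda>u. f u - g u)"
  using assms unfolding q_linear_def by (simp add: algebra_simps)

lemma q_linear_comm: "q_linear (*) (\<lambda>a. comm a b \<omega> J)" "q_linear (*) (\<lambda>b. comm a b \<omega> J)"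
  unfolding comm_def by (intro q_linear_diff gamma_gamma_linear q_linear_gamma)+

lemma spin_op_comm: "spin_op n (comm a b)"
proof -
  have eq: "comm a b = (\<lambda>\<omega> J. \<gamma> a (\<gamma> b \<omega>) J - \<gamma> b (\<gamma> a \<omega>) J)"
    by (intro ext) (rule comm_def)
  show ?thesis
    unfolding eq by (rule spin_op_minus) (rule spin_op_comp[OF spin_op_gamma spin_op_gamma])+
qed

lemma parity_comm: "parity n True (comm a b)"
proof -
  have eq: "comm a b = (\<lambda>\<omega> J. \<gamma> a (\<gamma> b \<omega>) J - \<gamma> b (\<gamma> a \<omega>) J)"
    by (intro ext) (rule comm_def)
  have "parity n True (\<lambda>\<omega>. \<gamma> a (\<gamma> b \<omega>))" for a b
    using parity_comp[OF spin_op_gamma spin_op_gamma parity_gamma parity_gamma] by simp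
  then show ?thesis unfolding eq by (intro parity_minus)
qed

lemma sp_eq: "sp X = (\<lambda>\<omega> J. \<Sum>j<m. 1/4 * comm (br X (z j)) (z j) \<omega> J)"
  by (intro ext) (rule sp_def)

lemma spin_op_sp: "spin_op n (sp X)"
  unfolding sp_eq by (rule spin_op_lincomb) (rule spin_op_comm)

lemma parity_sp: "parity n True (sp X)"
  unfolding sp_eq by (rule parity_lincomb) (rule parity_comm)

lemma br_skew_q: "X \<in> h \<Longrightarrow> u \<in> q \<Longrightarrow> v \<in> q \<Longrightarrow> killing (br X u) v = - killing u (br X v)"
  by (rule killing_skew)

lemma so_elem_in_q: "a \<in> q \<Longrightarrow> b \<in> q \<Longrightarrow> so_elem a b v \<in> q"
  unfolding so_elem_def by (intro subspace_diff[OF subspace_q] subspace_scale[OF subspace_q])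

text \<open>Expanding \<open>a\<close> and \<open>b\<close> in the basis gives
  \<open>comm a b - comm b a\<close>. The resulting factor 2 reconciles the constant
  \<open>1/4\<close> of \<open>sp\<close> with the \<open>1/2\<close> of
  \<open>spin_lift\<close>.\<close>

lemma sum_comm_so_elem:
  assumes "a \<in> q" "b \<in> q"
  shows "(\<Sum>j<m. comm (so_elem a b (z j)) (z j) \<omega> J) = 2 * comm a b \<omega> J"
proof -
  have "comm (so_elem a b (z j)) (z j) \<omega> J =
      killing (z j) b * comm a (z j) \<omega> J - killing (z j) a * comm b (z j) \<omega> J" for j
  proof -
    have "so_elem a b (z j) + killing (z j) a *s b = killing (z j) b *s a"
      unfolding so_elem_def by (simp add: killing_sym)
    then have "comm (killing (z j) b *s a) (z j) \<omega> J =
        comm (so_elem a b (z j)) (z j) \<omega> J + comm (killing (z j) a *s b) (z j) \<omega> J"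
      using q_linearD(1)[OF q_linear_comm(1) so_elem_in_q[OF assms] subspace_scale[OF subspace_q assms(2)]]
      by metis
    then show ?thesis using q_linearD(2)[OF q_linear_comm(1)] assms by simp
  qed
  then have "(\<Sum>j<m. comm (so_elem a b (z j)) (z j) \<omega> J) = comm a b \<omega> J - comm b a \<omega> J"
    using q_linear_expansion[OF vector_space_mult q_linear_comm(2) assms(2), of a \<omega> J]
      q_linear_expansion[OF vector_space_mult q_linear_comm(2) assms(1), of b \<omega> J]
    by (simp add: sum_subtractf)
  then show ?thesis using comm_anti[of b a \<omega> J] by simp
qed

text \<open>The right-hand side depends only on the endomorphism represented by \<open>ps\<close>, which is what makes the
  description in \<open>spin_lift\<close> definite.\<close>

lemma spin_lift_list:
  assumes "set ps \<subseteq> q \<times> q"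
  shows "(\<Sum>(a, b)\<leftarrow>ps. 1/2 * (\<gamma> a (\<gamma> b \<omega>) J - \<gamma> b (\<gamma> a \<omega>) J)) =
    (\<Sum>j<m. 1/4 * comm (\<Sum>(a, b)\<leftarrow>ps. so_elem a b (z j)) (z j) \<omega> J)"
  using assms
proof (induction ps)
  case Nil
  have "comm (0 *s 0) (z j) \<omega> J = 0 * comm 0 (z j) \<omega> J" for j
    by (rule q_linearD(2)[OF q_linear_comm(1) subspace_0[OF subspace_q]])
  then show ?case by simp
next
  case (Cons p ps)
  obtain a b where p: "p = (a, b)" by (cases p)
  have ab: "a \<in> q" "b \<in> q" using Cons.prems p by auto
  have sum_in_q: "(\<Sum>(a, b)\<leftarrow>ps. so_elem a b v) \<in> q" if "set ps \<subseteq> q \<times> q" for ps v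
    using that
  proof (induction ps)
    case Nil
    then show ?case using subspace_0[OF subspace_q] by simp
  next
    case (Cons p ps)
    then show ?case using so_elem_in_q subspace_add[OF subspace_q] by (cases p) auto
  qed
  have "comm (\<Sum>(a, b)\<leftarrow>p # ps. so_elem a b (z j)) (z j) \<omega> J =
      comm (so_elem a b (z j)) (z j) \<omega> J + comm (\<Sum>(a, b)\<leftarrow>ps. so_elem a b (z j)) (z j) \<omega> J" for j
    using q_linearD(1)[OF q_linear_comm(1) so_elem_in_q[OF ab] sum_in_q] Cons.prems p by simp
  then have "(\<Sum>j<m. 1/4 * comm (\<Sum>(a, b)\<leftarrow>p # ps. so_elem a b (z j)) (z j) \<omega> J) =
      1/4 * (\<Sum>j<m. comm (so_elem a b (z j)) (z j) \<omega> J) +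
      (\<Sum>j<m. 1/4 * comm (\<Sum>(a, b)\<leftarrow>ps. so_elem a b (z j)) (z j) \<omega> J)"
    by (simp only: distrib_left sum.distrib sum_distrib_left)
  also have "1/4 * (\<Sum>j<m. comm (so_elem a b (z j)) (z j) \<omega> J) = 1/2 * comm a b \<omega> J"
    unfolding sum_comm_so_elem[OF ab] by simp
  finally show ?case using Cons p by (simp add: comm_def)
qed

text \<open>Uniqueness in the definite description is \<open>spin_lift_list\<close>; existence needs
  one explicit list.\<close>

lemma spin_lift_br:
  assumes X: "X \<in> h"
  shows "spin_lift (br X) = sp X"
  unfolding spin_lift_def
proof (rule the_equality)
  \<comment> \<open>Each of the two terms of \<open>so_elem\<close>, summed over this list, gives
    \<open>1/2\<close> of \<open>br X v\<close>: the first by expanding \<open>v\<close>, the second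
    by skewness and expanding \<open>br X v\<close>.\<close>
  define ps where "ps = map (\<lambda>j. ((1/2) *s br X (z j), z j)) [0..<m]"
  have ps: "set ps \<subseteq> q \<times> q"
    unfolding ps_def using z_in_q br_h_q[OF X] subspace_scale[OF subspace_q] by auto
  have sum: "br X v = (\<Sum>(a, b)\<leftarrow>ps. so_elem a b v)" if v: "v \<in> q" for v
  proof -
    interpret bX: Vector_Spaces.linear scale scale "br X" by (rule linear_br)
    have "(\<Sum>(a, b)\<leftarrow>ps. so_elem a b v) = (\<Sum>j<m. so_elem ((1/2) *s br X (z j)) (z j) v)"
      unfolding ps_def by (simp add: comp_def interv_sum_list_conv_sum_set_nat atLeast0LessThan)
    also have "\<dots> = (\<Sum>j<m. (1/2) *s (killing (z j) v *s br X (z j)) + (1/2) *s (killing (z j) (br X v) *s z j))"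
    proof (rule sum.cong[OF refl])
      fix j
      have "killing (br X (z j)) v = - killing (z j) (br X v)" by (rule killing_skew)
      then show "so_elem ((1/2) *s br X (z j)) (z j) v =
          (1/2) *s (killing (z j) v *s br X (z j)) + (1/2) *s (killing (z j) (br X v) *s z j)"
        unfolding so_elem_def by (simp add: killing_scale_left mult.commute)
    qed
    also have "\<dots> = (1/2) *s br X (\<Sum>j<m. killing (z j) v *s z j) + (1/2) *s (\<Sum>j<m. killing (z j) (br X v) *s z j)"
      by (simp only: sum.distrib scale_sum_right bX.sum bX.scale)
    also have "\<dots> = (1/2) *s br X v + (1/2) *s br X v"
      using q_expansion[OF v] q_expansion[OF br_h_q[OF X v]] by simp
    also have "\<dots> = br X v" unfolding scale_left_distrib[symmetric] by simp
    finally show ?thesis by simp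
  qed
  show "\<exists>ps. set ps \<subseteq> q \<times> q \<and> (\<forall>v\<in>q. br X v = (\<Sum>(a, b)\<leftarrow>ps. so_elem a b v)) \<and>
      sp X = (\<lambda>\<omega> J. \<Sum>(a, b)\<leftarrow>ps. 1/2 * (\<gamma> a (\<gamma> b \<omega>) J - \<gamma> b (\<gamma> a \<omega>) J))"
  proof (intro exI conjI ballI)
    show "sp X = (\<lambda>\<omega> J. \<Sum>(a, b)\<leftarrow>ps. 1/2 * (\<gamma> a (\<gamma> b \<omega>) J - \<gamma> b (\<gamma> a \<omega>) J))"
      unfolding sp_eq spin_lift_list[OF ps]
      by (intro ext sum.cong refl) (simp only: sum[OF z_in_q] lessThan_iff)
  qed (rule ps, rule sum)
  fix T
  assume "\<exists>ps. set ps \<subseteq> q \<times> q \<and> (\<forall>v\<in>q. br X v = (\<Sum>(a, b)\<leftarrow>ps. so_elem a b v)) \<and>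
      T = (\<lambda>\<omega> J. \<Sum>(a, b)\<leftarrow>ps. 1/2 * (\<gamma> a (\<gamma> b \<omega>) J - \<gamma> b (\<gamma> a \<omega>) J))"
  then obtain ps where ps': "set ps \<subseteq> q \<times> q" "\<forall>v\<in>q. br X v = (\<Sum>(a, b)\<leftarrow>ps. so_elem a b v)"
      "T = (\<lambda>\<omega> J. \<Sum>(a, b)\<leftarrow>ps. 1/2 * (\<gamma> a (\<gamma> b \<omega>) J - \<gamma> b (\<gamma> a \<omega>) J))"
    by (elim exE conjE)
  show "T = sp X"
    unfolding sp_eq ps'(3) spin_lift_list[OF ps'(1)]
    by (intro ext sum.cong refl) (simp only: ps'(2)[rule_format, OF z_in_q] lessThan_iff)
qed

text \<open>The Clifford relation moves \<open>\<gamma> v\<close> first across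
  \<open>\<gamma> b\<close> and then across \<open>\<gamma> a\<close>.\<close>

lemma gamma_shift:
  assumes "a \<in> q" "b \<in> q" "v \<in> q"
  shows "\<gamma> a (\<gamma> b (\<gamma> v \<omega>)) J =
    killing b v * \<gamma> a \<omega> J - killing a v * \<gamma> b \<omega> J + \<gamma> v (\<gamma> a (\<gamma> b \<omega>)) J"
proof -
  have "\<gamma> b (\<gamma> v \<omega>) = (\<lambda>J. killing b v * res n \<omega> J - \<gamma> v (\<gamma> b \<omega>) J)"
    by (rule ext) (use clifford_relation[OF assms(2,3)] in \<open>simp add: eq_diff_eq\<close>)
  then have "\<gamma> a (\<gamma> b (\<gamma> v \<omega>)) J = killing b v * \<gamma> a \<omega> J - \<gamma> a (\<gamma> v (\<gamma> b \<omega>)) J"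
    using spin_op_diff[OF spin_op_gamma, of a "\<lambda>J. killing b v * res n \<omega> J" "\<gamma> v (\<gamma> b \<omega>)" J]
      spin_op_scale[OF spin_op_gamma, of a "killing b v" "res n \<omega>" J]
    by (simp add: spin_op_res[OF spin_op_gamma])
  moreover have "\<gamma> a (\<gamma> v (\<gamma> b \<omega>)) J = killing a v * \<gamma> b \<omega> J - \<gamma> v (\<gamma> a (\<gamma> b \<omega>)) J"
    using clifford_relation[OF assms(1,3), of "\<gamma> b \<omega>" J] by (simp add: res_gamma eq_diff_eq)
  ultimately show ?thesis by simp
qed

text \<open>With the factor \<open>1/2\<close> of \<open>spin_lift\<close> the right-hand side
  becomes \<open>\<gamma> (so_elem a b v)\<close>: the lift is compatible with the vector
  representation.\<close>

lemma comm_gamma: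
  assumes "a \<in> q" "b \<in> q" "v \<in> q"
  shows "comm a b (\<gamma> v \<omega>) J - \<gamma> v (comm a b \<omega>) J =
    2 * (killing b v * \<gamma> a \<omega> J - killing a v * \<gamma> b \<omega> J)"
proof -
  have "comm a b \<omega> = (\<lambda>J. \<gamma> a (\<gamma> b \<omega>) J - \<gamma> b (\<gamma> a \<omega>) J)" by (rule ext) (rule comm_def)
  then have "\<gamma> v (comm a b \<omega>) J = \<gamma> v (\<gamma> a (\<gamma> b \<omega>)) J - \<gamma> v (\<gamma> b (\<gamma> a \<omega>)) J"
    using spin_op_diff[OF spin_op_gamma] by simp
  then show ?thesis
    unfolding comm_def gamma_shift[OF assms] gamma_shift[OF assms(2,1,3)] by simp
qed

text \<open>The commutator of \<open>sp X\<close> with \<open>\<gamma> v\<close> consists of two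
  basis sums, each equal to half of \<open>\<gamma> (br X v)\<close>: one by expanding
  \<open>v\<close>, the other by skewness and expanding \<open>br X v\<close>.\<close>

lemma sp_gamma:
  assumes X: "X \<in> h" and v: "v \<in> q"
  shows "sp X (\<gamma> v \<omega>) J = \<gamma> v (sp X \<omega>) J + \<gamma> (br X v) \<omega> J"
proof -
  have "sp X \<omega> = (\<lambda>J. \<Sum>j<m. 1/4 * comm (br X (z j)) (z j) \<omega> J)" by (rule ext) (rule sp_def)
  then have "\<gamma> v (sp X \<omega>) J = (\<Sum>j<m. 1/4 * \<gamma> v (comm (br X (z j)) (z j) \<omega>) J)"
    using spin_op_sum[OF spin_op_gamma, of v "\<lambda>j. 1/4" "\<lambda>j. comm (br X (z j)) (z j) \<omega>" "{..<m}" J]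
    by simp
  then have "sp X (\<gamma> v \<omega>) J - \<gamma> v (sp X \<omega>) J =
      (\<Sum>j<m. 1/4 * (comm (br X (z j)) (z j) (\<gamma> v \<omega>) J - \<gamma> v (comm (br X (z j)) (z j) \<omega>) J))"
    by (simp add: sp_def sum_subtractf right_diff_distrib)
  also have "\<dots> = (\<Sum>j<m. 1/2 * (killing (z j) v * \<gamma> (br X (z j)) \<omega> J + killing (z j) (br X v) * \<gamma> (z j) \<omega> J))"
  proof (rule sum.cong[OF refl])
    fix j assume "j \<in> {..<m}"
    then have "z j \<in> q" "br X (z j) \<in> q" using z_in_q br_h_q[OF X] by auto
    moreover have "killing (br X (z j)) v = - killing (z j) (br X v)" by (rule killing_skew)
    ultimately show "1/4 * (comm (br X (z j)) (z j) (\<gamma> v \<omega>) J - \<gamma> v (comm (br X (z j)) (z j) \<omega>) J) =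
        1/2 * (killing (z j) v * \<gamma> (br X (z j)) \<omega> J + killing (z j) (br X v) * \<gamma> (z j) \<omega> J)"
      using comm_gamma[OF _ _ v, of "br X (z j)" "z j"] by simp
  qed
  also have "\<dots> = 1/2 * ((\<Sum>j<m. killing (z j) v * \<gamma> (br X (z j)) \<omega> J) + (\<Sum>j<m. killing (z j) (br X v) * \<gamma> (z j) \<omega> J))"
    by (simp only: sum.distrib sum_distrib_left distrib_left)
  also have "(\<Sum>j<m. killing (z j) (br X v) * \<gamma> (z j) \<omega> J) = \<gamma> (br X v) \<omega> J"
    using q_linear_expansion[OF vector_space_mult q_linear_gamma br_h_q[OF X v]] by simp
  also have "(\<Sum>j<m. killing (z j) v * \<gamma> (br X (z j)) \<omega> J) = \<gamma> (br X v) \<omega> J"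
  proof -
    have "q_linear (*) (\<lambda>u. \<gamma> (br X u) \<omega> J)"
      unfolding q_linear_def using q_linearD[OF q_linear_gamma] br_h_q[OF X]
      by (simp add: br_add_right br_scale_right)
    from q_linear_expansion[OF vector_space_mult this v] show ?thesis by simp
  qed
  finally have "sp X (\<gamma> v \<omega>) J - \<gamma> v (sp X \<omega>) J = \<gamma> (br X v) \<omega> J" by simp
  then show ?thesis by (simp only: diff_eq_eq add.commute)
qed

lemma sp_gamma_gamma:
  assumes X: "X \<in> h" and "a \<in> q" "b \<in> q"
  shows "sp X (\<gamma> a (\<gamma> b \<omega>)) J =
    \<gamma> a (\<gamma> b (sp X \<omega>)) J + \<gamma> a (\<gamma> (br X b) \<omega>) J + \<gamma> (br X a) (\<gamma> b \<omega>) J"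
proof -
  have "sp X (\<gamma> b \<omega>) = (\<lambda>J. \<gamma> b (sp X \<omega>) J + \<gamma> (br X b) \<omega> J)"
    by (rule ext) (rule sp_gamma[OF X assms(3)])
  then show ?thesis
    unfolding sp_gamma[OF X assms(2)] using spin_op_add[OF spin_op_gamma] by simp
qed

text \<open>\<open>sp X\<close> acts as a derivation on the commutators in \<open>sp Y\<close>.
  Where \<open>br X\<close> hits the second factor, \<open>skew_switch\<close> moves it to the
  first; the two derivative terms then form the commutator of \<open>br X\<close> and
  \<open>br Y\<close>, which is \<open>br (br X Y)\<close>.\<close>

lemma sp_br:
  assumes X: "X \<in> h" and Y: "Y \<in> h"
  shows "sp X (sp Y \<omega>) J = sp (br X Y) \<omega> J + sp Y (sp X \<omega>) J"
proof -
  have q1: "z j \<in> q" "br X (z j) \<in> q" "br Y (z j) \<in> q" "br X (br Y (z j)) \<in> q" "br Y (br X (z j)) \<in> q" if "j < m" for j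
    using z_in_q br_h_q[OF X] br_h_q[OF Y] that by blast+
  have "sp Y \<omega> = (\<lambda>J. \<Sum>j<m. 1/4 * comm (br Y (z j)) (z j) \<omega> J)" by (rule ext) (rule sp_def)
  then have "sp X (sp Y \<omega>) J = (\<Sum>j<m. 1/4 * sp X (comm (br Y (z j)) (z j) \<omega>) J)"
    using spin_op_sum[OF spin_op_sp, of X "\<lambda>j. 1/4" "\<lambda>j. comm (br Y (z j)) (z j) \<omega>" "{..<m}" J]
    by simp
  also have "\<dots> = (\<Sum>j<m. 1/4 * (comm (br Y (z j)) (z j) (sp X \<omega>) J +
      comm (br X (br Y (z j))) (z j) \<omega> J + comm (br Y (z j)) (br X (z j)) \<omega> J))"
  proof (rule sum.cong[OF refl])
    fix j assume j: "j \<in> {..<m}"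
    have "comm (br Y (z j)) (z j) \<omega> = (\<lambda>J. \<gamma> (br Y (z j)) (\<gamma> (z j) \<omega>) J - \<gamma> (z j) (\<gamma> (br Y (z j)) \<omega>) J)"
      by (rule ext) (rule comm_def)
    then have "sp X (comm (br Y (z j)) (z j) \<omega>) J =
        sp X (\<gamma> (br Y (z j)) (\<gamma> (z j) \<omega>)) J - sp X (\<gamma> (z j) (\<gamma> (br Y (z j)) \<omega>)) J"
      using spin_op_diff[OF spin_op_sp] by simp
    then show "1/4 * sp X (comm (br Y (z j)) (z j) \<omega>) J = 1/4 * (comm (br Y (z j)) (z j) (sp X \<omega>) J +
      comm (br X (br Y (z j))) (z j) \<omega> J + comm (br Y (z j)) (br X (z j)) \<omega> J)"
      using sp_gamma_gamma[OF X] q1[of j] j by (simp add: comm_def)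
  qed
  also have "\<dots> = sp Y (sp X \<omega>) J + 1/4 * ((\<Sum>j<m. comm (br X (br Y (z j))) (z j) \<omega> J) +
      (\<Sum>j<m. comm (br Y (z j)) (br X (z j)) \<omega> J))"
    unfolding sp_def[of Y] by (simp only: distrib_left sum.distrib sum_distrib_left add.assoc)
  also have "(\<Sum>j<m. comm (br Y (z j)) (br X (z j)) \<omega> J) = - (\<Sum>j<m. comm (br Y (br X (z j))) (z j) \<omega> J)"
  proof -
    have "q_linear (*) (\<lambda>u. comm (br Y u) v \<omega> J)" for v
      unfolding q_linear_def using q_linearD[OF q_linear_comm(1)] br_h_q[OF Y]
      by (simp add: br_add_right br_scale_right)
    then have "(\<Sum>j<m. comm (br Y (br X (z j))) (z j) \<omega> J) = - (\<Sum>j<m. comm (br Y (z j)) (br X (z j)) \<omega> J)"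
      using skew_switch[OF vector_space_mult, of "\<lambda>u v. comm (br Y u) v \<omega> J" "br X"]
        q_linear_comm(2) br_h_q[OF X] br_skew_q[OF X] by blast
    then show ?thesis by simp
  qed
  also have "1/4 * ((\<Sum>j<m. comm (br X (br Y (z j))) (z j) \<omega> J) + - (\<Sum>j<m. comm (br Y (br X (z j))) (z j) \<omega> J)) =
      sp (br X Y) \<omega> J"
  proof -
    have "comm (br (br X Y) (z j)) (z j) \<omega> J =
        comm (br X (br Y (z j))) (z j) \<omega> J - comm (br Y (br X (z j))) (z j) \<omega> J" if "j < m" for j
    proof -
      have "br X (br Y (z j)) = br (br X Y) (z j) + br Y (br X (z j))" by (simp add: br_br)
      then show ?thesis
        using q_linearD(1)[OF q_linear_comm(1), of "br (br X Y) (z j)" "br Y (br X (z j))" "z j" \<omega> J]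
          br_h_q[OF br_h[OF X Y] z_in_q[OF that]] q1(5)[OF that] by simp
    qed
    then have "sp (br X Y) \<omega> J = (\<Sum>j<m. 1/4 * (comm (br X (br Y (z j))) (z j) \<omega> J - comm (br Y (br X (z j))) (z j) \<omega> J))"
      unfolding sp_def by (intro sum.cong) auto
    then show ?thesis by (simp add: sum_subtractf sum_distrib_left right_diff_distrib)
  qed
  finally show ?thesis by simp
qed

lemma sp_add:
  assumes "X \<in> h" "Y \<in> h"
  shows "sp (X + Y) \<omega> J = sp X \<omega> J + sp Y \<omega> J"
  unfolding sp_def sum.distrib[symmetric] br_add_left
  by (intro sum.cong refl)
    (simp add: q_linearD(1)[OF q_linear_comm(1) br_h_q[OF assms(1) z_in_q] br_h_q[OF assms(2) z_in_q]])

lemma sp_scale: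
  assumes "X \<in> h"
  shows "sp (c *s X) \<omega> J = c * sp X \<omega> J"
  unfolding sp_def sum_distrib_left br_scale_left
  by (intro sum.cong refl)
    (simp add: q_linearD(2)[OF q_linear_comm(1) br_h_q[OF assms(1) z_in_q]])


subsection \<open>Invariance of the cubic element\<close>

definition cub :: "'g \<Rightarrow> 'g \<Rightarrow> 'g \<Rightarrow> complex" where
  "cub a b c = killing a (br b c)"

text \<open>The Jacobi identity distributes \<open>br X\<close> over the inner bracket, and skewness
  of \<open>br X\<close> for the form produces the first term.\<close>

lemma cub_invariant: "cub (br X a) b c + cub a (br X b) c + cub a b (br X c) = 0"
proof -
  have "br X (br b c) = br (br X b) c + br b (br X c)" using br_br[of X b c] by simp
  then have "killing a (br X (br b c)) = cub a (br X b) c + cub a b (br X c)"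
    by (simp add: cub_def killing_add_right)
  moreover have "cub (br X a) b c = - killing a (br X (br b c))"
    unfolding cub_def by (rule killing_skew)
  ultimately show ?thesis by simp
qed

definition mon :: "'g \<Rightarrow> 'g \<Rightarrow> 'g \<Rightarrow> (nat set \<Rightarrow> complex) \<Rightarrow> nat set \<Rightarrow> complex" where
  "mon a b c \<omega> = \<gamma> a (\<gamma> b (\<gamma> c \<omega>))"

lemma gamma_cubic_eq:
  "\<gamma>_cubic \<omega> J = 1/6 * (\<Sum>i<m. \<Sum>j<m. \<Sum>k<m. cub (z i) (z j) (z k) * mon (z i) (z j) (z k) \<omega> J)"
  unfolding \<gamma>_cubic_def cub_def mon_def ..

lemma gamma_cubic_lincomb:
  "\<gamma>_cubic = (\<lambda>\<omega> J. \<Sum>x\<in>{..<m} \<times> {..<m} \<times> {..<m}.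
    (1/6 * cub (z (fst x)) (z (fst (snd x))) (z (snd (snd x)))) *
      mon (z (fst x)) (z (fst (snd x))) (z (snd (snd x))) \<omega> J)"
  by (intro ext) (simp add: gamma_cubic_eq sum.cartesian_product case_prod_unfold sum_distrib_left mult.assoc)

lemma spin_op_mon: "spin_op n (mon a b c)"
  using spin_op_comp[OF spin_op_gamma spin_op_comp[OF spin_op_gamma spin_op_gamma]]
  unfolding mon_def[abs_def] .

lemma parity_mon: "parity n False (mon a b c)"
  using parity_comp[OF spin_op_gamma spin_op_comp[OF spin_op_gamma spin_op_gamma] parity_gamma
      parity_comp[OF spin_op_gamma spin_op_gamma parity_gamma parity_gamma]]
  unfolding mon_def[abs_def] by simp

lemma spin_op_cubic: "spin_op n \<gamma>_cubic"
  unfolding gamma_cubic_lincomb by (rule spin_op_lincomb) (rule spin_op_mon)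

lemma parity_cubic: "parity n False \<gamma>_cubic"
  unfolding gamma_cubic_lincomb by (rule parity_lincomb) (rule parity_mon)

lemma q_linear_mon:
  "q_linear (*) (\<lambda>a. mon a b c \<omega> J)" "q_linear (*) (\<lambda>b. mon a b c \<omega> J)" "q_linear (*) (\<lambda>c. mon a b c \<omega> J)"
proof -
  show "q_linear (*) (\<lambda>a. mon a b c \<omega> J)" unfolding mon_def by (rule q_linear_gamma)
  show "q_linear (*) (\<lambda>b. mon a b c \<omega> J)" unfolding mon_def by (rule gamma_gamma_linear)
  have "mon a b (u + v) \<omega> J = mon a b u \<omega> J + mon a b v \<omega> J" if "u \<in> q" "v \<in> q" for u v
  proof -
    have "\<gamma> (u + v) \<omega> = (\<lambda>J. \<gamma> u \<omega> J + \<gamma> v \<omega> J)"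
      by (rule ext) (rule q_linearD(1)[OF q_linear_gamma that])
    then show ?thesis
      unfolding mon_def using spin_op_add[OF spin_op_comp[OF spin_op_gamma spin_op_gamma]] by simp
  qed
  moreover have "mon a b (d *s u) \<omega> J = d * mon a b u \<omega> J" if "u \<in> q" for u d
  proof -
    have "\<gamma> (d *s u) \<omega> = (\<lambda>J. d * \<gamma> u \<omega> J)"
      by (rule ext) (rule q_linearD(2)[OF q_linear_gamma that])
    then show ?thesis
      unfolding mon_def using spin_op_scale[OF spin_op_comp[OF spin_op_gamma spin_op_gamma]] by simp
  qed
  ultimately show "q_linear (*) (\<lambda>c. mon a b c \<omega> J)" unfolding q_linear_def by blast
qed

lemma sp_mon:
  assumes X: "X \<in> h" and "a \<in> q" "b \<in> q" "c \<in> q"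
  shows "sp X (mon a b c \<omega>) J = mon a b c (sp X \<omega>) J +
    (mon (br X a) b c \<omega> J + mon a (br X b) c \<omega> J + mon a b (br X c) \<omega> J)"
proof -
  have "sp X (\<gamma> b (\<gamma> c \<omega>)) = (\<lambda>J. (\<gamma> b (\<gamma> c (sp X \<omega>)) J + \<gamma> b (\<gamma> (br X c) \<omega>) J) + \<gamma> (br X b) (\<gamma> c \<omega>) J)"
    by (rule ext) (rule sp_gamma_gamma[OF X assms(3,4)])
  then show ?thesis
    unfolding mon_def sp_gamma[OF X assms(2)] using spin_op_add[OF spin_op_gamma] by simp
qed

text \<open>The derivation rule leaves a sum over the three places where \<open>br X\<close> can act
  on a Clifford monomial. \<open>skew_switch\<close> moves it in each case to the coefficient, where
  the three terms cancel by \<open>cub_invariant\<close>.\<close>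

lemma sp_cubic:
  assumes X: "X \<in> h"
  shows "sp X (\<gamma>_cubic \<omega>) J = \<gamma>_cubic (sp X \<omega>) J"
proof -
  let ?S = "\<lambda>f. \<Sum>i<m. \<Sum>j<m. \<Sum>k<m. f (z i) (z j) (z k) :: complex"
  have lin1: "q_linear (*) (\<lambda>u. cub u b c * r)" "q_linear (*) (\<lambda>u. cub b u c * r)" "q_linear (*) (\<lambda>u. cub b c u * r)" for b c r
    unfolding q_linear_def cub_def
    by (simp_all add: killing_add_left killing_add_right killing_scale_left killing_scale_right
        br_add_left br_add_right br_scale_left br_scale_right algebra_simps)
  have lin2: "q_linear (*) (\<lambda>u. r * f u)" if "q_linear (*) f" for r f
    using that unfolding q_linear_def by (simp add: algebra_simps)
  note switch = skew_switch[OF vector_space_mult, of _ "br X"]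
  have s1: "(\<Sum>i<m. cub (z i) b c * mon (br X (z i)) b c \<omega> J) = - (\<Sum>i<m. cub (br X (z i)) b c * mon (z i) b c \<omega> J)" for b c
    using switch[of "\<lambda>u v. cub v b c * mon u b c \<omega> J"] lin1(1) lin2[OF q_linear_mon(1)] br_h_q[OF X] br_skew_q[OF X]
    by blast
  have s2: "(\<Sum>i<m. cub a (z i) c * mon a (br X (z i)) c \<omega> J) = - (\<Sum>i<m. cub a (br X (z i)) c * mon a (z i) c \<omega> J)" for a c
    using switch[of "\<lambda>u v. cub a v c * mon a u c \<omega> J"] lin1(2) lin2[OF q_linear_mon(2)] br_h_q[OF X] br_skew_q[OF X]
    by blast
  have s3: "(\<Sum>i<m. cub a b (z i) * mon a b (br X (z i)) \<omega> J) = - (\<Sum>i<m. cub a b (br X (z i)) * mon a b (z i) \<omega> J)" for a b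
    using switch[of "\<lambda>u v. cub a b v * mon a b u \<omega> J"] lin1(3) lin2[OF q_linear_mon(3)] br_h_q[OF X] br_skew_q[OF X]
    by blast
  have t1: "?S (\<lambda>a b c. cub a b c * mon (br X a) b c \<omega> J) = ?S (\<lambda>a b c. - (cub (br X a) b c * mon a b c \<omega> J))"
  proof -
    \<comment> \<open>The index being differentiated is made the innermost one, since
      \<open>skew_switch\<close> works on a single sum.\<close>
    have sw: "?S f = (\<Sum>j<m. \<Sum>k<m. \<Sum>i<m. f (z i) (z j) (z k))" for f :: "'g \<Rightarrow> 'g \<Rightarrow> 'g \<Rightarrow> complex"
      by (rule trans[OF sum.swap], rule sum.cong[OF refl], rule sum.swap)
    show ?thesis
      unfolding sw[of "\<lambda>a b c. cub a b c * mon (br X a) b c \<omega> J"]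
        sw[of "\<lambda>a b c. - (cub (br X a) b c * mon a b c \<omega> J)"]
      by (simp only: s1 sum_negf)
  qed
  have t2: "?S (\<lambda>a b c. cub a b c * mon a (br X b) c \<omega> J) = ?S (\<lambda>a b c. - (cub a (br X b) c * mon a b c \<omega> J))"
  proof -
    have sw: "?S f = (\<Sum>i<m. \<Sum>k<m. \<Sum>j<m. f (z i) (z j) (z k))" for f :: "'g \<Rightarrow> 'g \<Rightarrow> 'g \<Rightarrow> complex"
      by (rule sum.cong[OF refl], rule sum.swap)
    show ?thesis
      unfolding sw[of "\<lambda>a b c. cub a b c * mon a (br X b) c \<omega> J"]
        sw[of "\<lambda>a b c. - (cub a (br X b) c * mon a b c \<omega> J)"]
      by (simp only: s2 sum_negf)
  qed
  have t3: "?S (\<lambda>a b c. cub a b c * mon a b (br X c) \<omega> J) = ?S (\<lambda>a b c. - (cub a b (br X c) * mon a b c \<omega> J))"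
    by (simp only: s3 sum_negf)
  let ?d = "\<lambda>a b c. mon (br X a) b c \<omega> J + mon a (br X b) c \<omega> J + mon a b (br X c) \<omega> J"
  have "?S (\<lambda>a b c. cub a b c * ?d a b c) =
      ?S (\<lambda>a b c. cub a b c * mon (br X a) b c \<omega> J) + ?S (\<lambda>a b c. cub a b c * mon a (br X b) c \<omega> J) +
      ?S (\<lambda>a b c. cub a b c * mon a b (br X c) \<omega> J)"
    by (simp only: distrib_left sum.distrib)
  also have "\<dots> = ?S (\<lambda>a b c. - ((cub (br X a) b c + cub a (br X b) c + cub a b (br X c)) * mon a b c \<omega> J))"
    unfolding t1 t2 t3 by (simp only: distrib_right sum.distrib minus_add_distrib)
  also have "\<dots> = 0" by (simp add: cub_invariant)
  finally have zero: "?S (\<lambda>a b c. cub a b c * ?d a b c) = 0" .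
  have "sp X (\<gamma>_cubic \<omega>) J = (\<Sum>x\<in>{..<m} \<times> {..<m} \<times> {..<m}.
    (1/6 * cub (z (fst x)) (z (fst (snd x))) (z (snd (snd x)))) *
      sp X (mon (z (fst x)) (z (fst (snd x))) (z (snd (snd x))) \<omega>) J)"
    unfolding gamma_cubic_lincomb by (rule spin_op_sum[OF spin_op_sp])
  also have "\<dots> = 1/6 * ?S (\<lambda>a b c. cub a b c * sp X (mon a b c \<omega>) J)"
    by (simp add: sum.cartesian_product case_prod_unfold sum_distrib_left mult.assoc)
  also have "?S (\<lambda>a b c. cub a b c * sp X (mon a b c \<omega>) J) =
      ?S (\<lambda>a b c. cub a b c * mon a b c (sp X \<omega>) J + cub a b c * ?d a b c)"
    by (intro sum.cong refl) (simp only: sp_mon[OF X z_in_q z_in_q z_in_q] lessThan_iff distrib_left)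
  also have "\<dots> = ?S (\<lambda>a b c. cub a b c * mon a b c (sp X \<omega>) J)"
    using zero by (simp only: sum.distrib add_0_right)
  finally show ?thesis unfolding gamma_cubic_eq .
qed


subsection \<open>Weights of the spin module\<close>

lemma gamma_n_q_plus:
  assumes "x \<in> n_q_plus"
  shows "\<gamma> x \<omega> J = (\<Sum>i<n. killing x (ys ! i) * elem_op n True i \<omega> J)"
proof -
  have "plus_part x = x" using assms subspace_0[OF subspace_n_q(2)] by (intro plus_part_eq) simp_all
  then show ?thesis unfolding \<gamma>_def by (simp add: contract_eq wedge_eq representation_zero)
qed

lemma ys_in: "i < n \<Longrightarrow> ys ! i \<in> n_q_minus"
  using span_superset[of "set ys"] basis_ys(3) nth_mem by blast

text \<open>The coefficients at a fixed \<open>J\<close> are assembled to a vector \<open>y\<close>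
  of \<open>n_q_minus\<close>. The hypothesis makes it orthogonal to \<open>n_q_plus\<close>, so it
  is 0, and independence of \<open>ys\<close> kills each coefficient.\<close>

lemma annihilated_by_n_q_plus:
  assumes "\<And>x J. x \<in> n_q_plus \<Longrightarrow> \<gamma> x u J = 0" "i < n"
  shows "elem_op n True i u J = 0"
proof -
  define y where "y = (\<Sum>i<n. elem_op n True i u J *s ys ! i)"
  have yq: "y \<in> n_q_minus"
    unfolding y_def using ys_in by (intro subspace_sum subspace_scale subspace_n_q) auto
  have "y = 0"
  proof (rule killing_q_nondegenerate)
    show "y \<in> q" using yq n_q_minus_subset by blast
    fix v assume "v \<in> q"
    then have v: "plus_part v \<in> n_q_plus" "v - plus_part v \<in> n_q_minus" using plus_part by blast+
    have "killing (plus_part v) y = \<gamma> (plus_part v) u J"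
      unfolding gamma_n_q_plus[OF v(1)] y_def
      by (simp add: killing_sum killing_scale_right mult.commute)
    then have "killing y (plus_part v) = 0" using assms(1)[OF v(1)] by (simp add: killing_sym)
    moreover have "killing y (v - plus_part v) = 0" using killing_n_q_minus[OF yq v(2)] .
    ultimately show "killing y v = 0" by (simp add: killing_diff)
  qed
  define c where "c b = elem_op n True (the_inv_into {..<n} ((!) ys) b) u J" for b
  have inj: "inj_on ((!) ys) {..<n}" using basis_ys(1) by (simp add: inj_on_nth)
  have "(\<Sum>b\<in>set ys. c b *s b) = y"
  proof -
    have "(\<Sum>b\<in>set ys. c b *s b) = (\<Sum>i<n. c (ys ! i) *s ys ! i)"
      by (rule sum.reindex_bij_betw[symmetric, OF bij_betw_nth]) (simp_all add: basis_ys)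
    also have "\<dots> = y" unfolding y_def c_def by (intro sum.cong refl) (simp add: the_inv_into_f_f[OF inj])
    finally show ?thesis .
  qed
  then have "c (ys ! i) = 0"
    using independentD[OF basis_ys(2), of "set ys" c "ys ! i"] \<open>y = 0\<close> assms(2) by simp
  then show ?thesis unfolding c_def using the_inv_into_f_f[OF inj] assms(2) by simp
qed

definition spin_weight_vector :: "('g \<Rightarrow> complex) \<Rightarrow> bool \<Rightarrow> (nat set \<Rightarrow> complex) \<Rightarrow> bool" where
  "spin_weight_vector l p \<omega> \<longleftrightarrow> (\<forall>J. \<omega> J \<noteq> 0 \<longrightarrow> J \<subseteq> {..<n} \<and> even (card J) = p) \<and>
     (\<forall>H\<in>t. \<forall>J. sp H \<omega> J = l H * \<omega> J)"

definition spin_weight_vectors :: "(nat set \<Rightarrow> complex) set" where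
  "spin_weight_vectors = {\<omega>. \<exists>l p. l \<in> dual t \<and> spin_weight_vector l p \<omega>}"

text \<open>Since \<open>t\<close> normalizes \<open>n_q_plus\<close>, it preserves the line of vectors killed by \<open>n_q_plus\<close>.\<close>

lemma vacuum: "delta {} \<in> spin_weight_vectors"
proof -
  define l where "l H = (if H \<in> t then sp H (delta {}) {} else 0)" for H
  have tH: "H \<in> h" if "H \<in> t" for H using that cartan(2) by blast
  have "sp H (delta {}) J = l H * delta {} J" if H: "H \<in> t" for H J
  proof (cases "J = {}")
    case True
    then show ?thesis using H by (simp add: l_def delta_def)
  next
    case False
    let ?u = "sp H (delta {})"
    have "\<gamma> x ?u K = 0" if x: "x \<in> n_q_plus" for x K
    proof -
      have z: "\<gamma> x (delta {}) = (\<lambda>_. 0)" if "x \<in> n_q_plus" for x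
        by (rule ext) (auto simp: gamma_n_q_plus[OF that] elem_op_def delta_def intro!: sum.neutral)
      have "sp H (\<gamma> x (delta {})) K = \<gamma> x ?u K + \<gamma> (br H x) (delta {}) K"
        using sp_gamma[OF tH[OF H]] x n_q_plus_subset by blast
      moreover have "sp H (\<lambda>_. 0) K = 0"
        using spin_op_scale[OF spin_op_sp, of H 0 "\<lambda>_. 0"] by simp
      ultimately show ?thesis using z[OF x] z[OF br_t_n_q_plus[OF H x]] by simp
    qed
    then have ann: "elem_op n True i ?u K = 0" if "i < n" for i K
      using annihilated_by_n_q_plus that by blast
    have "?u J = 0"
    proof (cases "J \<subseteq> {..<n}")
      case True
      obtain i where i: "i \<in> J" using False by blast
      \<comment> \<open>Annihilation of an index of \<open>J\<close>, evaluated at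
        \<open>J - {i}\<close>, returns the coefficient at \<open>J\<close> up to sign.\<close>
      have "sg i (J - {i}) * ?u J = 0"
      proof -
        have "i < n" "J - {i} \<subseteq> {..<n}" "insert i (J - {i}) = J" using i True by auto
        then show ?thesis using ann[of i "J - {i}"] by (simp add: elem_op_def)
      qed
      then show ?thesis using sg_square[of i "J - {i}"] by auto
    qed (rule spin_op_outside[OF spin_op_sp])
    then show ?thesis using False by (simp add: delta_def)
  qed
  moreover have "l \<in> dual t"
    unfolding dual_def l_def using subspace_add[OF subspace_t] subspace_scale[OF subspace_t]
      sp_add[OF tH tH] sp_scale[OF tH] by auto
  ultimately have "l \<in> dual t \<and> spin_weight_vector l True (delta {})"
    unfolding spin_weight_vector_def by (auto simp: delta_def)
  then show ?thesis unfolding spin_weight_vectors_def by blast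
qed

lemma parity_support:
  assumes "spin_op n T" "parity n p T" "\<And>J. \<omega> J \<noteq> 0 \<Longrightarrow> even (card J) = r" "T \<omega> J \<noteq> 0"
  shows "J \<subseteq> {..<n} \<and> even (card J) = (p = r)"
proof -
  have "J \<subseteq> {..<n}" using spin_op_outside[OF assms(1)] assms(4) by blast
  moreover obtain I where I: "I \<in> Pow {..<n}" "\<omega> I * T (delta I) J \<noteq> 0"
    using assms(4) unfolding spin_op_matrix[OF assms(1), of \<omega> J] by (meson sum.neutral)
  then have "even (card I) = r" "(even (card I) \<longleftrightarrow> even (card J)) = p"
    using assms(2,3) unfolding parity_def by auto
  ultimately show ?thesis by auto
qed

text \<open>Moving \<open>sp H\<close> across \<open>\<gamma> y\<close> leaves
  \<open>\<gamma> (br H y)\<close>, a multiple of \<open>\<gamma> y\<close>; so the weight shifts by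
  \<open>- b\<close> and the parity changes.\<close>

lemma gamma_spin_weight_vectors:
  assumes b: "b \<in> \<Delta>p \<inter> roots_q" and y: "y \<in> root_space t (- b)" and w: "\<omega> \<in> spin_weight_vectors"
  shows "\<gamma> y \<omega> \<in> spin_weight_vectors"
proof -
  obtain l p where l: "l \<in> dual t" "spin_weight_vector l p \<omega>"
    using w unfolding spin_weight_vectors_def by blast
  have yq: "y \<in> q" using root_space_n_q_minus[OF b y] n_q_minus_subset by blast
  have "sp H (\<gamma> y \<omega>) J = (l + - b) H * \<gamma> y \<omega> J" if H: "H \<in> t" for H J
  proof -
    have "sp H \<omega> = (\<lambda>J. l H * \<omega> J)" using l(2) H unfolding spin_weight_vector_def by blast
    then have "\<gamma> y (sp H \<omega>) J = l H * \<gamma> y \<omega> J" using spin_op_scale[OF spin_op_gamma] by simp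
    moreover have "br H y = (- b) H *s y" using y H unfolding root_space_def by blast
    then have "\<gamma> (br H y) \<omega> J = (- b) H * \<gamma> y \<omega> J"
      using q_linearD(2)[OF q_linear_gamma yq] by (simp only:)
    moreover have "H \<in> h" using H cartan(2) by blast
    ultimately show ?thesis using sp_gamma[OF _ yq, of H \<omega> J] by (simp add: algebra_simps)
  qed
  moreover have "J \<subseteq> {..<n} \<and> even (card J) = (\<not> p)" if "\<gamma> y \<omega> J \<noteq> 0" for J
    using parity_support[OF spin_op_gamma parity_gamma _ that, of p] l(2)
    unfolding spin_weight_vector_def by auto
  ultimately have "spin_weight_vector (l + - b) (\<not> p) (\<gamma> y \<omega>)"
    unfolding spin_weight_vector_def by blast
  moreover have "b \<in> dual t" using b positive_roots_subset unfolding roots_def by blast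
  then have "l + - b \<in> dual t" using dual_add[OF l(1) dual_minus] by blast
  ultimately show ?thesis unfolding spin_weight_vectors_def by blast
qed

text \<open>The basis \<open>ys\<close> is arbitrary and need not consist of root vectors, so one of
  its elements sends a weight vector only into the span of weight vectors.\<close>

lemma gamma_span_spin_weight_vectors:
  assumes y: "y \<in> n_q_minus" and w: "\<omega> \<in> fs.span spin_weight_vectors"
  shows "\<gamma> y \<omega> \<in> fs.span spin_weight_vectors"
  using w
proof (induct rule: fs.span_induct_alt)
  case base
  have 0: "\<gamma> y 0 = 0" using module_hom.zero[OF Vector_Spaces.linear.axioms(3)[OF spin_op_linear[OF spin_op_gamma]]] .
  show ?case unfolding 0 by (rule fs.span_zero)
next
  case (step c x w)
  have "y \<in> q \<and> \<gamma> y x \<in> fs.span spin_weight_vectors"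
    using y unfolding n_q_minus_def
  proof (induct rule: span_induct_alt)
    case base
    have "\<gamma> (0 *s 0) x J = 0 * \<gamma> 0 x J" for J by (rule q_linearD(2)[OF q_linear_gamma subspace_0[OF subspace_q]])
    then have 0: "\<gamma> 0 x = 0" by (intro ext) simp
    show ?case unfolding 0 using subspace_0[OF subspace_q] fs.span_zero by (rule conjI)
  next
    case (step d v v')
    then obtain b where b: "b \<in> \<Delta>p \<inter> roots_q" "v \<in> root_space t (- b)" by blast
    have vq: "v \<in> q" using root_space_n_q_minus[OF b] n_q_minus_subset by blast
    have v'q: "v' \<in> q" using step(2) by blast
    have eq: "\<gamma> (d *s v + v') x = fscale d (\<gamma> v x) + \<gamma> v' x"
      using q_linearD[OF q_linear_gamma] vq v'q subspace_scale[OF subspace_q vq]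
      by (simp add: fun_eq_iff fscale_def)
    have "\<gamma> v x \<in> spin_weight_vectors"
      using gamma_spin_weight_vectors[OF b] \<open>x \<in> spin_weight_vectors\<close> by blast
    then have "\<gamma> (d *s v + v') x \<in> fs.span spin_weight_vectors"
      unfolding eq using fs.span_add[OF fs.span_scale[OF fs.span_base] conjunct2[OF step(2)]] by blast
    moreover have "d *s v + v' \<in> q"
      using vq v'q subspace_add[OF subspace_q subspace_scale[OF subspace_q vq]] by blast
    ultimately show ?case by (rule conjI[rotated])
  qed
  moreover have eq: "\<gamma> y (fscale c x + w) = fscale c (\<gamma> y x) + \<gamma> y w"
  proof -
    interpret l: Vector_Spaces.linear fscale fscale "\<gamma> y" by (rule spin_op_linear[OF spin_op_gamma])
    show ?thesis by (simp only: l.add l.scale)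
  qed
  ultimately show ?case
    unfolding eq using step(2) by (intro fs.span_add fs.span_scale) simp_all
qed

lemma gamma_ys:
  assumes "i < n"
  shows "\<gamma> (ys ! i) \<omega> = elem_op n False i \<omega>"
proof
  fix J
  have "plus_part (ys ! i) = 0"
    using ys_in[OF assms] subspace_0[OF subspace_n_q(1)] by (intro plus_part_eq) simp_all
  then have "\<gamma> (ys ! i) \<omega> J = (\<Sum>k<n. representation (set ys) (ys ! i) (ys ! k) * elem_op n False k \<omega> J)"
    unfolding \<gamma>_def by (simp add: contract_eq wedge_eq)
  also have "\<dots> = (\<Sum>k<n. if k = i then elem_op n False i \<omega> J else 0)"
    using assms basis_ys(1) representation_basis[OF basis_ys(2), of "ys ! i"]
    by (intro sum.cong) (auto simp: nth_eq_iff_index_eq)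
  also have "\<dots> = elem_op n False i \<omega> J" using assms by simp
  finally show "\<gamma> (ys ! i) \<omega> J = elem_op n False i \<omega> J" .
qed

text \<open>Creation operators build \<open>delta I\<close> from the vacuum; inserting the smallest
  index last makes every sign equal to 1.\<close>

lemma delta_in_span:
  assumes "I \<subseteq> {..<n}"
  shows "delta I \<in> fs.span spin_weight_vectors"
proof -
  have "finite I" using assms finite_subset by blast
  then show ?thesis using assms
  proof (induction I rule: finite_linorder_min_induct)
    case empty
    show ?case using vacuum fs.span_base by blast
  next
    case (insert i I)
    have i: "i < n" "i \<notin> I" using insert by auto
    have "elem_op n False i (delta I) = delta (insert i I)"
    proof
      fix J
      have e: "{j \<in> insert i I. j < i} = {}" using insert(2) by auto
      have "sg i (insert i I) = 1" unfolding sg_def e by simp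
      then show "elem_op n False i (delta I) J = delta (insert i I) J"
        using insert.prems i by (auto simp: elem_op_def delta_def)
    qed
    then show ?case
      using gamma_span_spin_weight_vectors[OF ys_in[OF i(1)] insert.IH] insert.prems gamma_ys[OF i(1)] by simp
  qed
qed

lemma finite_spin_weight_basis:
  "\<exists>\<Omega>. finite \<Omega> \<and> \<Omega> \<subseteq> spin_weight_vectors \<and> (\<forall>I. I \<subseteq> {..<n} \<longrightarrow> delta I \<in> fs.span \<Omega>)"
proof -
  have "\<exists>\<Omega>. finite \<Omega> \<and> \<Omega> \<subseteq> spin_weight_vectors \<and> delta I \<in> fs.span \<Omega>" if I: "I \<subseteq> {..<n}" for I
  proof -
    obtain F c where "finite F" "F \<subseteq> spin_weight_vectors" "delta I = (\<Sum>w\<in>F. fscale (c w) w)"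
      using delta_in_span[OF I] unfolding fs.span_explicit by blast
    moreover have "(\<Sum>w\<in>F. fscale (c w) w) \<in> fs.span F" for F c
      by (intro fs.span_sum fs.span_scale fs.span_base)
    ultimately show ?thesis by metis
  qed
  then obtain f where f: "\<And>I. I \<subseteq> {..<n} \<Longrightarrow> finite (f I) \<and> f I \<subseteq> spin_weight_vectors \<and> delta I \<in> fs.span (f I)"
    by metis
  let ?\<Omega> = "\<Union>I\<in>Pow {..<n}. f I"
  have "finite ?\<Omega>" "?\<Omega> \<subseteq> spin_weight_vectors" using f by auto
  moreover have "delta I \<in> fs.span ?\<Omega>" if "I \<subseteq> {..<n}" for I
    using f[OF that] fs.span_mono[of "f I" ?\<Omega>] that by blast
  ultimately show ?thesis by blast
qed

end


section \<open>The tensor product with the spin module\<close>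

context dirac_module
begin

sublocale Mw: weight_ops scaleM \<pi> t "dual t"
proof (unfold_locales)
  show "\<pi> H (u + v) = \<pi> H u + \<pi> H v" if "H \<in> t" for H u v by (rule act_add_right)
  show "\<pi> H (c *m v) = c *m \<pi> H v" if "H \<in> t" for H c v by (rule act_scale_right)
  show "a = b" if "a \<in> dual t" "b \<in> dual t" "\<And>H. H \<in> t \<Longrightarrow> a H = b H" for a b
    using that by (rule dual_ext)
qed

sublocale T: vspace tensor_scale
  by unfold_locales (simp_all add: tensor_scale_def fun_eq_iff M.scale_right_distrib M.scale_left_distrib)

section \<open>Operators on the tensor product\<close>

lemma linear_act: "Vector_Spaces.linear scaleM scaleM (\<pi> x)"
  by unfold_locales (rule act_add_right act_scale_right)+

lemma linear_M_id: "Vector_Spaces.linear scaleM scaleM id"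
  using M.linear_id .

lemma act_zero [simp]: "\<pi> x 0 = 0"
  using act_scale_right[of x 0 0] by simp

lemma act_zero_left [simp]: "\<pi> 0 v = 0"
  using act_scale_left[of 0 0 v] by simp

lemma op_tensor_eq: "op_tensor A T F J = (\<Sum>I\<in>Pow {..<n}. T (delta I) J *m A (F I))"
  unfolding op_tensor_def delta_def ..

lemma op_tensor_comp:
  assumes "Vector_Spaces.linear scaleM scaleM A" "spin_op n T"
  shows "op_tensor A T (op_tensor B U F) J = op_tensor (\<lambda>v. A (B v)) (\<lambda>\<omega>. T (U \<omega>)) F J"
proof -
  interpret A: Vector_Spaces.linear scaleM scaleM A by fact
  have "op_tensor A T (op_tensor B U F) J =
      (\<Sum>I\<in>Pow {..<n}. \<Sum>K\<in>Pow {..<n}. (U (delta K) I * T (delta I) J) *m A (B (F K)))"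
    unfolding op_tensor_eq by (simp add: A.sum A.scale M.scale_sum_right mult.commute)
  also have "\<dots> = (\<Sum>K\<in>Pow {..<n}. \<Sum>I\<in>Pow {..<n}. (U (delta K) I * T (delta I) J) *m A (B (F K)))"
    by (rule sum.swap)
  also have "\<dots> = (\<Sum>K\<in>Pow {..<n}. T (U (delta K)) J *m A (B (F K)))"
    by (rule sum.cong[OF refl], subst spin_op_matrix[OF assms(2), of "U _"])
      (simp add: M.scale_sum_left)
  finally show ?thesis unfolding op_tensor_eq .
qed

lemma op_tensor_linear:
  assumes "Vector_Spaces.linear scaleM scaleM A"
  shows "Vector_Spaces.linear tensor_scale tensor_scale (op_tensor A T)"
proof -
  interpret A: Vector_Spaces.linear scaleM scaleM A by fact
  show ?thesis
  proof
    show "op_tensor A T (F + G) = op_tensor A T F + op_tensor A T G" for F G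
      by (rule ext) (simp add: op_tensor_eq A.add M.scale_right_distrib sum.distrib)
    show "op_tensor A T (tensor_scale c F) = tensor_scale c (op_tensor A T F)" for c F
      by (rule ext) (simp add: op_tensor_eq A.scale tensor_scale_def M.scale_sum_right mult.commute)
  qed
qed

lemma op_tensor_add_spin:
  "op_tensor A (\<lambda>\<omega> J. T \<omega> J + U \<omega> J) F J = op_tensor A T F J + op_tensor A U F J"
  unfolding op_tensor_eq by (simp add: M.scale_left_distrib sum.distrib)

lemma op_tensor_scale_spin: "op_tensor A (\<lambda>\<omega> J. c * T \<omega> J) F J = c *m op_tensor A T F J"
  unfolding op_tensor_eq by (simp add: M.scale_sum_right)

lemma op_tensor_add_left: "op_tensor (\<lambda>v. A v + B v) T F J = op_tensor A T F J + op_tensor B T F J"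
  unfolding op_tensor_eq by (simp add: M.scale_right_distrib sum.distrib)

lemma op_tensor_scale_left: "op_tensor (\<lambda>v. c *m A v) T F J = c *m op_tensor A T F J"
  unfolding op_tensor_eq by (simp add: M.scale_sum_right mult.commute)

text \<open>\<open>id\<close> is not a \<open>spin_op\<close>, since it keeps irrelevant
  coefficients; on the basis vectors it agrees with \<open>res\<close>, to which the calculus of
  \<open>spin_op\<close> applies.\<close>

lemma op_tensor_id_spin: "op_tensor A id F J = op_tensor A (res n) F J"
proof -
  have "res n (delta I) J = delta I J" if "I \<subseteq> {..<n}" for I
    using that unfolding res_def delta_def by auto
  then show ?thesis unfolding op_tensor_eq by (intro sum.cong refl) (auto simp: id_def)
qed

text \<open>In \<open>TS\<close> and all parity-indexed families below, \<open>True\<close> is the even part.\<close>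

definition TS :: "bool \<Rightarrow> (nat set \<Rightarrow> 'm) set" where
  "TS s = {F. \<forall>I. F I \<noteq> 0 \<longrightarrow> I \<subseteq> {..<n} \<and> even (card I) = s}"

lemma TS_even: "tensor_spin_even = TS True" and TS_odd: "tensor_spin_odd = TS False"
  unfolding tensor_spin_even_def tensor_spin_odd_def tensor_spin_def TS_def by auto

lemma TS_subset: "TS s \<subseteq> tensor_spin"
  unfolding TS_def tensor_spin_def by auto

lemma subspace_TS: "T.subspace (TS s)"
proof (rule T.subspaceI)
  show "F + G \<in> TS s" if FG: "F \<in> TS s" "G \<in> TS s" for F G
    unfolding TS_def
  proof (intro CollectI allI impI)
    fix I assume "(F + G) I \<noteq> 0"
    then have "F I \<noteq> 0 \<or> G I \<noteq> 0" by auto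
    then show "I \<subseteq> {..<n} \<and> even (card I) = s" using FG unfolding TS_def by blast
  qed
qed (auto simp: TS_def tensor_scale_def)

lemma subspace_tensor_spin: "T.subspace tensor_spin"
proof (rule T.subspaceI)
  show "F + G \<in> tensor_spin" if FG: "F \<in> tensor_spin" "G \<in> tensor_spin" for F G
    unfolding tensor_spin_def
  proof (intro CollectI allI impI)
    fix I assume "(F + G) I \<noteq> 0"
    then have "F I \<noteq> 0 \<or> G I \<noteq> 0" by auto
    then show "I \<subseteq> {..<n}" using FG unfolding tensor_spin_def by blast
  qed
qed (auto simp: tensor_spin_def tensor_scale_def)

lemma op_tensor_TS:
  assumes "spin_op n T" "parity n p T" "A 0 = 0" "F \<in> TS s"
  shows "op_tensor A T F \<in> TS (p = s)"
  unfolding TS_def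
proof (intro CollectI allI impI)
  fix J assume "op_tensor A T F J \<noteq> 0"
  then obtain I where I: "I \<in> Pow {..<n}" "T (delta I) J *m A (F I) \<noteq> 0"
    unfolding op_tensor_eq by (meson sum.neutral)
  then have nz: "T (delta I) J \<noteq> 0" "F I \<noteq> 0" using assms(3) by auto
  have "even (card I) = s" using nz(2) assms(4) unfolding TS_def by blast
  moreover have "(even (card I) \<longleftrightarrow> even (card J)) = p"
    using assms(2) nz(1) I(1) unfolding parity_def by blast
  ultimately show "J \<subseteq> {..<n} \<and> even (card J) = (p = s)"
    using spin_op_outside[OF assms(1)] nz(1) by auto
qed

lemma op_tensor_tensor_spin:
  assumes "spin_op n T"
  shows "op_tensor A T F \<in> tensor_spin"
  unfolding tensor_spin_def
proof (intro CollectI allI impI)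
  fix J assume "op_tensor A T F J \<noteq> 0"
  then obtain I where "T (delta I) J *m A (F I) \<noteq> 0"
    unfolding op_tensor_eq by (meson sum.neutral)
  then show "J \<subseteq> {..<n}" using spin_op_outside[OF assms] by (cases "J \<subseteq> {..<n}") auto
qed

definition proj :: "bool \<Rightarrow> (nat set \<Rightarrow> 'm) \<Rightarrow> nat set \<Rightarrow> 'm" where
  "proj s F I = (if even (card I) = s then F I else 0)"

lemma proj_TS: "F \<in> tensor_spin \<Longrightarrow> proj s F \<in> TS s"
  unfolding proj_def TS_def tensor_spin_def by auto

lemma proj_sum: "F = proj s F + proj (\<not> s) F"
  by (rule ext) (simp add: proj_def)

lemma linear_proj: "Vector_Spaces.linear tensor_scale tensor_scale (proj s)"
proof
  show "proj s (F + G) = proj s F + proj s G" for F G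
    by (rule ext) (simp add: proj_def)
  show "proj s (tensor_scale c F) = tensor_scale c (proj s F)" for c F
    by (rule ext) (simp add: proj_def tensor_scale_def)
qed

lemma proj_TS_eq: "F \<in> TS s \<Longrightarrow> proj s F = F" "F \<in> TS (\<not> s) \<Longrightarrow> proj s F = 0"
  unfolding proj_def TS_def by (auto simp: fun_eq_iff)


subsection \<open>The diagonal action\<close>

lemma tensor_act_h:
  assumes "X \<in> h"
  shows "tensor_act X F J = op_tensor (\<pi> X) (res n) F J + op_tensor id (sp X) F J"
  unfolding tensor_act_def spin_lift_br[OF assms] by (simp add: op_tensor_id_spin)

lemma tensor_act_h_eq:
  assumes "X \<in> h"
  shows "tensor_act X F = op_tensor (\<pi> X) (res n) F + op_tensor id (sp X) F"
  by (rule ext) (simp only: tensor_act_h[OF assms] plus_fun_apply)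

lemma linear_tensor_act: "Vector_Spaces.linear tensor_scale tensor_scale (tensor_act X)"
proof -
  interpret a: Vector_Spaces.linear tensor_scale tensor_scale "op_tensor (\<pi> X) id"
    by (rule op_tensor_linear[OF linear_act])
  interpret b: Vector_Spaces.linear tensor_scale tensor_scale "op_tensor id (spin_lift (br X))"
    by (rule op_tensor_linear[OF linear_M_id])
  show ?thesis
  proof
    show "tensor_act X (F + G) = tensor_act X F + tensor_act X G" for F G
      unfolding tensor_act_def a.add b.add by (simp only: add_ac)
    show "tensor_act X (tensor_scale c F) = tensor_scale c (tensor_act X F)" for c F
      unfolding tensor_act_def a.scale b.scale by (simp only: T.scale_right_distrib)
  qed
qed

lemma tensor_act_TS:
  assumes "X \<in> h" "F \<in> TS s"
  shows "tensor_act X F \<in> TS s"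
  unfolding tensor_act_h_eq[OF assms(1)]
  using op_tensor_TS[OF spin_op_res_op parity_res _ assms(2), of "\<pi> X"]
    op_tensor_TS[OF spin_op_sp parity_sp _ assms(2), of id X]
  by (intro T.subspace_add[OF subspace_TS]) simp_all

lemma tensor_act_tensor_spin:
  assumes "X \<in> h"
  shows "tensor_act X F \<in> tensor_spin"
  unfolding tensor_act_h_eq[OF assms]
  by (intro T.subspace_add[OF subspace_tensor_spin] op_tensor_tensor_spin spin_op_res_op spin_op_sp)

lemma tensor_act_add_left:
  assumes "X \<in> h" "Y \<in> h"
  shows "tensor_act (X + Y) F = tensor_act X F + tensor_act Y F"
proof
  fix J
  have "\<pi> (X + Y) = (\<lambda>v. \<pi> X v + \<pi> Y v)" "sp (X + Y) = (\<lambda>\<omega> J. sp X \<omega> J + sp Y \<omega> J)"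
    by (intro ext, rule act_add_left) (intro ext, rule sp_add[OF assms])
  then show "tensor_act (X + Y) F J = (tensor_act X F + tensor_act Y F) J"
    unfolding plus_fun_apply tensor_act_h[OF assms(1)] tensor_act_h[OF assms(2)]
      tensor_act_h[OF subspace_add[OF subspace_h assms]]
    by (simp only: op_tensor_add_left op_tensor_add_spin add_ac)
qed

lemma tensor_act_scale_left:
  assumes "X \<in> h"
  shows "tensor_act (c *s X) F = tensor_scale c (tensor_act X F)"
proof
  fix J
  have "\<pi> (c *s X) = (\<lambda>v. c *m \<pi> X v)" "sp (c *s X) = (\<lambda>\<omega> J. c * sp X \<omega> J)"
    by (intro ext, rule act_scale_left) (intro ext, rule sp_scale[OF assms])
  then show "tensor_act (c *s X) F J = tensor_scale c (tensor_act X F) J"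
    unfolding tensor_scale_def tensor_act_h[OF assms] tensor_act_h[OF subspace_scale[OF subspace_h assms]]
    by (simp only: op_tensor_scale_left op_tensor_scale_spin M.scale_right_distrib)
qed

lemma tensor_act_tensor:
  assumes "X \<in> h" "Vector_Spaces.linear scaleM scaleM A" "spin_op n T"
  shows "tensor_act X (op_tensor A T F) J =
    op_tensor (\<lambda>v. \<pi> X (A v)) T F J + op_tensor A (\<lambda>\<omega>. sp X (T \<omega>)) F J"
proof -
  have "(\<lambda>\<omega>. res n (T \<omega>)) = T"
    by (intro ext) (auto simp: res_def spin_op_outside[OF assms(3)])
  then show ?thesis
    unfolding tensor_act_h[OF assms(1)] op_tensor_comp[OF linear_act spin_op_res_op]
      op_tensor_comp[OF linear_M_id spin_op_sp] by (simp add: id_def)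
qed

lemma tensor_act_tensor_right:
  assumes "X \<in> h" "Vector_Spaces.linear scaleM scaleM A" "spin_op n T"
  shows "op_tensor A T (tensor_act X F) J =
    op_tensor (\<lambda>v. A (\<pi> X v)) T F J + op_tensor A (\<lambda>\<omega>. T (sp X \<omega>)) F J"
proof -
  interpret a: Vector_Spaces.linear tensor_scale tensor_scale "op_tensor A T"
    by (rule op_tensor_linear[OF assms(2)])
  have "(\<lambda>\<omega>. T (res n \<omega>)) = T" by (intro ext) (simp add: spin_op_res[OF assms(3)])
  then show ?thesis
    unfolding tensor_act_h_eq[OF assms(1)] a.add plus_fun_apply
      op_tensor_comp[OF assms(2,3)] by (simp add: id_def)
qed

text \<open>On the first factor this is the module law and on the second \<open>sp_br\<close>; the
  mixed terms agree on both sides because operators on different factors commute.\<close>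

lemma tensor_act_br:
  assumes X: "X \<in> h" and Y: "Y \<in> h"
  shows "tensor_act X (tensor_act Y F) = tensor_act (br X Y) F + tensor_act Y (tensor_act X F)"
proof
  fix J
  interpret x: Vector_Spaces.linear tensor_scale tensor_scale "tensor_act X" by (rule linear_tensor_act)
  have p: "(\<lambda>v. \<pi> X (\<pi> Y v)) = (\<lambda>v. \<pi> (br X Y) v + \<pi> Y (\<pi> X v))"
    by (rule ext) (simp add: act_br)
  have s: "(\<lambda>\<omega>. sp X (sp Y \<omega>)) = (\<lambda>\<omega> J. sp (br X Y) \<omega> J + sp Y (sp X \<omega>) J)"
    by (intro ext) (rule sp_br[OF X Y])
  have r: "(\<lambda>\<omega>. sp X (res n \<omega>)) = sp X" "(\<lambda>\<omega>. res n (sp X \<omega>)) = sp X" for X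
    by (intro ext, simp add: spin_op_res[OF spin_op_sp])
      (intro ext, auto simp: res_def spin_op_outside[OF spin_op_sp])
  have "tensor_act X (tensor_act Y F) J =
      tensor_act X (op_tensor (\<pi> Y) (res n) F) J + tensor_act X (op_tensor id (sp Y) F) J"
    unfolding tensor_act_h_eq[OF Y] x.add plus_fun_apply ..
  also have "\<dots> = op_tensor (\<pi> (br X Y)) (res n) F J + op_tensor id (sp (br X Y)) F J +
     ((op_tensor (\<lambda>v. \<pi> Y (\<pi> X v)) (res n) F J + op_tensor (\<pi> Y) (sp X) F J) +
      (op_tensor (\<lambda>v. id (\<pi> X v)) (sp Y) F J + op_tensor id (\<lambda>\<omega>. sp Y (sp X \<omega>)) F J))"
    unfolding tensor_act_tensor[OF X linear_act spin_op_res_op]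
      tensor_act_tensor[OF X linear_M_id spin_op_sp] p s r
    by (simp add: op_tensor_add_left op_tensor_add_spin add_ac)
  also have "(op_tensor (\<lambda>v. \<pi> Y (\<pi> X v)) (res n) F J + op_tensor (\<pi> Y) (sp X) F J) =
      op_tensor (\<pi> Y) (res n) (tensor_act X F) J"
    unfolding tensor_act_tensor_right[OF X linear_act spin_op_res_op] r ..
  also have "(op_tensor (\<lambda>v. id (\<pi> X v)) (sp Y) F J + op_tensor id (\<lambda>\<omega>. sp Y (sp X \<omega>)) F J) =
      op_tensor id (sp Y) (tensor_act X F) J"
    unfolding tensor_act_tensor_right[OF X linear_M_id spin_op_sp] ..
  also have "op_tensor (\<pi> (br X Y)) (res n) F J + op_tensor id (sp (br X Y)) F J = tensor_act (br X Y) F J"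
    unfolding tensor_act_h[OF br_h[OF X Y]] ..
  also have "op_tensor (\<pi> Y) (res n) (tensor_act X F) J + op_tensor id (sp Y) (tensor_act X F) J =
      tensor_act Y (tensor_act X F) J"
    unfolding tensor_act_h[OF Y] ..
  finally show "tensor_act X (tensor_act Y F) J = (tensor_act (br X Y) F + tensor_act Y (tensor_act X F)) J"
    by (simp only: plus_fun_apply)
qed

sublocale Tw: weight_ops tensor_scale tensor_act t "dual t"
proof (unfold_locales)
  show "tensor_act H (u + v) = tensor_act H u + tensor_act H v" if "H \<in> t" for H u v
    by (rule Vector_Spaces.linear_iff[THEN iffD1, OF linear_tensor_act, THEN conjunct2, THEN conjunct2, THEN conjunct1, rule_format])
  show "tensor_act H (tensor_scale c v) = tensor_scale c (tensor_act H v)" if "H \<in> t" for H c v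
    by (rule Vector_Spaces.linear_iff[THEN iffD1, OF linear_tensor_act, THEN conjunct2, THEN conjunct2, THEN conjunct2, rule_format])
  show "a = b" if "a \<in> dual t" "b \<in> dual t" "\<And>H. H \<in> t \<Longrightarrow> a H = b H" for a b
    using that by (rule dual_ext)
qed


subsection \<open>The Dirac operator\<close>

lemma D_eq: "D F J = (\<Sum>j<m. op_tensor (\<pi> (z j)) (\<gamma> (z j)) F J) - op_tensor id \<gamma>_cubic F J"
  unfolding D_def by (simp add: sum_fun_apply)

lemma linear_D: "Vector_Spaces.linear tensor_scale tensor_scale D"
proof -
  interpret a: Vector_Spaces.linear tensor_scale tensor_scale "op_tensor (\<pi> x) (\<gamma> x)" for x
    by (rule op_tensor_linear[OF linear_act])
  interpret b: Vector_Spaces.linear tensor_scale tensor_scale "op_tensor id \<gamma>_cubic"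
    by (rule op_tensor_linear[OF linear_M_id])
  show ?thesis
  proof
    show "D (F + G) = D F + D G" for F G
      unfolding D_def a.add b.add by (simp only: sum.distrib add_diff_add)
    show "D (tensor_scale c F) = tensor_scale c (D F)" for c F
      unfolding D_def a.scale b.scale by (simp only: T.scale_sum_right T.scale_right_diff_distrib)
  qed
qed

lemma D_TS: "F \<in> TS s \<Longrightarrow> D F \<in> TS (\<not> s)"
proof -
  assume F: "F \<in> TS s"
  have "op_tensor (\<pi> x) (\<gamma> x) F \<in> TS (\<not> s)" for x
    using op_tensor_TS[OF spin_op_gamma parity_gamma _ F, of "\<pi> x"] by simp
  moreover have "op_tensor id \<gamma>_cubic F \<in> TS (\<not> s)"
    using op_tensor_TS[OF spin_op_cubic parity_cubic _ F, of id] by simp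
  ultimately show ?thesis
    unfolding D_def by (intro T.subspace_diff T.subspace_sum subspace_TS)
qed

lemma D_tensor_spin: "D F \<in> tensor_spin"
  unfolding D_def
  by (intro T.subspace_diff T.subspace_sum subspace_tensor_spin op_tensor_tensor_spin
      spin_op_gamma spin_op_cubic)

text \<open>The difference of the two sides consists of the terms in which \<open>br X\<close> hits
  the module factor or the Clifford factor of a summand, and these cancel by
  \<open>skew_switch\<close>. The cubic term is invariant by itself.\<close>

lemma D_tensor_act:
  assumes X: "X \<in> h"
  shows "tensor_act X (D F) = D (tensor_act X F)"
proof
  fix J
  interpret x: Vector_Spaces.linear tensor_scale tensor_scale "tensor_act X" by (rule linear_tensor_act)
  let ?\<Psi> = "\<lambda>u v. op_tensor (\<pi> u) (\<gamma> v) F J"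
  have 1: "tensor_act X (op_tensor (\<pi> (z j)) (\<gamma> (z j)) F) J =
      op_tensor (\<pi> (z j)) (\<gamma> (z j)) (tensor_act X F) J + (?\<Psi> (br X (z j)) (z j) + ?\<Psi> (z j) (br X (z j)))"
    if j: "j < m" for j
  proof -
    have p: "(\<lambda>v. \<pi> X (\<pi> (z j) v)) = (\<lambda>v. \<pi> (br X (z j)) v + \<pi> (z j) (\<pi> X v))"
      by (rule ext) (simp add: act_br)
    have s: "(\<lambda>\<omega>. sp X (\<gamma> (z j) \<omega>)) = (\<lambda>\<omega> J. \<gamma> (z j) (sp X \<omega>) J + \<gamma> (br X (z j)) \<omega> J)"
      by (intro ext) (rule sp_gamma[OF X z_in_q[OF j]])
    show ?thesis
      unfolding tensor_act_tensor[OF X linear_act spin_op_gamma]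
        tensor_act_tensor_right[OF X linear_act spin_op_gamma] p s
      by (simp add: op_tensor_add_left op_tensor_add_spin add_ac)
  qed
  have 2: "tensor_act X (op_tensor id \<gamma>_cubic F) J = op_tensor id \<gamma>_cubic (tensor_act X F) J"
  proof -
    have "(\<lambda>\<omega>. sp X (\<gamma>_cubic \<omega>)) = (\<lambda>\<omega>. \<gamma>_cubic (sp X \<omega>))" by (intro ext) (rule sp_cubic[OF X])
    then show ?thesis
      unfolding tensor_act_tensor[OF X linear_M_id spin_op_cubic]
        tensor_act_tensor_right[OF X linear_M_id spin_op_cubic] by (simp add: id_def)
  qed
  have 3: "(\<Sum>j<m. ?\<Psi> (br X (z j)) (z j)) = - (\<Sum>j<m. ?\<Psi> (z j) (br X (z j)))"
  proof (rule skew_switch[where s = scaleM])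
    show "vector_space scaleM" by unfold_locales
    have "\<pi> (u + u') = (\<lambda>v. \<pi> u v + \<pi> u' v)" "\<pi> (c *s u) = (\<lambda>v. c *m \<pi> u v)" for u u' c
      by (intro ext, rule act_add_left) (intro ext, rule act_scale_left)
    then show "q_linear scaleM (\<lambda>u. ?\<Psi> u v)" for v
      unfolding q_linear_def by (simp only: op_tensor_add_left op_tensor_scale_left) simp
    have "\<gamma> (u + v) = (\<lambda>\<omega> J. \<gamma> u \<omega> J + \<gamma> v \<omega> J)" if "u \<in> q" "v \<in> q" for u v
      by (intro ext) (rule q_linearD(1)[OF q_linear_gamma that])
    moreover have "\<gamma> (c *s u) = (\<lambda>\<omega> J. c * \<gamma> u \<omega> J)" if "u \<in> q" for c u
      by (intro ext) (rule q_linearD(2)[OF q_linear_gamma that])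
    ultimately show "q_linear scaleM (?\<Psi> u)" for u
      unfolding q_linear_def by (intro conjI ballI allI) (simp_all only: op_tensor_add_spin op_tensor_scale_spin)
    show "br X u \<in> q" if "u \<in> q" for u using br_h_q[OF X that] .
    show "killing (br X u) v = - killing u (br X v)" for u v by (rule killing_skew)
  qed
  have "tensor_act X (D F) J = (\<Sum>j<m. tensor_act X (op_tensor (\<pi> (z j)) (\<gamma> (z j)) F) J) -
      tensor_act X (op_tensor id \<gamma>_cubic F) J"
    unfolding D_def x.diff x.sum by (simp add: sum_fun_apply)
  also have "(\<Sum>j<m. tensor_act X (op_tensor (\<pi> (z j)) (\<gamma> (z j)) F) J) =
      (\<Sum>j<m. op_tensor (\<pi> (z j)) (\<gamma> (z j)) (tensor_act X F) J) +
      ((\<Sum>j<m. ?\<Psi> (br X (z j)) (z j)) + (\<Sum>j<m. ?\<Psi> (z j) (br X (z j))))"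
    unfolding sum.distrib[symmetric] by (intro sum.cong refl) (simp only: 1 lessThan_iff)
  finally show "tensor_act X (D F) J = D (tensor_act X F) J"
    unfolding 2 3 D_eq by simp
qed


section \<open>Weights in category O\<close>

lemma Mwt_eq: "Mw.wt \<mu> = weight_space \<mu>"
  unfolding Mw.wt_def weight_space_def ..

lemma act_wt:
  assumes "x \<in> root_space t a" "u \<in> Mw.wt b"
  shows "\<pi> x u \<in> Mw.wt (a + b)"
  unfolding Mw.wt_def
proof (intro CollectI ballI)
  fix H assume H: "H \<in> t"
  have "\<pi> H (\<pi> x u) = \<pi> (br H x) u + \<pi> x (\<pi> H u)" by (simp add: act_br)
  moreover have "br H x = a H *s x" using assms(1) H unfolding root_space_def by blast
  moreover have "\<pi> H u = b H *m u" using assms(2) H unfolding Mw.wt_def by blast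
  ultimately show "\<pi> H (\<pi> x u) = (a + b) H *m \<pi> x u"
    by (simp add: act_scale_left act_scale_right M.scale_left_distrib)
qed

lemma act_span_right:
  assumes "M.subspace N" "\<And>u. u \<in> S \<Longrightarrow> \<pi> x u \<in> N" "u \<in> M.span S"
  shows "\<pi> x u \<in> N"
proof -
  interpret l: Vector_Spaces.linear scaleM scaleM "\<pi> x" by (rule linear_act)
  have "M.span S \<subseteq> {u. \<pi> x u \<in> N}"
    using assms(2) l.subspace_linear_preimage[OF assms(1)] by (intro M.span_minimal) auto
  then show ?thesis using assms(3) by blast
qed

lemma act_span_left:
  assumes "M.subspace N" "\<And>x. x \<in> S \<Longrightarrow> \<pi> x u \<in> N" "x \<in> span S"
  shows "\<pi> x u \<in> N"
proof -
  have "subspace {x. \<pi> x u \<in> N}"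
    using assms(1) by (intro subspaceI)
      (simp_all add: act_add_left act_scale_left M.subspace_add M.subspace_scale M.subspace_0)
  then have "span S \<subseteq> {x. \<pi> x u \<in> N}"
    using assms(2) by (intro span_minimal) auto
  then show ?thesis using assms(3) by blast
qed

lemma submodule_generated: "submodule_over k (generated k G)" "G \<subseteq> generated k G"
proof -
  have "M.subspace (generated k G)"
    unfolding generated_def by (rule M.subspace_Inter) (simp add: submodule_over_def)
  moreover have "\<pi> x v \<in> generated k G" if x: "x \<in> k" and v: "v \<in> generated k G" for x v
    unfolding generated_def
  proof (rule InterI)
    fix N assume N: "N \<in> {N. submodule_over k N \<and> G \<subseteq> N}"
    then have "v \<in> N" using v unfolding generated_def by (rule InterD[rotated])
    then show "\<pi> x v \<in> N" using N x unfolding submodule_over_def by blast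
  qed
  ultimately show "submodule_over k (generated k G)" unfolding submodule_over_def by blast
  show "G \<subseteq> generated k G" unfolding generated_def by (rule Inter_greatest) simp
qed

lemma generated_subset: "submodule_over k N \<Longrightarrow> G \<subseteq> N \<Longrightarrow> generated k G \<subseteq> N"
  unfolding generated_def by blast

text \<open>Each generator is replaced by the finitely many weight vectors in an expression for
  it.\<close>

lemma weight_generators:
  assumes O: category_O
  shows "\<exists>G. finite G \<and> G \<subseteq> (\<Union>\<nu>\<in>dual t. Mw.wt \<nu>) \<and> generated UNIV G = UNIV"
proof -
  obtain G0 where G0: "finite G0" "generated UNIV G0 = UNIV" using O unfolding category_O_def by blast
  have wts: "M.span (\<Union>\<nu>\<in>dual t. Mw.wt \<nu>) = UNIV" using O unfolding category_O_def Mwt_eq by blast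
  have "\<exists>F. finite F \<and> F \<subseteq> (\<Union>\<nu>\<in>dual t. Mw.wt \<nu>) \<and> g \<in> M.span F" for g
  proof -
    have "g \<in> M.span (\<Union>\<nu>\<in>dual t. Mw.wt \<nu>)" using wts by simp
    then obtain F c where F: "finite F" "F \<subseteq> (\<Union>\<nu>\<in>dual t. Mw.wt \<nu>)" "g = (\<Sum>w\<in>F. c w *m w)"
      unfolding M.span_explicit by blast
    have "g \<in> M.span F" unfolding F(3) by (intro M.span_sum M.span_scale M.span_base)
    then show ?thesis using F by blast
  qed
  then obtain f where f: "\<And>g. finite (f g) \<and> f g \<subseteq> (\<Union>\<nu>\<in>dual t. Mw.wt \<nu>) \<and> g \<in> M.span (f g)" by metis
  let ?G = "\<Union>g\<in>G0. f g"
  have "G0 \<subseteq> generated UNIV ?G"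
  proof
    fix g assume "g \<in> G0"
    then have "f g \<subseteq> ?G" by blast
    then have "f g \<subseteq> generated UNIV ?G" using submodule_generated(2) by (rule order_trans)
    then have "M.span (f g) \<subseteq> generated UNIV ?G"
      using submodule_generated(1)[of UNIV ?G] unfolding submodule_over_def by (intro M.span_minimal) blast+
    then show "g \<in> generated UNIV ?G" using f[of g] by blast
  qed
  then have "generated UNIV G0 \<subseteq> generated UNIV ?G" using generated_subset[OF submodule_generated(1)] by blast
  then have "generated UNIV ?G = UNIV" using G0(2) by blast
  moreover have "finite ?G" "?G \<subseteq> (\<Union>\<nu>\<in>dual t. Mw.wt \<nu>)" using G0(1) f by blast+
  ultimately show ?thesis by blast
qed

text \<open>The \<open>n_plus\<close>-module generated by \<open>v\<close> is finite-dimensional by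
  local finiteness. Its weight vectors span an \<open>n_plus\<close>-stable subspace containing
  \<open>v\<close>, hence all of it, and a basis can be chosen among them.\<close>

lemma highest_part:
  assumes O: category_O and v: "v \<in> Mw.wt a" "a \<in> dual t"
  shows "\<exists>B. finite B \<and> B \<subseteq> (\<Union>\<nu>\<in>dual t. Mw.wt \<nu>) \<and> v \<in> M.span B \<and>
    (\<forall>x\<in>n_plus. \<forall>u\<in>M.span B. \<pi> x u \<in> M.span B)"
proof -
  let ?U = "generated n_plus {v}"
  let ?Q = "\<Union>\<nu>\<in>dual t. ?U \<inter> Mw.wt \<nu>"
  have U: "M.subspace ?U" "\<And>x u. x \<in> n_plus \<Longrightarrow> u \<in> ?U \<Longrightarrow> \<pi> x u \<in> ?U" "v \<in> ?U"
    using submodule_generated(1)[of n_plus "{v}"] submodule_generated(2)[of "{v}" n_plus]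
    unfolding submodule_over_def by blast+
  have "submodule_over n_plus (M.span ?Q)"
    unfolding submodule_over_def
  proof (intro conjI ballI)
    show "M.subspace (M.span ?Q)" by (rule M.subspace_span)
    fix x u assume x: "x \<in> n_plus" and u: "u \<in> M.span ?Q"
    show "\<pi> x u \<in> M.span ?Q"
    proof (rule act_span_left[OF M.subspace_span _ x[unfolded n_plus_def]])
      fix y assume "y \<in> (\<Union>\<alpha>\<in>\<Delta>p. root_space t \<alpha>)"
      then obtain b where b: "b \<in> \<Delta>p" "y \<in> root_space t b" by blast
      have bd: "b \<in> dual t" using b(1) positive_roots_subset unfolding roots_def by blast
      have yn: "y \<in> n_plus" unfolding n_plus_def using b by (intro span_base) blast
      show "\<pi> y u \<in> M.span ?Q"
      proof (rule act_span_right[OF M.subspace_span _ u])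
        fix w assume "w \<in> ?Q"
        then obtain c where c: "c \<in> dual t" "w \<in> ?U" "w \<in> Mw.wt c" by blast
        have "\<pi> y w \<in> ?U \<inter> Mw.wt (b + c)" using U(2)[OF yn c(2)] act_wt[OF b(2) c(3)] by blast
        then show "\<pi> y w \<in> M.span ?Q" using dual_add[OF bd c(1)] by (intro M.span_base) blast
      qed
    qed
  qed
  moreover have "v \<in> M.span ?Q" using U(3) v by (intro M.span_base) blast
  ultimately have UQ: "?U \<subseteq> M.span ?Q" using generated_subset[of n_plus "M.span ?Q" "{v}"] by blast
  obtain B where B: "B \<subseteq> ?Q" "M.independent B" "?Q \<subseteq> M.span B"
    using M.maximal_independent_subset by blast
  have fU: "Mw.fin_span ?U" using O unfolding category_O_def Mw.fin_span_def by blast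
  have "B \<subseteq> ?U" using B(1) by blast
  then have fB: "finite B" using Mw.fin_span_independent[OF fU _ B(2)] by blast
  have "M.span B \<subseteq> ?U" by (rule M.span_minimal[OF \<open>B \<subseteq> ?U\<close> U(1)])
  moreover have "M.span ?Q \<subseteq> M.span B" by (rule M.span_minimal[OF B(3) M.subspace_span])
  ultimately have eq: "M.span B = ?U" using UQ by blast
  show ?thesis
  proof (intro exI[of _ B] conjI)
    show "B \<subseteq> (\<Union>\<nu>\<in>dual t. Mw.wt \<nu>)" using B(1) by blast
    show "v \<in> M.span B" unfolding eq by (rule U(3))
    show "\<forall>x\<in>n_plus. \<forall>u\<in>M.span B. \<pi> x u \<in> M.span B" unfolding eq using U(2) by blast
  qed (rule fB)
qed

text \<open>The role of highest weight vectors is played by a finite set whose span is stable under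
  \<open>n_plus\<close>, though it need not be killed by it.\<close>

lemma highest_weight_generators:
  assumes O: category_O
  shows "\<exists>W. finite W \<and> W \<subseteq> (\<Union>\<nu>\<in>dual t. Mw.wt \<nu>) \<and> generated UNIV W = UNIV \<and>
    (\<forall>x\<in>n_plus. \<forall>u\<in>W. \<pi> x u \<in> M.span W)"
proof -
  obtain G where G: "finite G" "G \<subseteq> (\<Union>\<nu>\<in>dual t. Mw.wt \<nu>)" "generated UNIV G = UNIV"
    using weight_generators[OF O] by blast
  have "\<exists>B. finite B \<and> B \<subseteq> (\<Union>\<nu>\<in>dual t. Mw.wt \<nu>) \<and> v \<in> M.span B \<and>
    (\<forall>x\<in>n_plus. \<forall>u\<in>M.span B. \<pi> x u \<in> M.span B)" if v: "v \<in> G" for v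
  proof -
    obtain a where "a \<in> dual t" "v \<in> Mw.wt a" using v G(2) by blast
    then show ?thesis using highest_part[OF O] by blast
  qed
  then obtain B where B: "\<And>v. v \<in> G \<Longrightarrow> finite (B v) \<and> B v \<subseteq> (\<Union>\<nu>\<in>dual t. Mw.wt \<nu>) \<and> v \<in> M.span (B v) \<and>
    (\<forall>x\<in>n_plus. \<forall>u\<in>M.span (B v). \<pi> x u \<in> M.span (B v))" by metis
  let ?W = "\<Union>v\<in>G. B v"
  have "generated UNIV G \<subseteq> generated UNIV ?W"
  proof (rule generated_subset[OF submodule_generated(1)], rule subsetI)
    fix v assume v: "v \<in> G"
    then have "B v \<subseteq> generated UNIV ?W" using submodule_generated(2)[of ?W UNIV] by blast
    then have "M.span (B v) \<subseteq> generated UNIV ?W"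
      using submodule_generated(1)[of UNIV ?W] unfolding submodule_over_def by (intro M.span_minimal) blast+
    then show "v \<in> generated UNIV ?W" using B[OF v] by blast
  qed
  then have gen: "generated UNIV ?W = UNIV" using G(3) by blast
  have act: "\<pi> x u \<in> M.span ?W" if x: "x \<in> n_plus" and u: "u \<in> ?W" for x u
  proof -
    obtain v where v: "v \<in> G" "u \<in> B v" using u by blast
    then have "\<pi> x u \<in> M.span (B v)" using B[OF v(1)] M.span_base x by blast
    moreover have "M.span (B v) \<subseteq> M.span ?W" by (rule M.span_mono) (use v in blast)
    ultimately show ?thesis by blast
  qed
  have fin: "finite ?W" using G(1) B by blast
  have sub: "?W \<subseteq> (\<Union>\<nu>\<in>dual t. Mw.wt \<nu>)"
  proof (rule UN_least)
    fix v assume "v \<in> G"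
    then show "B v \<subseteq> (\<Union>\<nu>\<in>dual t. Mw.wt \<nu>)" using B by blast
  qed
  show ?thesis
    by (intro exI[of _ ?W] conjI ballI fin sub gen act)
qed

definition neg_vector :: "('g \<Rightarrow> complex) \<Rightarrow> 'g" where
  "neg_vector b = (SOME e. e \<in> root_space t (- b) \<and> e \<noteq> 0)"

lemma neg_vector:
  assumes "b \<in> \<Delta>p"
  shows "neg_vector b \<in> root_space t (- b)" "root_space t (- b) = span {neg_vector b}"
proof -
  have r: "- b \<in> roots t" using assms positive_roots_subset neg_root by blast
  then have "\<exists>e. e \<in> root_space t (- b) \<and> e \<noteq> 0"
    unfolding roots_def using subspace_0[OF subspace_root_space] by blast
  then have e: "neg_vector b \<in> root_space t (- b) \<and> neg_vector b \<noteq> 0"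
    unfolding neg_vector_def by (rule someI_ex)
  then show "neg_vector b \<in> root_space t (- b)" "root_space t (- b) = span {neg_vector b}"
    using root_space_one_dimensional[OF r] by blast+
qed

definition lower :: "('g \<Rightarrow> complex) list \<Rightarrow> 'm \<Rightarrow> 'm" where
  "lower bs w = foldr (\<lambda>b. \<pi> (neg_vector b)) bs w"

lemma lower_wt:
  assumes "set bs \<subseteq> \<Delta>p" "w \<in> Mw.wt a"
  shows "lower bs w \<in> Mw.wt (a - sum_list bs)"
  using assms(1)
proof (induction bs)
  case Nil
  have "a - sum_list [] = a" by (simp only: sum_list.Nil diff_0_right)
  then show ?case unfolding lower_def using assms(2) by (simp only: foldr.simps id_apply)
next
  case (Cons b bs)
  have "\<pi> (neg_vector b) (lower bs w) \<in> Mw.wt (- b + (a - sum_list bs))"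
  proof (rule act_wt)
    show "neg_vector b \<in> root_space t (- b)" using Cons.prems by (intro neg_vector(1)) simp
    show "lower bs w \<in> Mw.wt (a - sum_list bs)" using Cons.prems by (intro Cons.IH) simp
  qed
  moreover have "- b + (a - sum_list bs) = a - sum_list (b # bs)"
    by (simp only: sum_list.Cons diff_conv_add_uminus minus_add_distrib add_ac)
  ultimately show ?case unfolding lower_def by (simp only: foldr.simps comp_apply)
qed

text \<open>Proving stability of the span under all of \<open>g\<close> at once, by induction on the length of the
  monomial, avoids the Poincare-Birkhoff-Witt theorem.\<close>

lemma lowered_vectors_span:
  assumes W: "W \<subseteq> (\<Union>\<nu>\<in>dual t. Mw.wt \<nu>)" "generated UNIV W = UNIV"
    "\<forall>x\<in>n_plus. \<forall>u\<in>W. \<pi> x u \<in> M.span W"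
  shows "M.span {lower bs w | bs w. set bs \<subseteq> \<Delta>p \<and> w \<in> W} = UNIV"
proof -
  define L where "L = {lower bs w | bs w. set bs \<subseteq> \<Delta>p \<and> w \<in> W}"
  have LI: "lower bs w \<in> M.span L" if "set bs \<subseteq> \<Delta>p" "w \<in> W" for bs w
    unfolding L_def using that by (intro M.span_base) blast
  have WL: "W \<subseteq> M.span L"
  proof
    fix w assume "w \<in> W"
    then show "w \<in> M.span L" using LI[of "[]" w] by (simp add: lower_def)
  qed
  then have WL': "M.span W \<subseteq> M.span L" by (rule M.span_minimal[OF _ M.subspace_span])
  have e: "\<pi> (neg_vector b) u \<in> M.span L" if b: "b \<in> \<Delta>p" and u: "u \<in> M.span L" for b u
  proof (rule act_span_right[OF M.subspace_span _ u])
    fix v assume "v \<in> L"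
    then obtain bs w where v: "v = lower bs w" "set bs \<subseteq> \<Delta>p" "w \<in> W" unfolding L_def by blast
    have "lower (b # bs) w \<in> M.span L" using v b by (intro LI) simp_all
    then show "\<pi> (neg_vector b) v \<in> M.span L" unfolding v(1) lower_def by (simp only: foldr.simps comp_apply)
  qed
  have main: "\<pi> x (lower bs w) \<in> M.span L" if "set bs \<subseteq> \<Delta>p" "w \<in> W" for bs w x
    using that
  proof (induction bs arbitrary: x)
    case Nil
    have w: "lower [] w = w" by (simp add: lower_def)
    have "x \<in> span ((\<Union>\<beta>\<in>\<Delta>p. root_space t (- \<beta>)) \<union> t \<union> (\<Union>\<beta>\<in>\<Delta>p. root_space t \<beta>))"
      unfolding triangular_decomposition by simp
    then show ?case
    proof (rule act_span_left[OF M.subspace_span, rotated])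
      fix y assume "y \<in> (\<Union>\<beta>\<in>\<Delta>p. root_space t (- \<beta>)) \<union> t \<union> (\<Union>\<beta>\<in>\<Delta>p. root_space t \<beta>)"
      then consider b where "b \<in> \<Delta>p" "y \<in> root_space t (- b)" | "y \<in> t" | b where "b \<in> \<Delta>p" "y \<in> root_space t b"
        by blast
      then show "\<pi> y (lower [] w) \<in> M.span L"
      proof cases
        case 1
        then have "y \<in> span {neg_vector b}" using neg_vector(2) by blast
        then obtain c where "y = c *s neg_vector b" unfolding span_singleton by blast
        then show ?thesis
          using e[OF 1(1) LI[OF _ Nil.prems(2), of "[]"]] by (simp add: act_scale_left M.span_scale)
      next
        case 2
        obtain \<nu> where "w \<in> Mw.wt \<nu>" using W(1) Nil.prems(2) by blast
        then have "\<pi> y w = \<nu> y *m w" using 2 unfolding Mw.wt_def by blast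
        then show ?thesis unfolding w using WL Nil.prems(2) by (simp only:) (blast intro: M.span_scale)
      next
        case 3
        then have "y \<in> n_plus" unfolding n_plus_def by (intro span_base) blast
        then show ?thesis unfolding w using W(3) WL' Nil.prems(2) by blast
      qed
    qed
  next
    case (Cons b bs)
    \<comment> \<open>Moving \<open>x\<close> past one lowering operator leaves a commutator acting
      on a shorter monomial; the induction covers it because \<open>x\<close> is arbitrary
      there.\<close>
    have "\<pi> x (lower (b # bs) w) = \<pi> (br x (neg_vector b)) (lower bs w) + \<pi> (neg_vector b) (\<pi> x (lower bs w))"
      unfolding lower_def by (simp add: act_br)
    moreover have "\<pi> (br x (neg_vector b)) (lower bs w) \<in> M.span L" using Cons by simp
    moreover have "\<pi> (neg_vector b) (\<pi> x (lower bs w)) \<in> M.span L" using Cons by (intro e) simp_all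
    ultimately show ?case using M.span_add by (simp only:)
  qed
  have "submodule_over UNIV (M.span L)"
    unfolding submodule_over_def
  proof (intro conjI ballI M.subspace_span)
    fix x u assume u: "u \<in> M.span L"
    show "\<pi> x u \<in> M.span L"
    proof (rule act_span_right[OF M.subspace_span _ u])
      fix v assume "v \<in> L"
      then show "\<pi> x v \<in> M.span L" using main unfolding L_def by blast
    qed
  qed
  then have "generated UNIV W \<subseteq> M.span L" using WL by (rule generated_subset)
  then show ?thesis using W(2) unfolding L_def by blast
qed

text \<open>The weight of a nonzero lowered vector is read off from the sum of its roots, so weight
  \<nu> is reached from \<open>w\<close> only by the finitely many lists with sum
  \<open>a w - \<nu>\<close>.\<close>

theorem category_O_weight_spanning_set:
  assumes O: category_O
  shows "\<exists>G. M.span G = UNIV \<and> G \<subseteq> (\<Union>\<nu>\<in>dual t. Mw.wt \<nu>) \<and> 0 \<notin> G \<and> (\<forall>\<nu>\<in>dual t. finite (G \<inter> Mw.wt \<nu>))"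
proof -
  obtain W where W: "finite W" "W \<subseteq> (\<Union>\<nu>\<in>dual t. Mw.wt \<nu>)" "generated UNIV W = UNIV"
    "\<forall>x\<in>n_plus. \<forall>u\<in>W. \<pi> x u \<in> M.span W"
    using highest_weight_generators[OF O] by blast
  have "\<forall>w\<in>W. \<exists>\<nu>. \<nu> \<in> dual t \<and> w \<in> Mw.wt \<nu>" using W(2) by blast
  from bchoice[OF this] obtain a where "\<forall>w\<in>W. a w \<in> dual t \<and> w \<in> Mw.wt (a w)" by blast
  then have a: "\<And>w. w \<in> W \<Longrightarrow> a w \<in> dual t" "\<And>w. w \<in> W \<Longrightarrow> w \<in> Mw.wt (a w)" by blast+
  define L where "L = {lower bs w | bs w. set bs \<subseteq> \<Delta>p \<and> w \<in> W}"
  have sd: "a w - sum_list bs \<in> dual t" if "set bs \<subseteq> \<Delta>p" "w \<in> W" for bs w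
    using that(1)
  proof (induction bs)
    case Nil
    have "a w - sum_list [] = a w" by (simp only: sum_list.Nil diff_0_right)
    then show ?case using a(1)[OF that(2)] by (simp only:)
  next
    case (Cons b bs)
    have "- b \<in> dual t" using Cons.prems positive_roots_subset dual_minus unfolding roots_def by auto
    moreover have "a w - sum_list bs \<in> dual t" using Cons.prems by (intro Cons.IH) simp
    moreover have "- b + (a w - sum_list bs) = a w - sum_list (b # bs)"
      by (simp only: sum_list.Cons diff_conv_add_uminus minus_add_distrib add_ac)
    ultimately show ?case using dual_add by metis
  qed
  have lw: "lower bs w \<in> Mw.wt (a w - sum_list bs)" if "set bs \<subseteq> \<Delta>p" "w \<in> W" for bs w
    using lower_wt[OF that(1) a(2)[OF that(2)]] .
  \<comment> \<open>0 lies in every weight space; with it removed, a vector of \<open>L\<close> in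
    \<open>Mw.wt \<nu>\<close> must have the weight read off from its roots.\<close>
  have fin: "finite ((L - {0}) \<inter> Mw.wt \<nu>)" if \<nu>: "\<nu> \<in> dual t" for \<nu>
  proof (rule finite_subset)
    show "(L - {0}) \<inter> Mw.wt \<nu> \<subseteq>
        (\<Union>w\<in>W. (\<lambda>bs. lower bs w) ` {bs. set bs \<subseteq> \<Delta>p \<and> sum_list bs = a w - \<nu>})"
    proof
      fix v assume v: "v \<in> (L - {0}) \<inter> Mw.wt \<nu>"
      then obtain bs w where l: "v = lower bs w" "set bs \<subseteq> \<Delta>p" "w \<in> W" unfolding L_def by blast
      have "a w - sum_list bs = \<nu>"
        using Mw.wt_Int[OF sd[OF l(2,3)] \<nu> lw[OF l(2,3)]] v l(1) by blast
      then have "sum_list bs = a w - \<nu>" by (metis add_diff_cancel diff_add_cancel add.commute)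
      then show "v \<in> (\<Union>w\<in>W. (\<lambda>bs. lower bs w) ` {bs. set bs \<subseteq> \<Delta>p \<and> sum_list bs = a w - \<nu>})"
        using l by blast
    qed
    show "finite (\<Union>w\<in>W. (\<lambda>bs. lower bs w) ` {bs. set bs \<subseteq> \<Delta>p \<and> sum_list bs = a w - \<nu>})"
      by (rule finite_UN_I[OF W(1)], rule finite_imageI, rule finite_partitions)
  qed
  have sp: "M.span (L - {0}) = UNIV"
    unfolding M.span_delete_0 L_def by (rule lowered_vectors_span[OF W(2-4)])
  have wts: "L - {0} \<subseteq> (\<Union>\<nu>\<in>dual t. Mw.wt \<nu>)"
  proof
    fix v assume "v \<in> L - {0}"
    then obtain bs w where l: "v = lower bs w" "set bs \<subseteq> \<Delta>p" "w \<in> W" unfolding L_def by blast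
    then show "v \<in> (\<Union>\<nu>\<in>dual t. Mw.wt \<nu>)" using sd[OF l(2,3)] lw[OF l(2,3)] by blast
  qed
  show ?thesis
    by (intro exI[of _ "L - {0}"] conjI ballI sp wts fin) simp_all
qed

section \<open>Weight vectors of the tensor product\<close>

definition pure :: "'m \<Rightarrow> (nat set \<Rightarrow> complex) \<Rightarrow> nat set \<Rightarrow> 'm" where
  "pure v \<omega> J = \<omega> J *m v"

lemma pure_wt:
  assumes "v \<in> Mw.wt a" "spin_weight_vector l p \<omega>"
  shows "pure v \<omega> \<in> Tw.wt (a + l)"
  unfolding Tw.wt_def
proof (intro CollectI ballI ext)
  fix H J assume H: "H \<in> t"
  have hH: "H \<in> h" using H cartan(2) by blast
  have "op_tensor (\<pi> H) (res n) (pure v \<omega>) J = (\<Sum>I\<in>Pow {..<n}. (\<omega> I * res n (delta I) J) *m \<pi> H v)"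
    unfolding op_tensor_eq pure_def by (simp add: act_scale_right mult.commute)
  also have "\<dots> = res n \<omega> J *m \<pi> H v"
    unfolding M.scale_sum_left[symmetric] spin_op_matrix[OF spin_op_res_op, of n \<omega>] ..
  also have "res n \<omega> J = \<omega> J" using assms(2) unfolding spin_weight_vector_def res_def by auto
  finally have 1: "op_tensor (\<pi> H) (res n) (pure v \<omega>) J = \<omega> J *m \<pi> H v" .
  have "op_tensor id (sp H) (pure v \<omega>) J = (\<Sum>I\<in>Pow {..<n}. (\<omega> I * sp H (delta I) J) *m v)"
    unfolding op_tensor_eq pure_def by (simp add: mult.commute)
  also have "\<dots> = sp H \<omega> J *m v"
    unfolding M.scale_sum_left[symmetric] spin_op_matrix[OF spin_op_sp, of H \<omega>] ..
  also have "sp H \<omega> J = l H * \<omega> J" using assms(2) H unfolding spin_weight_vector_def by blast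
  finally have 2: "op_tensor id (sp H) (pure v \<omega>) J = (l H * \<omega> J) *m v" .
  have "\<pi> H v = a H *m v" using assms(1) H unfolding Mw.wt_def by blast
  then show "tensor_act H (pure v \<omega>) J = tensor_scale ((a + l) H) (pure v \<omega>) J"
    unfolding tensor_act_h[OF hH] 1 2
    by (simp add: tensor_scale_def pure_def M.scale_left_distrib distrib_left mult.commute)
qed

lemma pure_in_span:
  assumes "v \<in> M.span G" "\<omega> \<in> fs.span \<Omega>"
  shows "pure v \<omega> \<in> T.span {pure g w | g w. g \<in> G \<and> w \<in> \<Omega>}"
  using assms(1)
proof (induct rule: M.span_induct_alt)
  case base
  have "pure 0 \<omega> = 0" by (rule ext) (simp add: pure_def)
  then show ?case using T.span_zero by (simp only:)
next
  case (step c g u)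
  have "pure g \<omega> \<in> T.span {pure g w | g w. g \<in> G \<and> w \<in> \<Omega>}"
    using assms(2)
  proof (induct rule: fs.span_induct_alt)
    case base
    have "pure g 0 = 0" by (rule ext) (simp add: pure_def)
    then show ?case using T.span_zero by (simp only:)
  next
    case (step d w w')
    have eq: "pure g (fscale d w + w') = tensor_scale d (pure g w) + pure g w'"
      by (rule ext) (simp add: pure_def fscale_def tensor_scale_def M.scale_left_distrib)
    have "pure g w \<in> T.span {pure g w | g w. g \<in> G \<and> w \<in> \<Omega>}"
      using step(1) \<open>g \<in> G\<close> by (intro T.span_base) blast
    then show ?case unfolding eq using step(2) by (intro T.span_add T.span_scale)
  qed
  moreover have eq: "pure (c *m g + u) \<omega> = tensor_scale c (pure g \<omega>) + pure u \<omega>"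
    by (rule ext) (simp add: pure_def tensor_scale_def M.scale_right_distrib mult.commute)
  ultimately show ?case unfolding eq using step(2) by (intro T.span_add T.span_scale)
qed

text \<open>Pure tensors of weight vectors span. For a given \<nu> the module factor has weight
  \<open>\<nu> - l w\<close> for one of finitely many spin vectors \<open>w\<close>, and each such
  weight has finitely many candidates.\<close>

theorem tensor_weight_spanning_set:
  assumes O: category_O
  shows "\<exists>G. G \<subseteq> (\<Union>\<nu>\<in>dual t. Tw.wt \<nu>) \<and> tensor_spin \<subseteq> T.span G \<and>
    (\<forall>\<nu>\<in>dual t. finite (G \<inter> Tw.wt \<nu>))"
proof -
  obtain G where G: "M.span G = UNIV" "G \<subseteq> (\<Union>\<nu>\<in>dual t. Mw.wt \<nu>)" "0 \<notin> G"
    "\<forall>\<nu>\<in>dual t. finite (G \<inter> Mw.wt \<nu>)"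
    using category_O_weight_spanning_set[OF O] by blast
  obtain \<Omega> where \<Omega>: "finite \<Omega>" "\<Omega> \<subseteq> spin_weight_vectors" "\<forall>I. I \<subseteq> {..<n} \<longrightarrow> delta I \<in> fs.span \<Omega>"
    using finite_spin_weight_basis by blast
  have "\<forall>w\<in>\<Omega>. \<exists>l. l \<in> dual t \<and> (\<exists>p. spin_weight_vector l p w)"
    using \<Omega>(2) unfolding spin_weight_vectors_def by blast
  from bchoice[OF this] obtain l where "\<forall>w\<in>\<Omega>. l w \<in> dual t \<and> (\<exists>p. spin_weight_vector (l w) p w)" by blast
  then have l: "\<And>w. w \<in> \<Omega> \<Longrightarrow> l w \<in> dual t" "\<And>w. w \<in> \<Omega> \<Longrightarrow> \<exists>p. spin_weight_vector (l w) p w" by blast+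
  let ?G = "{pure g w | g w. g \<in> G \<and> w \<in> \<Omega>}"
  have wt: "pure g w \<in> Tw.wt (a + l w)" if "g \<in> Mw.wt a" "w \<in> \<Omega>" for g w a
    using pure_wt[OF that(1)] l(2)[OF that(2)] by blast
  have wts: "?G \<subseteq> (\<Union>\<nu>\<in>dual t. Tw.wt \<nu>)"
  proof
    fix x assume "x \<in> ?G"
    then obtain g w where x: "x = pure g w" "g \<in> G" "w \<in> \<Omega>" by blast
    obtain a where a: "a \<in> dual t" "g \<in> Mw.wt a" using G(2) x(2) by blast
    then show "x \<in> (\<Union>\<nu>\<in>dual t. Tw.wt \<nu>)"
      using wt[OF a(2) x(3)] dual_add[OF a(1) l(1)[OF x(3)]] x(1) by blast
  qed
  have sp: "tensor_spin \<subseteq> T.span ?G"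
  proof
    fix F assume F: "F \<in> tensor_spin"
    have "F = (\<Sum>I\<in>Pow {..<n}. pure (F I) (delta I))"
    proof
      fix J
      have "(\<Sum>I\<in>Pow {..<n}. pure (F I) (delta I)) J = (\<Sum>I\<in>Pow {..<n}. if J = I then F J else 0)"
        unfolding sum_fun_apply by (intro sum.cong refl) (auto simp: pure_def delta_def)
      also have "\<dots> = (if J \<subseteq> {..<n} then F J else 0)" by (subst sum.delta') auto
      also have "\<dots> = F J" using F unfolding tensor_spin_def by auto
      finally show "F J = (\<Sum>I\<in>Pow {..<n}. pure (F I) (delta I)) J" by simp
    qed
    moreover have "(\<Sum>I\<in>Pow {..<n}. pure (F I) (delta I)) \<in> T.span ?G"
    proof (rule T.span_sum)
      fix I assume "I \<in> Pow {..<n}"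
      then show "pure (F I) (delta I) \<in> T.span ?G" using G(1) \<Omega>(3) by (intro pure_in_span) auto
    qed
    ultimately show "F \<in> T.span ?G" by (simp only:)
  qed
  have fin: "finite (?G \<inter> Tw.wt \<nu>)" if \<nu>: "\<nu> \<in> dual t" for \<nu>
  proof (rule finite_subset)
    \<comment> \<open>0 is added by hand because a vanishing pure tensor says nothing about the
      weights of its factors.\<close>
    show "?G \<inter> Tw.wt \<nu> \<subseteq> insert 0 (\<Union>w\<in>\<Omega>. (\<lambda>g. pure g w) ` (G \<inter> Mw.wt (\<nu> + - l w)))"
    proof
      fix x assume x0: "x \<in> ?G \<inter> Tw.wt \<nu>"
      then obtain g w where x: "x = pure g w" "g \<in> G" "w \<in> \<Omega>" by blast
      obtain a where a: "a \<in> dual t" "g \<in> Mw.wt a" using G(2) x(2) by blast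
      show "x \<in> insert 0 (\<Union>w\<in>\<Omega>. (\<lambda>g. pure g w) ` (G \<inter> Mw.wt (\<nu> + - l w)))"
      proof (cases "x = 0")
        case False
        have "pure g w \<in> Tw.wt \<nu>" using x0 unfolding x(1) by (rule IntD2)
        then have "a + l w = \<nu>"
          using Tw.wt_Int[OF dual_add[OF a(1) l(1)[OF x(3)]] \<nu> wt[OF a(2) x(3)]] False
          unfolding x(1) by blast
        then have "\<nu> + - l w = a" by (metis add.assoc add.right_inverse add_0_right)
        then have "g \<in> G \<inter> Mw.wt (\<nu> + - l w)" using x(2) a(2) by simp
        then show ?thesis unfolding x(1) using x(3) by blast
      next
        case True
        show ?thesis unfolding True by (rule insertI1)
      qed
    qed
    show "finite (insert 0 (\<Union>w\<in>\<Omega>. (\<lambda>g. pure g w) ` (G \<inter> Mw.wt (\<nu> + - l w))))"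
    proof (rule finite.insertI, rule finite_UN_I[OF \<Omega>(1)], rule finite_imageI)
      fix w assume w: "w \<in> \<Omega>"
      show "finite (G \<inter> Mw.wt (\<nu> + - l w))"
        by (rule G(4)[rule_format, OF dual_add[OF \<nu> dual_minus[OF l(1)[OF w]]]])
    qed
  qed
  show ?thesis
    by (intro exI[of _ ?G] conjI ballI sp wts fin)
qed

definition V :: "('g \<Rightarrow> complex) \<Rightarrow> bool \<Rightarrow> (nat set \<Rightarrow> 'm) set" where
  "V \<mu> s = TS s \<inter> Tw.wt \<mu>"

lemma stable_TS: "Tw.stable (TS s)"
  unfolding Tw.stable_def
  by (intro conjI ballI subspace_TS tensor_act_TS) (rule subsetD[OF cartan(2)])

lemma stable_tensor_spin: "Tw.stable tensor_spin"
  unfolding Tw.stable_def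
  by (intro conjI ballI subspace_tensor_spin tensor_act_tensor_spin) (rule subsetD[OF cartan(2)])

lemma stable_span_weights:
  assumes O: category_O and "Tw.stable N" "N \<subseteq> tensor_spin"
  shows "N \<subseteq> T.span (\<Union>\<nu>\<in>dual t. N \<inter> Tw.wt \<nu>)"
proof -
  obtain G where G: "G \<subseteq> (\<Union>\<nu>\<in>dual t. Tw.wt \<nu>)" "tensor_spin \<subseteq> T.span G"
    using tensor_weight_spanning_set[OF O] by blast
  show ?thesis by (rule Tw.stable_subset_span[OF assms(2) G(1) order_trans[OF assms(3) G(2)]])
qed

lemma fin_span_V:
  assumes O: category_O and "\<mu> \<in> dual t"
  shows "T.fin_span (V \<mu> s)"
proof -
  obtain G where G: "G \<subseteq> (\<Union>\<nu>\<in>dual t. Tw.wt \<nu>)" "tensor_spin \<subseteq> T.span G"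
    "\<forall>\<nu>\<in>dual t. finite (G \<inter> Tw.wt \<nu>)"
    using tensor_weight_spanning_set[OF O] by blast
  have "V \<mu> s \<subseteq> T.span (G \<inter> Tw.wt \<mu>)"
  proof
    fix x assume "x \<in> V \<mu> s"
    then have "x \<in> T.span G" "x \<in> Tw.wt \<mu>" unfolding V_def using G(2) TS_subset by blast+
    then show "x \<in> T.span (G \<inter> Tw.wt \<mu>)" by (rule Tw.wt_subset_span[OF G(1) assms(2)])
  qed
  moreover have "finite (G \<inter> Tw.wt \<mu>)" using G(3) assms(2) by (rule bspec)
  ultimately show ?thesis unfolding T.fin_span_def by (intro exI conjI)
qed

end


section \<open>Formal characters of homomorphic images\<close>

text \<open>A module record presented as \<open>X\<close> modulo \<open>W\<close> through the map
  \<open>\<Phi>\<close>. Both sides of the theorem have this form: the cohomology as finitely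
  supported sequences modulo denominators, the tensor product modulo 0.\<close>

locale rep_image = complex_lie_algebra scale br + src: weight_ops sc ac t "dual t"
  for scale :: "complex \<Rightarrow> 'g::ab_group_add \<Rightarrow> 'g" (infixr \<open>*s\<close> 75)
    and br :: "'g \<Rightarrow> 'g \<Rightarrow> 'g"
    and sc :: "complex \<Rightarrow> 'b::ab_group_add \<Rightarrow> 'b"
    and ac :: "'g \<Rightarrow> 'b \<Rightarrow> 'b" and t :: "'g set" +
  fixes k :: "'g set" and X W :: "'b set" and A :: "('g, 'w) rep" and \<Phi> :: "'b \<Rightarrow> 'w"
  assumes subalgebra_k: "subalgebra k" and t_k: "t \<subseteq> k"
    and subspace_X: "src.subspace X" and ac_X: "x \<in> k \<Longrightarrow> u \<in> X \<Longrightarrow> ac x u \<in> X"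
    and ac_linear: "x \<in> k \<Longrightarrow> Vector_Spaces.linear sc sc (ac x)"
    and ac_add_left: "x \<in> k \<Longrightarrow> y \<in> k \<Longrightarrow> ac (x + y) u = ac x u + ac y u"
    and ac_scale_left: "x \<in> k \<Longrightarrow> ac (c *s x) u = sc c (ac x u)"
    and ac_br: "x \<in> k \<Longrightarrow> y \<in> k \<Longrightarrow> ac x (ac y u) = ac (br x y) u + ac y (ac x u)"
    and car_A: "car A = \<Phi> ` X"
    and zero_A: "zero A = \<Phi> 0"
    and add_A: "u \<in> X \<Longrightarrow> v \<in> X \<Longrightarrow> add A (\<Phi> u) (\<Phi> v) = \<Phi> (u + v)"
    and smul_A: "u \<in> X \<Longrightarrow> smul A c (\<Phi> u) = \<Phi> (sc c u)"
    and act_A: "x \<in> k \<Longrightarrow> u \<in> X \<Longrightarrow> act A x (\<Phi> u) = \<Phi> (ac x u)"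
    and stable_W: "src.stable W" 
    and \<Phi>_eq: "u \<in> X \<Longrightarrow> v \<in> X \<Longrightarrow> \<Phi> u = \<Phi> v \<longleftrightarrow> u - v \<in> W"
    and X_span: "X \<subseteq> src.span (\<Union>\<nu>\<in>dual t. X \<inter> src.wt \<nu>)"
begin

lemma k_closed: "x \<in> k \<Longrightarrow> y \<in> k \<Longrightarrow> x + y \<in> k" "x \<in> k \<Longrightarrow> c *s x \<in> k"
    "x \<in> k \<Longrightarrow> y \<in> k \<Longrightarrow> br x y \<in> k"
  using subalgebra_k subspace_add subspace_scale unfolding subalgebra_def by blast+

lemma X_closed: "0 \<in> X" "u \<in> X \<Longrightarrow> v \<in> X \<Longrightarrow> u + v \<in> X" "u \<in> X \<Longrightarrow> sc c u \<in> X" "u \<in> X \<Longrightarrow> - u \<in> X"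
  using src.subspace_0 src.subspace_add src.subspace_scale src.subspace_neg subspace_X by blast+

lemma ac_add: "x \<in> k \<Longrightarrow> ac x (u + v) = ac x u + ac x v"
  and ac_scale: "x \<in> k \<Longrightarrow> ac x (sc c u) = sc c (ac x u)"
  using ac_linear unfolding Vector_Spaces.linear_iff by blast+

lemma ball_car: "(\<forall>v\<in>car A. P v) \<longleftrightarrow> (\<forall>u\<in>X. P (\<Phi> u))"
  unfolding car_A by blast

lemma \<Phi>_car: "u \<in> X \<Longrightarrow> \<Phi> u \<in> car A"
  unfolding car_A by blast

lemma is_rep: "is_rep k A"
  unfolding is_rep_def ball_car
proof (intro conjI ballI allI)
  show "zero A \<in> car A" unfolding zero_A by (rule \<Phi>_car[OF X_closed(1)])
  fix u assume u: "u \<in> X"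
  show "\<exists>v\<in>car A. add A v (\<Phi> u) = zero A"
    by (rule bexI[OF _ \<Phi>_car[OF X_closed(4)[OF u]]])
      (simp only: add_A[OF X_closed(4)[OF u] u] zero_A left_minus)
next
  fix x y u assume "x \<in> k" "y \<in> k" "u \<in> X"
  then show "act A x (act A y (\<Phi> u)) = add A (act A (br x y) (\<Phi> u)) (act A y (act A x (\<Phi> u)))"
    by (simp only: act_A ac_X k_closed add_A ac_br[of x y])
qed (simp_all only: zero_A add_A smul_A act_A X_closed ac_X \<Phi>_car k_closed ac_add ac_scale
      ac_add_left ac_scale_left add_0_left add_0_right src.scale_right_distrib src.scale_left_distrib
      src.scale_scale src.scale_one add_ac)

lemma lincomb_image:
  assumes "\<And>i. i < n \<Longrightarrow> b i \<in> X"
  shows "lincomb A c (\<lambda>i. \<Phi> (b i)) n = \<Phi> (\<Sum>i<n. sc (c i) (b i))"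
  using assms
proof (induction n)
  case 0
  show ?case by (simp add: zero_A)
next
  case (Suc n)
  have "(\<Sum>i<n. sc (c i) (b i)) \<in> X"
    using Suc.prems X_closed by (intro src.subspace_sum subspace_X) simp_all
  then show ?case using Suc X_closed by (simp add: smul_A add_A)
qed

lemma lincomb_cong: "(\<And>i. i < n \<Longrightarrow> b i = b' i) \<Longrightarrow> (\<And>i. i < n \<Longrightarrow> c i = c' i) \<Longrightarrow>
    lincomb A c b n = lincomb A c' b' n"
  by (induction n) simp_all

lemma X_decomposition:
  assumes "v \<in> X"
  shows "\<exists>B x. finite B \<and> B \<subseteq> dual t \<and> (\<forall>a\<in>B. x a \<in> X \<inter> src.wt a) \<and> v = (\<Sum>a\<in>B. x a)"
proof -
  have "(\<Union>\<nu>\<in>dual t. X \<inter> src.wt \<nu>) \<subseteq> (\<Union>\<nu>\<in>dual t. src.wt \<nu>)" by blast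
  from src.span_wt_decomposition[OF this subsetD[OF X_span assms]]
  obtain B x where B: "finite B" "B \<subseteq> dual t"
    "\<forall>a\<in>B. x a \<in> src.span ((\<Union>\<nu>\<in>dual t. X \<inter> src.wt \<nu>) \<inter> src.wt a)" "v = (\<Sum>a\<in>B. x a)"
    by (elim exE conjE)
  have "x a \<in> X \<inter> src.wt a" if "a \<in> B" for a
  proof -
    have "src.span ((\<Union>\<nu>\<in>dual t. X \<inter> src.wt \<nu>) \<inter> src.wt a) \<subseteq> X \<inter> src.wt a"
      by (rule src.span_minimal[OF _ src.subspace_inter[OF subspace_X src.subspace_wt]]) blast
    then show ?thesis using B(3) that by blast
  qed
  then show ?thesis using B by blast
qed

text \<open>A weight vector of the quotient has a lift of the same weight: for any lift
  \<open>v\<close> the difference \<open>ac H v - sc (\<mu> H) v\<close> lies in \<open>W\<close>,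
  and stability of \<open>W\<close> puts the components of \<open>v\<close> of other weights into
  \<open>W\<close>.\<close>

lemma rep_weight_space_eq:
  assumes \<mu>: "\<mu> \<in> dual t"
  shows "rep_weight_space t A \<mu> = \<Phi> ` (X \<inter> src.wt \<mu>)"
proof
  have act: "act A H (\<Phi> v) = smul A c (\<Phi> v) \<longleftrightarrow> ac H v - sc c v \<in> W" if "H \<in> t" "v \<in> X" for H c v
    using that t_k by (simp add: act_A smul_A \<Phi>_eq ac_X X_closed subset_iff)
  have W: "src.subspace W" using stable_W unfolding src.stable_def by blast
  show "\<Phi> ` (X \<inter> src.wt \<mu>) \<subseteq> rep_weight_space t A \<mu>"
  proof
    fix y assume "y \<in> \<Phi> ` (X \<inter> src.wt \<mu>)"
    then obtain v where v: "y = \<Phi> v" "v \<in> X" "v \<in> src.wt \<mu>" by blast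
    have "act A H (\<Phi> v) = smul A (\<mu> H) (\<Phi> v)" if H: "H \<in> t" for H
    proof -
      have "ac H v - sc (\<mu> H) v = 0" using v(3) H unfolding src.wt_def by simp
      then show ?thesis unfolding act[OF H v(2)] using src.subspace_0[OF W] by (simp only:)
    qed
    then show "y \<in> rep_weight_space t A \<mu>"
      unfolding rep_weight_space_def v(1) using \<Phi>_car[OF v(2)] by blast
  qed
  show "rep_weight_space t A \<mu> \<subseteq> \<Phi> ` (X \<inter> src.wt \<mu>)"
  proof
    fix y assume "y \<in> rep_weight_space t A \<mu>"
    then have y: "y \<in> car A" "\<And>H. H \<in> t \<Longrightarrow> act A H y = smul A (\<mu> H) y"
      unfolding rep_weight_space_def by blast+
    obtain v where v: "y = \<Phi> v" "v \<in> X" using y(1) unfolding car_A by blast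
    have vW: "ac H v - sc (\<mu> H) v \<in> W" if "H \<in> t" for H
      using y(2)[OF that] act[OF that v(2)] unfolding v(1) by blast
    obtain B x where B: "finite B" "B \<subseteq> dual t" "\<forall>a\<in>B. x a \<in> X \<inter> src.wt a" "v = (\<Sum>a\<in>B. x a)"
      using X_decomposition[OF v(2)] by blast
    have xW: "x a \<in> W" if a: "a \<in> B" "a \<noteq> \<mu>" for a
    proof -
      obtain H where H: "H \<in> t" "a H \<noteq> \<mu> H" using src.sep[of a \<mu>] a B(2) \<mu> by blast
      interpret l: Vector_Spaces.linear sc sc "ac H" by (rule ac_linear) (use H t_k in blast)
      have "ac H v - sc (\<mu> H) v = (\<Sum>b\<in>B. sc (b H - \<mu> H) (x b))"
        unfolding B(4) l.sum src.scale_sum_right sum_subtractf[symmetric]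
      proof (rule sum.cong[OF refl])
        fix b assume "b \<in> B"
        then have "ac H (x b) = sc (b H) (x b)" using B(3) H(1) unfolding src.wt_def by blast
        then show "ac H (x b) - sc (\<mu> H) (x b) = sc (b H - \<mu> H) (x b)"
          by (simp add: src.scale_left_diff_distrib)
      qed
      then have "(\<Sum>b\<in>B. sc (b H - \<mu> H) (x b)) \<in> W" using vW[OF H(1)] by (simp only:)
      moreover have "sc (b H - \<mu> H) (x b) \<in> src.wt b" if "b \<in> B" for b
        using B(3) that src.subspace_scale[OF src.subspace_wt] by blast
      ultimately have "sc (a H - \<mu> H) (x a) \<in> W"
        using src.stable_wt_component[OF B(1,2) stable_W, of "\<lambda>b. sc (b H - \<mu> H) (x b)" a] a(1) by blast
      then have "sc (inverse (a H - \<mu> H)) (sc (a H - \<mu> H) (x a)) \<in> W"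
        by (rule src.subspace_scale[OF W])
      then show ?thesis using H(2) by simp
    qed
    \<comment> \<open>The component of weight \<mu>, or 0 if this weight does not occur in
      \<open>B\<close>.\<close>
    define w where "w = (\<Sum>a\<in>B \<inter> {\<mu>}. x a)"
    have w: "w \<in> X \<inter> src.wt \<mu>"
      unfolding w_def using B(3) by (intro src.subspace_sum src.subspace_inter subspace_X src.subspace_wt) auto
    have "v = w + (\<Sum>a\<in>B - {\<mu>}. x a)"
      unfolding w_def B(4) using sum.Int_Diff[OF B(1), of x "{\<mu>}"] .
    moreover have "(\<Sum>a\<in>B - {\<mu>}. x a) \<in> W" using xW by (intro src.subspace_sum W) auto
    ultimately have "v - w \<in> W" by simp
    then have "y = \<Phi> w" unfolding v(1) using \<Phi>_eq v(2) w by blast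
    then show "y \<in> \<Phi> ` (X \<inter> src.wt \<mu>)" using w by blast
  qed
qed

lemma spanned_by_weight_vectors:
  assumes "y \<in> car A"
  shows "\<exists>n b. (\<forall>i<n. \<exists>\<mu>\<in>dual t. b i \<in> rep_weight_space t A \<mu>) \<and> y = lincomb A (\<lambda>_. 1) b n"
proof -
  obtain v where v: "y = \<Phi> v" "v \<in> X" using assms unfolding car_A by blast
  obtain B x where B: "finite B" "B \<subseteq> dual t" "\<forall>a\<in>B. x a \<in> X \<inter> src.wt a" "v = (\<Sum>a\<in>B. x a)"
    using X_decomposition[OF v(2)] by blast
  obtain f where f: "bij_betw f {0..<card B} B" using ex_bij_betw_nat_finite[OF B(1)] by blast
  have fB: "f i \<in> B" if "i < card B" for i using f that unfolding bij_betw_def by auto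
  have "v = (\<Sum>i<card B. sc 1 (x (f i)))"
    unfolding B(4) src.scale_one atLeast0LessThan[symmetric]
    by (rule sum.reindex_bij_betw[OF f, symmetric])
  then have "y = lincomb A (\<lambda>_. 1) (\<lambda>i. \<Phi> (x (f i))) (card B)"
    unfolding v(1) using lincomb_image[of "card B" "\<lambda>i. x (f i)" "\<lambda>_. 1"] fB B(3) by simp
  moreover have "\<exists>\<mu>\<in>dual t. \<Phi> (x (f i)) \<in> rep_weight_space t A \<mu>" if "i < card B" for i
    using rep_weight_space_eq[of "f i"] fB[OF that] B(2,3) by blast
  ultimately show ?thesis by (intro exI[of _ "card B"] exI[of _ "\<lambda>i. \<Phi> (x (f i))"] conjI allI impI)
qed

text \<open>A finite-dimensional subspace of the source mapped bijectively onto \<open>U\<close>; it turns dimensions of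
  carriers of records into dimensions of subspaces.\<close>

definition section_of :: "'w set \<Rightarrow> 'b set \<Rightarrow> bool" where
  "section_of U C \<longleftrightarrow> src.subspace C \<and> C \<subseteq> X \<and> C \<inter> W \<subseteq> {0} \<and> \<Phi> ` C = U \<and> src.fin_span C"

lemma section_inj:
  assumes "section_of U C" "u \<in> C" "v \<in> C" "\<Phi> u = \<Phi> v"
  shows "u = v"
proof -
  have C: "src.subspace C" "C \<subseteq> X" "C \<inter> W \<subseteq> {0}" using assms(1) unfolding section_of_def by blast+
  have "u - v \<in> W" using \<Phi>_eq assms C(2) by blast
  moreover have "u - v \<in> C" by (rule src.subspace_diff[OF C(1) assms(2,3)])
  ultimately have "u - v = 0" using C(3) by blast
  then show ?thesis by simp
qed

lemma is_basis_section:
  assumes s: "section_of U C"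
  shows "\<exists>b. is_basis A U b (src.dim C)"
proof -
  have C: "src.subspace C" "C \<subseteq> X" "\<Phi> ` C = U" "src.fin_span C" using s unfolding section_of_def by blast+
  obtain E where E: "E \<subseteq> C" "src.independent E" "C \<subseteq> src.span E" "card E = src.dim C"
    using src.basis_exists by blast
  have fE: "finite E" by (rule src.fin_span_independent[OF C(4) E(1,2)])
  obtain e where e: "bij_betw e {0..<card E} E" using ex_bij_betw_nat_finite[OF fE] by blast
  have eE: "e i \<in> E" if "i < card E" for i using e that unfolding bij_betw_def by auto
  have einj: "inj_on e {..<card E}" using e unfolding bij_betw_def atLeast0LessThan by blast
  have eC: "e i \<in> X" if "i < card E" for i using eE[OF that] E(1) C(2) by blast
  have sumC: "(\<Sum>i<card E. sc (c i) (e i)) \<in> C" for c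
    using eE E(1) by (intro src.subspace_sum src.subspace_scale C(1)) auto
  have "is_basis A U (\<lambda>i. \<Phi> (e i)) (card E)"
    unfolding is_basis_def
  proof (intro conjI allI impI ballI)
    show "\<Phi> (e i) \<in> U" if "i < card E" for i using eE[OF that] E(1) C(3) by blast
    fix y assume "y \<in> U"
    then obtain x where x: "x \<in> C" "y = \<Phi> x" using C(3) by blast
    have "x \<in> src.span E" using x E(3) by blast
    then obtain r where r: "x = (\<Sum>b\<in>E. sc (r b) b)" unfolding src.span_finite[OF fE] by blast
    have "x = (\<Sum>i<card E. sc (r (e i)) (e i))"
      unfolding r atLeast0LessThan[symmetric] by (rule sum.reindex_bij_betw[OF e, symmetric])
    \<comment> \<open>\<open>is_basis\<close> makes coefficient functions unique by demanding 0
      beyond the length of the basis, so the coordinates are extended by 0.\<close>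
    define c where "c i = (if i < card E then r (e i) else 0)" for i
    have xc: "x = (\<Sum>i<card E. sc (c i) (e i))"
      unfolding \<open>x = (\<Sum>i<card E. sc (r (e i)) (e i))\<close> by (rule sum.cong) (simp_all add: c_def)
    show "\<exists>!c. (\<forall>i\<ge>card E. c i = 0) \<and> y = lincomb A c (\<lambda>i. \<Phi> (e i)) (card E)"
    proof (rule ex1I[of _ c])
      have "y = lincomb A c (\<lambda>i. \<Phi> (e i)) (card E)"
        using lincomb_image[of "card E" e c] eC x(2) xc by simp
      then show "(\<forall>i\<ge>card E. c i = 0) \<and> y = lincomb A c (\<lambda>i. \<Phi> (e i)) (card E)"
        by (simp add: c_def)
      fix d assume d: "(\<forall>i\<ge>card E. d i = 0) \<and> y = lincomb A d (\<lambda>i. \<Phi> (e i)) (card E)"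
      then have "\<Phi> x = \<Phi> (\<Sum>i<card E. sc (d i) (e i))"
        using lincomb_image[of "card E" e d] eC x(2) by simp
      then have "x = (\<Sum>i<card E. sc (d i) (e i))" by (rule section_inj[OF s x(1) sumC])
      then have "(\<Sum>i<card E. sc (d i) (e i)) - (\<Sum>i<card E. sc (c i) (e i)) = 0" using xc by simp
      then have z: "(\<Sum>i<card E. sc (d i - c i) (e i)) = 0"
        by (simp only: sum_subtractf[symmetric] src.scale_left_diff_distrib)
      define u where "u b = d (the_inv_into {..<card E} e b) - c (the_inv_into {..<card E} e b)" for b
      have "(\<Sum>b\<in>E. sc (u b) b) = (\<Sum>i<card E. sc (u (e i)) (e i))"
        unfolding atLeast0LessThan[symmetric] by (rule sum.reindex_bij_betw[OF e, symmetric])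
      also have "\<dots> = 0"
        unfolding z[symmetric] by (rule sum.cong) (simp_all add: u_def the_inv_into_f_f[OF einj])
      finally have "u (e i) = 0" if "i < card E" for i
        using src.independentD[OF E(2) fE subset_refl] eE[OF that] by blast
      then have "d i = c i" if "i < card E" for i
        using that by (simp add: u_def the_inv_into_f_f[OF einj])
      then show "d = c" using d by (intro ext) (metis c_def leI)
    qed
  qed
  then show ?thesis unfolding E(4) by blast
qed

text \<open>\<open>rep_dim\<close> is a definite description, so the length of a basis must be
  unique. A basis of \<open>U\<close> is lifted to one of \<open>C\<close>, where the dimension is
  invariant.\<close>

lemma is_basis_card:
  assumes s: "section_of U C" and b: "is_basis A U b n"
  shows "n = src.dim C"
proof -
  have C: "src.subspace C" "C \<subseteq> X" "\<Phi> ` C = U" using s unfolding section_of_def by blast+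
  have bU: "\<And>i. i < n \<Longrightarrow> b i \<in> U" using b unfolding is_basis_def by blast
  have uniq: "c = d" if "\<forall>i\<ge>n. c i = 0" "\<forall>i\<ge>n. d i = 0" "lincomb A c b n = lincomb A d b n"
    "lincomb A c b n \<in> U" for c d
    using b that unfolding is_basis_def by metis
  have "\<forall>i\<in>{..<n}. \<exists>v. v \<in> C \<and> \<Phi> v = b i"
  proof
    fix i assume "i \<in> {..<n}"
    then have "b i \<in> \<Phi> ` C" unfolding C(3) by (intro bU) simp
    then obtain v where "b i = \<Phi> v" "v \<in> C" by (rule imageE)
    then show "\<exists>v. v \<in> C \<and> \<Phi> v = b i" by (intro exI[of _ v]) simp
  qed
  from bchoice[OF this] obtain v where "\<forall>i\<in>{..<n}. v i \<in> C \<and> \<Phi> (v i) = b i" by blast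
  then have v: "\<And>i. i < n \<Longrightarrow> v i \<in> C" "\<And>i. i < n \<Longrightarrow> \<Phi> (v i) = b i" by blast+
  have lin: "lincomb A c b n = \<Phi> (\<Sum>i<n. sc (c i) (v i))" for c
    using lincomb_image[of n v c] v C(2) lincomb_cong[of n "\<lambda>i. \<Phi> (v i)" b c c] by fastforce
  have sumC: "(\<Sum>i<n. sc (c i) (v i)) \<in> C" for c
    using v by (intro src.subspace_sum src.subspace_scale C(1)) auto
  then have linU: "lincomb A c b n \<in> U" for c unfolding lin using C(3) by blast
  have zero: "c i = 0" if "(\<Sum>i<n. sc (c i) (v i)) = 0" "i < n" for c i
  proof -
    define c' where "c' i = (if i < n then c i else 0)" for i
    have "(\<Sum>i<n. sc (c' i) (v i)) = (\<Sum>i<n. sc 0 (v i))"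
      using that(1) by (simp add: c'_def)
    then have "lincomb A c' b n = lincomb A (\<lambda>_. 0) b n" unfolding lin by (simp only:)
    then have "c' = (\<lambda>_. 0)" by (intro uniq linU) (simp_all add: c'_def)
    then have "c' i = 0" by (rule fun_cong)
    then show ?thesis using that(2) by (simp add: c'_def)
  qed
  have inj: "inj_on v {..<n}"
  proof (rule inj_onI, rule ccontr)
    fix i j assume ij: "i \<in> {..<n}" "j \<in> {..<n}" "v i = v j" "i \<noteq> j"
    \<comment> \<open>A repeated vector would satisfy the nontrivial relation with coefficients 1
      and -1.\<close>
    let ?c = "\<lambda>l. if l = i then 1 else if l = j then -1 else 0"
    have "(\<Sum>l<n. sc (?c l) (v l)) = (\<Sum>l\<in>{i, j}. sc (?c l) (v l))"
      by (rule sum.mono_neutral_right) (use ij in auto)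
    also have "\<dots> = 0" using ij(3,4) by simp
    finally have "(\<Sum>l<n. sc (?c l) (v l)) = 0" .
    from zero[OF this, of i] ij(1) show False by simp
  qed
  have "src.independent (v ` {..<n})"
  proof (rule src.independent_if_scalars_zero)
    fix f x assume f: "(\<Sum>x\<in>v ` {..<n}. sc (f x) x) = 0" and x: "x \<in> v ` {..<n}"
    have "(\<Sum>i<n. sc (f (v i)) (v i)) = 0" using f by (simp add: sum.reindex[OF inj])
    then show "f x = 0" using zero[of "\<lambda>i. f (v i)"] x by auto
  qed simp
  moreover have "v ` {..<n} \<subseteq> C" using v(1) by auto
  moreover have "C \<subseteq> src.span (v ` {..<n})"
  proof
    fix x assume x: "x \<in> C"
    then have "\<Phi> x \<in> U" using C(3) by blast
    then obtain c where "\<Phi> x = lincomb A c b n" using b unfolding is_basis_def by blast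
    then have "x = (\<Sum>i<n. sc (c i) (v i))" unfolding lin by (rule section_inj[OF s x sumC])
    then show "x \<in> src.span (v ` {..<n})"
      by (simp only:) (intro src.span_sum src.span_scale src.span_base imageI)
  qed
  ultimately have "card (v ` {..<n}) = src.dim C" by (intro src.basis_card_eq_dim)
  then show ?thesis by (simp add: card_image[OF inj])
qed

lemma rep_dim_section:
  assumes "section_of U C"
  shows "rep_dim A U = src.dim C" "finite_dim A U"
proof -
  show "rep_dim A U = src.dim C"
    unfolding rep_dim_def
    by (rule the_equality) (rule is_basis_section[OF assms], use is_basis_card[OF assms] in blast)
  show "finite_dim A U" unfolding finite_dim_def using is_basis_section[OF assms] by blast
qed

lemma admissible:
  assumes "\<And>\<mu>. \<mu> \<in> dual t \<Longrightarrow> \<exists>C. section_of (\<Phi> ` (X \<inter> src.wt \<mu>)) C"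
  shows "admissible k t A"
  unfolding admissible_def
proof (intro conjI ballI)
  show "is_rep k A" by (rule is_rep)
  show "\<exists>n b. (\<forall>i<n. \<exists>\<mu>\<in>dual t. b i \<in> rep_weight_space t A \<mu>) \<and> v = lincomb A (\<lambda>_. 1) b n"
    if "v \<in> car A" for v by (rule spanned_by_weight_vectors[OF that])
  show "finite_dim A (rep_weight_space t A \<mu>)" if "\<mu> \<in> dual t" for \<mu>
    unfolding rep_weight_space_eq[OF that] using assms[OF that] rep_dim_section(2) by blast
qed

end


section \<open>Cosets and sequences of vectors\<close>

definition seq_scale :: "('a \<Rightarrow> 'b \<Rightarrow> 'b) \<Rightarrow> 'a \<Rightarrow> (nat \<Rightarrow> 'b) \<Rightarrow> nat \<Rightarrow> 'b" where
  "seq_scale s c g = (\<lambda>k. s c (g k))"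

definition single :: "nat \<Rightarrow> 'b::zero \<Rightarrow> nat \<Rightarrow> 'b" where
  "single k x = (\<lambda>j. if j = k then x else 0)"

context vspace
begin

lemma coset_eq_iff:
  assumes W: "subspace W"
  shows "coset W u = coset W v \<longleftrightarrow> u - v \<in> W"
proof
  assume "coset W u = coset W v"
  moreover have "u + 0 \<in> coset W u" unfolding coset_def using subspace_0[OF W] by blast
  ultimately obtain w where "u + 0 = v + w" "w \<in> W" unfolding coset_def by blast
  then show "u - v \<in> W" by simp
next
  have sub: "coset W u \<subseteq> coset W v" if "u - v \<in> W" for u v
  proof
    fix x assume "x \<in> coset W u"
    then obtain w where w: "x = u + w" "w \<in> W" unfolding coset_def by blast
    then have "x = v + ((u - v) + w)" "(u - v) + w \<in> W" using subspace_add[OF W that] by simp_all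
    then show "x \<in> coset W v" unfolding coset_def by blast
  qed
  assume uv: "u - v \<in> W"
  then have "- (u - v) \<in> W" by (rule subspace_neg[OF W])
  then have "v - u \<in> W" by simp
  then show "coset W u = coset W v" using sub uv by blast
qed

lemma coset_add:
  assumes W: "subspace W"
  shows "{a + b | a b. a \<in> coset W u \<and> b \<in> coset W v} = coset W (u + v)"
proof (intro set_eqI iffI)
  fix x assume "x \<in> {a + b | a b. a \<in> coset W u \<and> b \<in> coset W v}"
  then obtain w w' where w: "x = (u + w) + (v + w')" "w \<in> W" "w' \<in> W" unfolding coset_def by blast
  have "x = (u + v) + (w + w')" unfolding w(1) by (simp only: add_ac)
  then show "x \<in> coset W (u + v)" unfolding coset_def using subspace_add[OF W w(2,3)] by blast
next
  fix x assume "x \<in> coset W (u + v)"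
  then obtain w where w: "x = (u + v) + w" "w \<in> W" unfolding coset_def by blast
  have "x = (u + 0) + (v + w)" unfolding w(1) by (simp add: add_ac)
  then show "x \<in> {a + b | a b. a \<in> coset W u \<and> b \<in> coset W v}"
    unfolding coset_def using subspace_0[OF W] w(2) by blast
qed

text \<open>The extra summand \<open>w\<close> in the quotient operations matters when
  \<open>f\<close> does not map \<open>W\<close> onto itself, for instance for scaling by 0: the
  images alone would be too small a set.\<close>

lemma coset_map:
  assumes W: "subspace W" and f: "Vector_Spaces.linear scale scale f" "\<And>w. w \<in> W \<Longrightarrow> f w \<in> W"
  shows "{f a + w | a w. a \<in> coset W u \<and> w \<in> W} = coset W (f u)"
proof -
  interpret f: Vector_Spaces.linear scale scale f by fact
  show ?thesis
  proof (intro set_eqI iffI)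
    fix x assume "x \<in> {f a + w | a w. a \<in> coset W u \<and> w \<in> W}"
    then obtain w w' where w: "x = f (u + w') + w" "w \<in> W" "w' \<in> W" unfolding coset_def by blast
    have "x = f u + (f w' + w)" unfolding w(1) f.add by (simp only: add_ac)
    then show "x \<in> coset W (f u)" unfolding coset_def using subspace_add[OF W f(2)[OF w(3)] w(2)] by blast
  next
    fix x assume "x \<in> coset W (f u)"
    then obtain w where w: "x = f u + w" "w \<in> W" unfolding coset_def by blast
    have "u + 0 \<in> coset W u" unfolding coset_def using subspace_0[OF W] by blast
    then have "u \<in> coset W u" by simp
    then show "x \<in> {f a + w | a w. a \<in> coset W u \<and> w \<in> W}" using w by blast
  qed
qed

lemma coset_zero: "coset W 0 = W"
  unfolding coset_def by simp

lemma linear_scale: "Vector_Spaces.linear scale scale (scale c)"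
  by unfold_locales (simp_all add: scale_right_distrib mult.commute)

lemma vspace_seq: "vspace (seq_scale scale)"
  by unfold_locales (simp_all add: seq_scale_def fun_eq_iff scale_right_distrib scale_left_distrib)

end

locale vspace_with_seq = vspace scale + seq: vspace "seq_scale scale"
  for scale :: "'a::field \<Rightarrow> 'b::ab_group_add \<Rightarrow> 'b"
begin

lemma linear_single: "Vector_Spaces.linear scale (seq_scale scale) (single k)"
  by unfold_locales (simp_all add: seq_scale_def single_def fun_eq_iff)

lemma linear_eval: "Vector_Spaces.linear (seq_scale scale) scale (\<lambda>g. g k)"
  by unfold_locales (simp_all add: seq_scale_def)

definition finite_seqs :: "(nat \<Rightarrow> 'b set) \<Rightarrow> nat \<Rightarrow> (nat \<Rightarrow> 'b) set" where
  "finite_seqs C N = {g. (\<forall>k<N. g k \<in> C k) \<and> (\<forall>k\<ge>N. g k = 0)}"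

lemma subspace_finite_seqs:
  assumes "\<And>k. subspace (C k)"
  shows "seq.subspace (finite_seqs C N)"
  by (rule seq.subspaceI)
    (auto simp: finite_seqs_def seq_scale_def subspace_0 subspace_add subspace_scale assms)

text \<open>Evaluation at \<open>N\<close> maps the sequences supported below \<open>Suc N\<close>
  onto \<open>C N\<close>, with the shorter sequences as kernel, so the dimensions add up.\<close>

lemma finite_seqs_dim:
  assumes C: "\<And>k. subspace (C k)" "\<And>k. fin_span (C k)"
  shows "seq.fin_span (finite_seqs C N) \<and> seq.dim (finite_seqs C N) = (\<Sum>k<N. dim (C k))"
proof (induction N)
  case 0
  have "g = 0" if "g \<in> finite_seqs C 0" for g
    using that unfolding finite_seqs_def by (intro ext) simp
  moreover have "0 \<in> finite_seqs C 0" unfolding finite_seqs_def by simp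
  ultimately have eq: "finite_seqs C 0 = {0}" by blast
  have "seq.dim {0} = 0" using seq.dim_span_eq_card_independent[OF seq.independent_empty] by simp
  moreover have "seq.fin_span {0}"
    unfolding seq.fin_span_def by (rule exI[of _ "{}"]) simp
  ultimately show ?case unfolding eq by simp
next
  case (Suc N)
  interpret p: vspace_pair "seq_scale scale" scale by unfold_locales
  have fin: "seq.fin_span (finite_seqs C (Suc N))"
  proof (rule seq.fin_span_subset)
    show "seq.fin_span {u + w | u w. u \<in> finite_seqs C N \<and> w \<in> single N ` C N}"
      by (rule seq.fin_span_sums[OF conjunct1[OF Suc] fin_span_image[OF seq.vspace_axioms linear_single C(2)]])
    show "finite_seqs C (Suc N) \<subseteq> {u + w | u w. u \<in> finite_seqs C N \<and> w \<in> single N ` C N}"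
    proof
      fix g assume g: "g \<in> finite_seqs C (Suc N)"
      let ?u = "\<lambda>k. if k < N then g k else 0"
      have "g = ?u + single N (g N)"
      proof
        fix k
        consider "k < N" | "k = N" | "k \<ge> Suc N" by linarith
        then show "g k = (?u + single N (g N)) k"
          using g by cases (auto simp: single_def finite_seqs_def)
      qed
      moreover have "?u \<in> finite_seqs C N" "g N \<in> C N" using g unfolding finite_seqs_def by auto
      ultimately show "g \<in> {u + w | u w. u \<in> finite_seqs C N \<and> w \<in> single N ` C N}" by blast
    qed
  qed
  have "finite_seqs C (Suc N) \<inter> {g. g N = 0} = finite_seqs C N"
  proof
    show "finite_seqs C N \<subseteq> finite_seqs C (Suc N) \<inter> {g. g N = 0}"
      unfolding finite_seqs_def using subspace_0[OF C(1)] by (auto simp: less_Suc_eq)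
    show "finite_seqs C (Suc N) \<inter> {g. g N = 0} \<subseteq> finite_seqs C N"
    proof
      fix g assume "g \<in> finite_seqs C (Suc N) \<inter> {g. g N = 0}"
      then have g: "\<And>k. k < Suc N \<Longrightarrow> g k \<in> C k" "\<And>k. k \<ge> Suc N \<Longrightarrow> g k = 0" "g N = 0"
        unfolding finite_seqs_def by blast+
      have "g k = 0" if "k \<ge> N" for k using g(2)[of k] g(3) that by (cases "k = N") simp_all
      then show "g \<in> finite_seqs C N" unfolding finite_seqs_def using g(1) by simp
    qed
  qed
  moreover have "(\<lambda>g. g N) ` finite_seqs C (Suc N) = C N"
  proof
    show "C N \<subseteq> (\<lambda>g. g N) ` finite_seqs C (Suc N)"
    proof
      fix x assume "x \<in> C N"
      then have "single N x \<in> finite_seqs C (Suc N)"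
        unfolding finite_seqs_def single_def using subspace_0[OF C(1)] by auto
      moreover have "single N x N = x" by (simp add: single_def)
      ultimately show "x \<in> (\<lambda>g. g N) ` finite_seqs C (Suc N)" by (metis imageI)
    qed
  qed (auto simp: finite_seqs_def)
  ultimately have "seq.dim (finite_seqs C (Suc N)) = seq.dim (finite_seqs C N) + dim (C N)"
    using p.rank_nullity[OF linear_eval subspace_finite_seqs[OF C(1)] fin, of N] by simp
  then show ?case using Suc fin by simp
qed

end


section \<open>Higher Dirac cohomology\<close>

context dirac_module
begin

sublocale Q: vspace_with_seq tensor_scale
  by (intro vspace_with_seq.intro T.vspace_axioms T.vspace_seq)

definition seq_act :: "'g \<Rightarrow> (nat \<Rightarrow> nat set \<Rightarrow> 'm) \<Rightarrow> nat \<Rightarrow> nat set \<Rightarrow> 'm" where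
  "seq_act x g = (\<lambda>k. tensor_act x (g k))"

lemma tensor_act_add: "tensor_act x (F + G) = tensor_act x F + tensor_act x G"
  and tensor_act_scale: "tensor_act x (tensor_scale c F) = tensor_scale c (tensor_act x F)"
  using linear_tensor_act[of x] unfolding Vector_Spaces.linear_iff by blast+

lemma linear_seq_act: "Vector_Spaces.linear (seq_scale tensor_scale) (seq_scale tensor_scale) (seq_act x)"
proof
  show "seq_act x (g + g') = seq_act x g + seq_act x g'" for g g'
    by (rule ext) (simp only: seq_act_def plus_fun_apply[of g g'] plus_fun_apply[of "\<lambda>k. tensor_act x (g k)"] tensor_act_add)
  show "seq_act x (seq_scale tensor_scale c g) = seq_scale tensor_scale c (seq_act x g)" for c g
    by (rule ext) (simp only: seq_act_def seq_scale_def tensor_act_scale)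
qed

sublocale Qw: weight_ops "seq_scale tensor_scale" seq_act t "dual t"
proof (unfold_locales)
  show "seq_act H (u + v) = seq_act H u + seq_act H v" if "H \<in> t" for H u v
    using linear_seq_act[of H] unfolding Vector_Spaces.linear_iff by blast
  show "seq_act H (seq_scale tensor_scale c v) = seq_scale tensor_scale c (seq_act H v)" if "H \<in> t" for H c v
    using linear_seq_act[of H] unfolding Vector_Spaces.linear_iff by blast
  show "a = b" if "a \<in> dual t" "b \<in> dual t" "\<And>H. H \<in> t \<Longrightarrow> a H = b H" for a b
    using that by (rule dual_ext)
qed

lemma Qwt_iff: "g \<in> Qw.wt \<mu> \<longleftrightarrow> (\<forall>k. g k \<in> Tw.wt \<mu>)"
  unfolding Qw.wt_def Tw.wt_def seq_act_def seq_scale_def mem_Collect_eq fun_eq_iff by blast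

section \<open>Kernels of the powers of \<open>D\<close> and the denominators as
  \<open>h\<close>-modules\<close>

lemma linear_D_pow: "Vector_Spaces.linear tensor_scale tensor_scale (D ^^ r)"
proof (induction r)
  case 0
  show ?case using T.linear_id by (simp add: id_def)
next
  case (Suc r)
  show ?case using Vector_Spaces.linear_compose[OF Suc linear_D] by (simp add: comp_def)
qed

lemma D_pow_act: "X \<in> h \<Longrightarrow> (D ^^ r) (tensor_act X F) = tensor_act X ((D ^^ r) F)"
  by (induction r) (simp_all add: D_tensor_act)

lemma subspace_ker_D: "T.subspace (ker_D r)"
proof -
  interpret l: Vector_Spaces.linear tensor_scale tensor_scale "D ^^ r" by (rule linear_D_pow)
  have "ker_D r = tensor_spin \<inter> {F. (D ^^ r) F = 0}" unfolding ker_D_def by blast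
  then show ?thesis using T.subspace_inter[OF subspace_tensor_spin l.subspace_kernel] by simp
qed

lemma tensor_act_zero: "tensor_act X 0 = 0"
  using module_hom.zero[OF Vector_Spaces.linear.axioms(3)[OF linear_tensor_act]] .

lemma ker_D_act: "X \<in> h \<Longrightarrow> F \<in> ker_D r \<Longrightarrow> tensor_act X F \<in> ker_D r"
  unfolding ker_D_def using tensor_act_tensor_spin by (simp add: D_pow_act tensor_act_zero)

lemma ker_D_Suc: "ker_D r \<subseteq> ker_D (Suc r)"
proof -
  have "D 0 = 0" using module_hom.zero[OF Vector_Spaces.linear.axioms(3)[OF linear_D]] .
  then show ?thesis unfolding ker_D_def by auto
qed

lemma subspace_D_image: "T.subspace N \<Longrightarrow> T.subspace (D ` N)"
  using module_hom.subspace_image[OF Vector_Spaces.linear.axioms(3)[OF linear_D]] .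

lemma H_denominator_eq:
  "H_denominator k = {F + G | F G. F \<in> ker_D (2 * k + 1) \<inter> D ` tensor_spin \<and> G \<in> ker_D (2 * k)}"
  unfolding H_denominator_def ..

lemma subspace_H_denominator: "T.subspace (H_denominator k)"
  unfolding H_denominator_eq
  by (intro T.subspace_sums T.subspace_inter subspace_ker_D subspace_D_image subspace_tensor_spin)

lemma H_denominator_act:
  assumes "X \<in> h" "F \<in> H_denominator k"
  shows "tensor_act X F \<in> H_denominator k"
proof -
  obtain w G where F: "F = D w + G" "D w \<in> ker_D (2 * k + 1)" "G \<in> ker_D (2 * k)"
    using assms(2) unfolding H_denominator_eq by blast
  have "tensor_act X F = D (tensor_act X w) + tensor_act X G"
    unfolding F(1) tensor_act_add D_tensor_act[OF assms(1)] ..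
  moreover have "D (tensor_act X w) \<in> ker_D (2 * k + 1)"
    using ker_D_act[OF assms(1) F(2)] unfolding D_tensor_act[OF assms(1)] .
  moreover have "D (tensor_act X w) \<in> D ` tensor_spin" using tensor_act_tensor_spin[OF assms(1)] by (rule imageI)
  ultimately show ?thesis
    unfolding H_denominator_eq using ker_D_act[OF assms(1) F(3)] by blast
qed

lemma H_denominator_subset: "H_denominator k \<subseteq> ker_D (2 * k + 1)"
proof
  fix F assume "F \<in> H_denominator k"
  then obtain x y where F: "F = x + y" "x \<in> ker_D (2 * k + 1)" "y \<in> ker_D (2 * k)"
    unfolding H_denominator_eq by blast
  have "y \<in> ker_D (2 * k + 1)" using F(3) ker_D_Suc[of "2 * k"] by auto
  then show "F \<in> ker_D (2 * k + 1)" unfolding F(1) by (rule T.subspace_add[OF subspace_ker_D F(2)])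
qed

lemma subset_h: "H \<in> t \<Longrightarrow> H \<in> h"
  using cartan(2) by (rule subsetD)

lemma stable_ker_D: "Tw.stable (ker_D r)"
  unfolding Tw.stable_def by (intro conjI ballI subspace_ker_D ker_D_act subset_h)

lemma stable_ker_D_TS: "Tw.stable (ker_D r \<inter> TS s)"
  unfolding Tw.stable_def
  by (intro conjI ballI T.subspace_inter subspace_ker_D subspace_TS IntI ker_D_act tensor_act_TS subset_h)
    (assumption | erule IntD1 | erule IntD2)+

text \<open>An operator that preserves or exchanges the parities sends the two components of
  \<open>F\<close> to components of different parity, so it intertwines the projections;
  \<open>p\<close> is True in the preserving case.\<close>

lemma proj_odd:
  assumes T: "Vector_Spaces.linear tensor_scale tensor_scale A"
    and p: "\<And>F s. F \<in> TS s \<Longrightarrow> A F \<in> TS (s = p)" and F: "F \<in> tensor_spin"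
  shows "A (proj s F) = proj (s = p) (A F)"
proof -
  interpret A: Vector_Spaces.linear tensor_scale tensor_scale A by (rule T)
  interpret P: Vector_Spaces.linear tensor_scale tensor_scale "proj r" for r by (rule linear_proj)
  have 1: "A (proj s F) \<in> TS (s = p)" by (rule p[OF proj_TS[OF F]])
  have "A (proj (\<not> s) F) \<in> TS ((\<not> s) = p)" by (rule p[OF proj_TS[OF F]])
  moreover have "((\<not> s) = p) = (\<not> (s = p))" by blast
  ultimately have 2: "A (proj (\<not> s) F) \<in> TS (\<not> (s = p))" by (simp only:)
  have "A F = A (proj s F) + A (proj (\<not> s) F)"
    by (subst proj_sum[of F s]) (rule A.add)
  then have "proj (s = p) (A F) = proj (s = p) (A (proj s F)) + proj (s = p) (A (proj (\<not> s) F))"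
    by (simp only: P.add)
  then show ?thesis unfolding proj_TS_eq(1)[OF 1] proj_TS_eq(2)[OF 2] by simp
qed

lemma proj_D: "F \<in> tensor_spin \<Longrightarrow> D (proj s F) = proj (\<not> s) (D F)"
  using proj_odd[OF linear_D, where p = False and F = F and s = s] D_TS by simp

lemma proj_act: "X \<in> h \<Longrightarrow> F \<in> tensor_spin \<Longrightarrow> tensor_act X (proj s F) = proj s (tensor_act X F)"
  using proj_odd[OF linear_tensor_act, where p = True and F = F and s = s] tensor_act_TS by simp

lemma proj_zero: "proj s 0 = 0"
  by (rule ext) (simp add: proj_def)

lemma D_pow_tensor_spin: "F \<in> tensor_spin \<Longrightarrow> (D ^^ r) F \<in> tensor_spin"
  by (induction r) (simp_all add: D_tensor_spin)

lemma proj_D_pow: "F \<in> tensor_spin \<Longrightarrow> (D ^^ r) (proj s F) = proj (even r = s) ((D ^^ r) F)"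
proof (induction r)
  case (Suc r)
  have e: "(\<not> (even r = s)) = (even (Suc r) = s)" by auto
  have "(D ^^ Suc r) (proj s F) = D (proj (even r = s) ((D ^^ r) F))" using Suc by simp
  also have "\<dots> = proj (even (Suc r) = s) ((D ^^ Suc r) F)"
    unfolding proj_D[OF D_pow_tensor_spin[OF Suc.prems]] e by simp
  finally show ?case .
qed simp

lemma proj_ker_D: "F \<in> ker_D r \<Longrightarrow> proj s F \<in> ker_D r"
proof -
  assume "F \<in> ker_D r"
  then have F: "F \<in> tensor_spin" "(D ^^ r) F = 0" unfolding ker_D_def by blast+
  have "proj s F \<in> tensor_spin" using proj_TS[OF F(1)] TS_subset by blast
  moreover have "(D ^^ r) (proj s F) = 0" unfolding proj_D_pow[OF F(1)] F(2) by (rule proj_zero)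
  ultimately show "proj s F \<in> ker_D r" unfolding ker_D_def by blast
qed

lemma proj_V: "F \<in> tensor_spin \<Longrightarrow> F \<in> Tw.wt \<mu> \<Longrightarrow> proj s F \<in> V \<mu> s"
proof -
  assume F: "F \<in> tensor_spin" "F \<in> Tw.wt \<mu>"
  have "tensor_act H (proj s F) = tensor_scale (\<mu> H) (proj s F)" if H: "H \<in> t" for H
  proof -
    have "tensor_act H F = tensor_scale (\<mu> H) F" using F(2) H unfolding Tw.wt_def by blast
    moreover have "proj s (tensor_scale c F) = tensor_scale c (proj s F)" for c
      using linear_proj unfolding Vector_Spaces.linear_iff by blast
    ultimately show ?thesis unfolding proj_act[OF subset_h[OF H] F(1)] by (simp only:)
  qed
  then show "proj s F \<in> V \<mu> s" unfolding V_def Tw.wt_def using proj_TS[OF F(1)] by blast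
qed

lemma subspace_V: "T.subspace (V \<mu> s)"
  unfolding V_def by (rule T.subspace_inter[OF subspace_TS Tw.subspace_wt])

lemma D_wt: "F \<in> Tw.wt \<mu> \<Longrightarrow> D F \<in> Tw.wt \<mu>"
  unfolding Tw.wt_def
proof (intro CollectI ballI)
  fix H assume F: "F \<in> {x. \<forall>H\<in>t. tensor_act H x = tensor_scale (\<mu> H) x}" and H: "H \<in> t"
  then have "tensor_act H F = tensor_scale (\<mu> H) F" by blast
  moreover have "D (tensor_scale c F) = tensor_scale c (D F)" for c
    using linear_D unfolding Vector_Spaces.linear_iff by blast
  ultimately show "tensor_act H (D F) = tensor_scale (\<mu> H) (D F)"
    unfolding D_tensor_act[OF subset_h[OF H]] by (simp only:)
qed

lemma odd_operator_V:
  assumes "category_O" "\<mu> \<in> dual t"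
  shows "odd_operator tensor_scale (V \<mu>) D"
proof (intro odd_operator.intro odd_operator_axioms.intro)
  show "vspace tensor_scale" by (rule T.vspace_axioms)
  show "Vector_Spaces.linear tensor_scale tensor_scale D" by (rule linear_D)
  show "T.subspace (V \<mu> s)" for s by (rule subspace_V)
  show "T.fin_span (V \<mu> s)" for s by (rule fin_span_V[OF assms])
  show "D x \<in> V \<mu> (\<not> s)" if "x \<in> V \<mu> s" for x s
    using that D_TS D_wt unfolding V_def by blast
qed

lemma V_tensor_spin: "V \<mu> s \<subseteq> tensor_spin"
  unfolding V_def using TS_subset by blast

lemma D_zero: "D 0 = 0"
  using module_hom.zero[OF Vector_Spaces.linear.axioms(3)[OF linear_D]] .

text \<open>Weight components commute with \<open>D\<close>, so a weight vector in the denominator can be written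
  with summands of the same weight; the parity components are then handled by \<open>proj\<close>.\<close>

lemma H_denominator_weight:
  assumes O: category_O and \<mu>: "\<mu> \<in> dual t" and F: "F \<in> H_denominator k" "F \<in> V \<mu> s"
  shows "F \<in> odd_operator.den (V \<mu>) D k s"
proof -
  interpret o: odd_operator tensor_scale "V \<mu>" D by (rule odd_operator_V[OF O \<mu>])
  let ?G1 = "\<Union>\<nu>\<in>dual t. tensor_spin \<inter> Tw.wt \<nu>" and ?G2 = "\<Union>\<nu>\<in>dual t. ker_D (2 * k) \<inter> Tw.wt \<nu>"
  let ?A = "D ` (tensor_spin \<inter> Tw.wt \<mu>)" and ?B = "ker_D (2 * k) \<inter> Tw.wt \<mu>"
  obtain w y where wy: "F = D w + y" "w \<in> tensor_spin" "y \<in> ker_D (2 * k)"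
    using F(1) unfolding H_denominator_eq by blast
  have "w \<in> T.span ?G1"
    by (rule subsetD[OF stable_span_weights[OF O stable_tensor_spin subset_refl] wy(2)])
  then have "D w \<in> T.span (D ` ?G1)" unfolding o.D.span_image by (rule imageI)
  moreover have "ker_D (2 * k) \<subseteq> tensor_spin" unfolding ker_D_def by blast
  then have "y \<in> T.span ?G2"
    by (rule subsetD[OF stable_span_weights[OF O stable_ker_D] wy(3)])
  ultimately have "F \<in> T.span (D ` ?G1 \<union> ?G2)"
    unfolding wy(1) T.span_Un by blast
  moreover have "D ` ?G1 \<union> ?G2 \<subseteq> (\<Union>\<nu>\<in>dual t. Tw.wt \<nu>)"
  proof (rule Un_least)
    show "D ` ?G1 \<subseteq> (\<Union>\<nu>\<in>dual t. Tw.wt \<nu>)"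
    proof
      fix x assume "x \<in> D ` ?G1"
      then obtain g \<nu> where "x = D g" "\<nu> \<in> dual t" "g \<in> Tw.wt \<nu>" by blast
      then show "x \<in> (\<Union>\<nu>\<in>dual t. Tw.wt \<nu>)" using D_wt by blast
    qed
  qed blast
  moreover have "F \<in> Tw.wt \<mu>" using F(2) unfolding V_def by blast
  ultimately have "F \<in> T.span ((D ` ?G1 \<union> ?G2) \<inter> Tw.wt \<mu>)"
    using Tw.wt_subset_span[OF _ \<mu>] by blast
  moreover have "(D ` ?G1 \<union> ?G2) \<inter> Tw.wt \<mu> \<subseteq> ?A \<union> ?B"
  proof
    fix x assume x: "x \<in> (D ` ?G1 \<union> ?G2) \<inter> Tw.wt \<mu>"
    show "x \<in> ?A \<union> ?B"
    proof (cases "x \<in> ?G2")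
      case True
      then show ?thesis using x by blast
    next
      case False
      then obtain g \<nu> where g: "x = D g" "\<nu> \<in> dual t" "g \<in> tensor_spin" "g \<in> Tw.wt \<nu>" using x by blast
      show ?thesis
      proof (cases "\<nu> = \<mu>")
        case True
        then show ?thesis using g by blast
      next
        case False
        have "x \<in> Tw.wt \<nu>" unfolding g(1) by (rule D_wt[OF g(4)])
        moreover have "x \<in> Tw.wt \<mu>" using x by (rule IntD2)
        ultimately have "x = 0" using Tw.wt_Int[OF g(2) \<mu>] False by blast
        \<comment> \<open>A boundary with two different weights is 0, which still belongs to
          \<open>?A\<close> as the image of 0.\<close>
        then have "x = D 0" unfolding D_zero .
        moreover have "0 \<in> tensor_spin \<inter> Tw.wt \<mu>"
          by (rule T.subspace_0[OF T.subspace_inter[OF subspace_tensor_spin Tw.subspace_wt]])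
        ultimately show ?thesis by blast
      qed
    qed
  qed
  ultimately have "F \<in> T.span (?A \<union> ?B)" using T.span_mono by blast
  moreover have "T.span ?A = ?A" "T.span ?B = ?B"
    unfolding T.span_eq_iff
    by (intro subspace_D_image T.subspace_inter subspace_tensor_spin Tw.subspace_wt subspace_ker_D)+
  ultimately have "F \<in> {a + b | a b. a \<in> ?A \<and> b \<in> ?B}" unfolding T.span_Un by (simp only:)
  then obtain w' y' where w': "w' \<in> tensor_spin" "w' \<in> Tw.wt \<mu>" and y': "y' \<in> ker_D (2 * k)" "y' \<in> Tw.wt \<mu>"
    and F': "F = D w' + y'" by blast
  have ys: "y' \<in> tensor_spin" using y'(1) unfolding ker_D_def by blast
  have FT: "F \<in> TS s" using F(2) unfolding V_def by blast
  have "proj s (D w' + y') = proj s (D w') + proj s y'"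
    using linear_proj unfolding Vector_Spaces.linear_iff by blast
  moreover have "D (proj (\<not> s) w') = proj s (D w')" using proj_D[OF w'(1), of "\<not> s"] by simp
  ultimately have eq: "F = D (proj (\<not> s) w') + proj s y'"
    using proj_TS_eq(1)[OF FT] F' by (simp only:)
  have yK: "proj s y' \<in> o.K (2 * k) s"
    using proj_V[OF ys y'(2)] proj_ker_D[OF y'(1)] unfolding o.K_def ker_D_def by blast
  have FK: "F \<in> o.K (2 * k + 1) s"
    using subsetD[OF H_denominator_subset F(1)] F(2) unfolding o.K_def ker_D_def by blast
  have "proj s y' \<in> o.K (2 * k + 1) s" using yK o.K_Suc_mono[of "2 * k" s] by auto
  \<comment> \<open>Passing to weight components lost the information that the boundary lies in the
    kernel; it is recovered as a difference of two elements of the kernel.\<close>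
  then have "F - proj s y' \<in> o.K (2 * k + 1) s" by (rule T.subspace_diff[OF o.subspace_K FK])
  moreover have "F - proj s y' = D (proj (\<not> s) w')" unfolding diff_eq_eq by (rule eq)
  ultimately have "D (proj (\<not> s) w') \<in> o.K (2 * k + 1) s \<inter> D ` V \<mu> (\<not> s)"
    using imageI[OF proj_V[OF w']] by simp
  then show ?thesis unfolding o.den_def using eq yK by blast
qed


subsection \<open>The cohomology as an image\<close>

definition H_part :: "bool \<Rightarrow> ('g, nat \<Rightarrow> (nat set \<Rightarrow> 'm) set) rep" where
  "H_part s = H_top\<lparr>car := {f \<in> car H_top.
     \<forall>k. f k \<in> coset (H_denominator k) ` (ker_D (2 * k + 1) \<inter> TS s)}\<rparr>"

lemma H_top_even_eq: "H_top_even = H_part True" and H_top_odd_eq: "H_top_odd = H_part False"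
  unfolding H_top_even_def H_top_odd_def H_part_def TS_even TS_odd by (rule refl)+

definition HX :: "bool \<Rightarrow> (nat \<Rightarrow> nat set \<Rightarrow> 'm) set" where
  "HX s = {g. finite {k. g k \<noteq> 0} \<and> (\<forall>k. g k \<in> ker_D (2 * k + 1) \<inter> TS s)}"

definition HW :: "(nat \<Rightarrow> nat set \<Rightarrow> 'm) set" where
  "HW = {g. \<forall>k. g k \<in> H_denominator k}"

definition class_of :: "(nat \<Rightarrow> nat set \<Rightarrow> 'm) \<Rightarrow> nat \<Rightarrow> (nat set \<Rightarrow> 'm) set" where
  "class_of g = (\<lambda>k. coset (H_denominator k) (g k))"

text \<open>Finite support passes from the cosets to the representatives only if the zero class is
  represented by 0, so the representatives are chosen with this side condition.\<close>

lemma car_H_part: "car (H_part s) = class_of ` HX s"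
proof
  have car: "car (H_part s) = {f. (\<forall>k. f k \<in> coset (H_denominator k) ` ker_D (2 * k + 1)) \<and>
      finite {k. f k \<noteq> H_denominator k} \<and>
      (\<forall>k. f k \<in> coset (H_denominator k) ` (ker_D (2 * k + 1) \<inter> TS s))}"
    by (simp add: H_part_def H_top_def direct_sum_rep_def H_top_deg_def quot_rep_def conj_assoc)
  show "class_of ` HX s \<subseteq> car (H_part s)"
  proof
    fix f assume "f \<in> class_of ` HX s"
    then obtain g where g: "f = class_of g" "finite {k. g k \<noteq> 0}" "\<And>k. g k \<in> ker_D (2 * k + 1) \<inter> TS s"
      unfolding HX_def by blast
    have "{k. f k \<noteq> H_denominator k} \<subseteq> {k. g k \<noteq> 0}"
    proof (intro subsetI CollectI notI)
      fix k assume k: "k \<in> {k. f k \<noteq> H_denominator k}" "g k = 0"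
      have "f k = H_denominator k" unfolding g(1) class_of_def k(2) by (rule T.coset_zero)
      then show False using k(1) by blast
    qed
    then have "finite {k. f k \<noteq> H_denominator k}" using g(2) by (rule finite_subset)
    moreover have "f k \<in> coset (H_denominator k) ` (ker_D (2 * k + 1) \<inter> TS s)" for k
      unfolding g(1) class_of_def by (rule imageI[OF g(3)])
    ultimately show "f \<in> car (H_part s)" unfolding car by blast
  qed
  show "car (H_part s) \<subseteq> class_of ` HX s"
  proof
    fix f assume "f \<in> car (H_part s)"
    then have f: "finite {k. f k \<noteq> H_denominator k}"
      "\<And>k. f k \<in> coset (H_denominator k) ` (ker_D (2 * k + 1) \<inter> TS s)" unfolding car by blast+
    have "\<exists>x. x \<in> ker_D (2 * k + 1) \<inter> TS s \<and> f k = coset (H_denominator k) x \<and>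
        (f k = H_denominator k \<longrightarrow> x = 0)" for k
    proof (cases "f k = H_denominator k")
      case True
      have "0 \<in> ker_D (2 * k + 1) \<inter> TS s"
        by (rule T.subspace_0[OF T.subspace_inter[OF subspace_ker_D subspace_TS]])
      then show ?thesis using True T.coset_zero[of "H_denominator k"] by (intro exI[of _ 0]) simp
    next
      case False
      then show ?thesis using f(2)[of k] by blast
    qed
    then have "\<forall>k. \<exists>x. x \<in> ker_D (2 * k + 1) \<inter> TS s \<and> f k = coset (H_denominator k) x \<and>
        (f k = H_denominator k \<longrightarrow> x = 0)" by (rule allI)
    from choice[OF this] obtain g where g: "\<forall>k. g k \<in> ker_D (2 * k + 1) \<inter> TS s \<and>
        f k = coset (H_denominator k) (g k) \<and> (f k = H_denominator k \<longrightarrow> g k = 0)" by (rule exE)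
    have "{k. g k \<noteq> 0} \<subseteq> {k. f k \<noteq> H_denominator k}" using g by blast
    then have "finite {k. g k \<noteq> 0}" using f(1) by (rule finite_subset)
    then have "g \<in> HX s" unfolding HX_def using g by blast
    moreover have "f = class_of g" unfolding class_of_def using g by (intro ext) blast
    ultimately show "f \<in> class_of ` HX s" by blast
  qed
qed

lemma subspace_HX: "Q.seq.subspace (HX s)"
proof (rule Q.seq.subspaceI)
  have N: "T.subspace (ker_D r \<inter> TS s)" for r by (rule T.subspace_inter[OF subspace_ker_D subspace_TS])
  show "0 \<in> HX s" unfolding HX_def using T.subspace_0[OF N] by simp
  show "g + g' \<in> HX s" if g: "g \<in> HX s" "g' \<in> HX s" for g g'
  proof -
    have "{k. (g + g') k \<noteq> 0} \<subseteq> {k. g k \<noteq> 0} \<union> {k. g' k \<noteq> 0}" by auto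
    then have "finite {k. (g + g') k \<noteq> 0}"
      by (rule finite_subset) (use g in \<open>simp add: HX_def\<close>)
    moreover have "(g + g') k \<in> ker_D (2 * k + 1) \<inter> TS s" for k
    proof -
      have "(g + g') k = g k + g' k" by (rule plus_fun_apply)
      moreover have "g k \<in> ker_D (2 * k + 1) \<inter> TS s" "g' k \<in> ker_D (2 * k + 1) \<inter> TS s"
        using g unfolding HX_def by blast+
      ultimately show ?thesis using T.subspace_add[OF N] by (simp only:)
    qed
    ultimately show ?thesis unfolding HX_def by blast
  qed
  show "seq_scale tensor_scale c g \<in> HX s" if g: "g \<in> HX s" for c g
  proof -
    have "{k. seq_scale tensor_scale c g k \<noteq> 0} \<subseteq> {k. g k \<noteq> 0}"
      unfolding seq_scale_def by auto
    then have "finite {k. seq_scale tensor_scale c g k \<noteq> 0}"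
      by (rule finite_subset) (use g in \<open>simp add: HX_def\<close>)
    moreover have "seq_scale tensor_scale c g k \<in> ker_D (2 * k + 1) \<inter> TS s" for k
      unfolding seq_scale_def using g unfolding HX_def by (intro T.subspace_scale[OF N]) blast
    ultimately show ?thesis unfolding HX_def by blast
  qed
qed

text \<open>Weight components are taken in one degree at a time; finite support makes a sequence a
  finite sum of sequences concentrated in a single degree.\<close>

lemma HX_span:
  assumes O: category_O
  shows "HX s \<subseteq> Q.seq.span (\<Union>\<nu>\<in>dual t. HX s \<inter> Qw.wt \<nu>)"
proof
  let ?S = "Q.seq.span (\<Union>\<nu>\<in>dual t. HX s \<inter> Qw.wt \<nu>)"
  fix g assume g: "g \<in> HX s"
  have N: "T.subspace (ker_D r \<inter> TS s)" for r by (rule T.subspace_inter[OF subspace_ker_D subspace_TS])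
  have single: "single k F \<in> ?S" if F: "F \<in> ker_D (2 * k + 1) \<inter> TS s" for k F
  proof -
    interpret l: Vector_Spaces.linear tensor_scale "seq_scale tensor_scale" "single k" by (rule Q.linear_single)
    have "ker_D (2 * k + 1) \<inter> TS s \<subseteq> tensor_spin" using TS_subset by blast
    from stable_span_weights[OF O stable_ker_D_TS this]
    have "F \<in> T.span (\<Union>\<nu>\<in>dual t. ker_D (2 * k + 1) \<inter> TS s \<inter> Tw.wt \<nu>)" using F by (rule subsetD)
    moreover have "T.span (\<Union>\<nu>\<in>dual t. ker_D (2 * k + 1) \<inter> TS s \<inter> Tw.wt \<nu>) \<subseteq> {F. single k F \<in> ?S}"
    proof (rule T.span_minimal[OF _ l.subspace_linear_preimage[OF Q.seq.subspace_span]], rule subsetI)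
      fix x assume "x \<in> (\<Union>\<nu>\<in>dual t. ker_D (2 * k + 1) \<inter> TS s \<inter> Tw.wt \<nu>)"
      then obtain \<nu> where x: "\<nu> \<in> dual t" "x \<in> ker_D (2 * k + 1) \<inter> TS s" "x \<in> Tw.wt \<nu>" by blast
      have "{j. single k x j \<noteq> 0} \<subseteq> {k}" unfolding single_def by auto
      then have "finite {j. single k x j \<noteq> 0}" by (rule finite_subset) simp
      moreover have "single k x j \<in> ker_D (2 * j + 1) \<inter> TS s" for j
        unfolding single_def using x(2) T.subspace_0[OF N] by simp
      ultimately have "single k x \<in> HX s" unfolding HX_def by blast
      moreover have "single k x \<in> Qw.wt \<nu>"
        unfolding Qwt_iff single_def using x(3) T.subspace_0[OF Tw.subspace_wt] by simp
      ultimately show "x \<in> {F. single k F \<in> ?S}" using x(1) by (intro CollectI Q.seq.span_base) blast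
    qed
    ultimately show ?thesis by blast
  qed
  have gs: "finite {k. g k \<noteq> 0}" "\<And>k. g k \<in> ker_D (2 * k + 1) \<inter> TS s" using g unfolding HX_def by blast+
  have "g = (\<Sum>k\<in>{k. g k \<noteq> 0}. single k (g k))"
  proof
    fix j
    have "(\<Sum>k\<in>{k. g k \<noteq> 0}. single k (g k)) j = (\<Sum>k\<in>{k. g k \<noteq> 0}. if j = k then g j else 0)"
      by (subst sum_fun_apply, rule sum.cong[OF refl]) (simp add: single_def)
    also have "\<dots> = g j" using gs(1) by (subst sum.delta') auto
    finally show "g j = (\<Sum>k\<in>{k. g k \<noteq> 0}. single k (g k)) j" by (rule sym)
  qed
  moreover have "(\<Sum>k\<in>{k. g k \<noteq> 0}. single k (g k)) \<in> ?S"
    by (rule Q.seq.span_sum) (rule single[OF gs(2)])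
  ultimately show "g \<in> ?S" by (simp only:)
qed

lemma rep_image_H:
  assumes O: category_O
  shows "rep_image scale br (seq_scale tensor_scale) seq_act t h (HX s) HW (H_part s) class_of"
proof (intro rep_image.intro rep_image_axioms.intro)
  show "complex_lie_algebra scale br" by (rule complex_lie_algebra_axioms)
  show "weight_ops (seq_scale tensor_scale) seq_act t (dual t)" by (rule Qw.weight_ops_axioms)
  show "subalgebra h" by (rule subalgebra_h)
  show "t \<subseteq> h" by (rule cartan(2))
  show "Q.seq.subspace (HX s)" by (rule subspace_HX)
  show "seq_act x u \<in> HX s" if x: "x \<in> h" and u: "u \<in> HX s" for x u
  proof -
    have "{k. seq_act x u k \<noteq> 0} \<subseteq> {k. u k \<noteq> 0}" unfolding seq_act_def using tensor_act_zero by auto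
    then have "finite {k. seq_act x u k \<noteq> 0}" by (rule finite_subset) (use u in \<open>simp add: HX_def\<close>)
    moreover have "seq_act x u k \<in> ker_D (2 * k + 1) \<inter> TS s" for k
      unfolding seq_act_def using u ker_D_act[OF x] tensor_act_TS[OF x] unfolding HX_def by blast
    ultimately show ?thesis unfolding HX_def by blast
  qed
  show "Vector_Spaces.linear (seq_scale tensor_scale) (seq_scale tensor_scale) (seq_act x)" for x
    by (rule linear_seq_act)
  show "seq_act (x + y) u = seq_act x u + seq_act y u" if "x \<in> h" "y \<in> h" for x y u
    by (rule ext) (simp only: seq_act_def plus_fun_apply[of "\<lambda>k. tensor_act x (u k)"] tensor_act_add_left[OF that])
  show "seq_act (c *s x) u = seq_scale tensor_scale c (seq_act x u)" if "x \<in> h" for c x u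
    by (rule ext) (simp only: seq_act_def seq_scale_def tensor_act_scale_left[OF that])
  show "seq_act x (seq_act y u) = seq_act (br x y) u + seq_act y (seq_act x u)" if "x \<in> h" "y \<in> h" for x y u
    by (rule ext) (simp only: seq_act_def plus_fun_apply[of "\<lambda>k. tensor_act (br x y) (u k)"] tensor_act_br[OF that])
  show "car (H_part s) = class_of ` HX s" by (rule car_H_part)
  note sel = H_part_def H_top_def direct_sum_rep_def H_top_deg_def quot_rep_def class_of_def
  show "rep.zero (H_part s) = class_of 0"
    by (rule ext) (simp add: sel T.coset_zero)
  show "rep.add (H_part s) (class_of u) (class_of v) = class_of (u + v)" for u v
    by (rule ext) (simp add: sel T.coset_add[OF subspace_H_denominator])
  show "smul (H_part s) c (class_of u) = class_of (seq_scale tensor_scale c u)" for c u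
  proof (rule ext)
    fix k
    have "{tensor_scale c a + w | a w. a \<in> coset (H_denominator k) (u k) \<and> w \<in> H_denominator k} =
        coset (H_denominator k) (tensor_scale c (u k))"
      by (rule T.coset_map[OF subspace_H_denominator T.linear_scale T.subspace_scale[OF subspace_H_denominator]])
    then show "smul (H_part s) c (class_of u) k = class_of (seq_scale tensor_scale c u) k"
      by (simp add: sel seq_scale_def)
  qed
  show "act (H_part s) x (class_of u) = class_of (seq_act x u)" if "x \<in> h" for x u
  proof (rule ext)
    fix k
    have "{tensor_act x a + w | a w. a \<in> coset (H_denominator k) (u k) \<and> w \<in> H_denominator k} =
        coset (H_denominator k) (tensor_act x (u k))"
      by (rule T.coset_map[OF subspace_H_denominator linear_tensor_act H_denominator_act[OF that]])
    then show "act (H_part s) x (class_of u) k = class_of (seq_act x u) k"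
      by (simp add: sel seq_act_def)
  qed
  show "Qw.stable HW"
    unfolding Qw.stable_def
  proof (intro conjI ballI)
    show "Q.seq.subspace HW"
    proof (rule Q.seq.subspaceI)
      show "0 \<in> HW" unfolding HW_def using T.subspace_0[OF subspace_H_denominator] by simp
      show "g + g' \<in> HW" if "g \<in> HW" "g' \<in> HW" for g g'
        using that unfolding HW_def mem_Collect_eq plus_fun_apply[of g]
        by (intro allI T.subspace_add[OF subspace_H_denominator]) simp_all
      show "seq_scale tensor_scale c g \<in> HW" if "g \<in> HW" for c g
        using that unfolding HW_def mem_Collect_eq seq_scale_def
        by (intro allI T.subspace_scale[OF subspace_H_denominator]) blast
    qed
    show "seq_act H g \<in> HW" if "H \<in> t" "g \<in> HW" for H g
      using that H_denominator_act[OF subset_h] unfolding HW_def seq_act_def by blast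
  qed
  show "class_of u = class_of v \<longleftrightarrow> u - v \<in> HW" for u v
    unfolding class_of_def HW_def fun_eq_iff[of "\<lambda>k. coset (H_denominator k) (u k)"]
      T.coset_eq_iff[OF subspace_H_denominator] by simp
  show "HX s \<subseteq> Q.seq.span (\<Union>\<nu>\<in>dual t. HX s \<inter> Qw.wt \<nu>)" by (rule HX_span[OF O])
qed

text \<open>Complements of \<open>den\<close> in the kernels on the weight space, one for each
  degree below \<open>N\<close>, represent all classes of weight \<mu>; from \<open>N\<close> on the
  class is 0. They meet the denominators trivially by \<open>H_denominator_weight\<close>: a weight
  vector that is trivial in the full cohomology is already trivial in its weight space.\<close>

lemma H_section:
  assumes O: category_O and \<mu>: "\<mu> \<in> dual t"
    and N: "\<forall>k\<ge>N. odd_operator.den (V \<mu>) D k s = odd_operator.K (V \<mu>) D (2 * k + 1) s"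
  shows "\<exists>C. rep_image.section_of (seq_scale tensor_scale) (HX s) HW class_of (class_of ` (HX s \<inter> Qw.wt \<mu>)) C \<and>
    Q.seq.dim C = (\<Sum>k<N. T.dim (odd_operator.K (V \<mu>) D (2 * k + 1) s) - T.dim (odd_operator.den (V \<mu>) D k s))"
proof -
  interpret o: odd_operator tensor_scale "V \<mu>" D by (rule odd_operator_V[OF O \<mu>])
  interpret R: rep_image scale br "seq_scale tensor_scale" seq_act t h "HX s" HW "H_part s" class_of
    by (rule rep_image_H[OF O])
  have den_sub: "o.den k s \<subseteq> H_denominator k" for k
  proof
    fix x assume "x \<in> o.den k s"
    then obtain a b where x: "x = a + b" "a \<in> o.K (2 * k + 1) s" "a \<in> D ` V \<mu> (\<not> s)" "b \<in> o.K (2 * k) s"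
      unfolding o.den_def by blast
    have "a \<in> ker_D (2 * k + 1)" "b \<in> ker_D (2 * k)"
      using x(2,4) V_tensor_spin unfolding o.K_def ker_D_def by blast+
    moreover have "a \<in> D ` tensor_spin" using x(3) V_tensor_spin by blast
    ultimately show "x \<in> H_denominator k" unfolding H_denominator_eq x(1) by blast
  qed
  have "\<forall>k. \<exists>C. T.subspace C \<and> C \<subseteq> o.K (2 * k + 1) s \<and> C \<inter> o.den k s = {0} \<and>
      o.K (2 * k + 1) s = {c + w | c w. c \<in> C \<and> w \<in> o.den k s} \<and>
      T.dim C + T.dim (o.den k s) = T.dim (o.K (2 * k + 1) s)"
    using T.complement_exists[OF o.subspace_K o.subspace_den o.den_subset o.fin_K] by (intro allI)
  from choice[OF this] obtain C where "\<forall>k. T.subspace (C k) \<and> C k \<subseteq> o.K (2 * k + 1) s \<and> C k \<inter> o.den k s = {0} \<and>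
      o.K (2 * k + 1) s = {c + w | c w. c \<in> C k \<and> w \<in> o.den k s} \<and>
      T.dim (C k) + T.dim (o.den k s) = T.dim (o.K (2 * k + 1) s)" by (rule exE)
  then have C: "\<And>k. T.subspace (C k)" "\<And>k. C k \<subseteq> o.K (2 * k + 1) s" "\<And>k. C k \<inter> o.den k s = {0}"
      "\<And>k. o.K (2 * k + 1) s = {c + w | c w. c \<in> C k \<and> w \<in> o.den k s}"
      "\<And>k. T.dim (C k) + T.dim (o.den k s) = T.dim (o.K (2 * k + 1) s)" by blast+
  let ?C = "Q.finite_seqs C N"
  have fin: "T.fin_span (C k)" for k by (rule T.fin_span_subset[OF o.fin_K C(2)])
  have CV: "C k \<subseteq> V \<mu> s" "C k \<subseteq> ker_D (2 * k + 1)" for k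
    using C(2)[of k] V_tensor_spin unfolding o.K_def ker_D_def by blast+
  have C0: "g k = 0 \<or> g k \<in> C k" if "g \<in> ?C" for g k
    using that unfolding Q.finite_seqs_def by (cases "k < N") auto
  have gC: "g k \<in> C k" if "g \<in> ?C" for g k
    using C0[OF that, of k] T.subspace_0[OF C(1)] by auto
  have sub: "?C \<subseteq> HX s \<inter> Qw.wt \<mu>"
  proof
    fix g assume g: "g \<in> ?C"
    have "{k. g k \<noteq> 0} \<subseteq> {..<N}" using g unfolding Q.finite_seqs_def by (auto simp: not_le[symmetric])
    then have "finite {k. g k \<noteq> 0}" by (rule finite_subset) simp
    moreover have "g k \<in> ker_D (2 * k + 1)" "g k \<in> TS s" "g k \<in> Tw.wt \<mu>" for k
      using gC[OF g, of k] CV[of k] unfolding V_def by blast+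
    ultimately show "g \<in> HX s \<inter> Qw.wt \<mu>" unfolding HX_def Int_iff Qwt_iff by blast
  qed
  have inj: "?C \<inter> HW \<subseteq> {0}"
  proof
    fix g assume g: "g \<in> ?C \<inter> HW"
    have "g k = 0" for k
    proof -
      have gk: "g k \<in> C k" using g gC by blast
      then have "g k \<in> V \<mu> s" using CV(1) by blast
      moreover have "g k \<in> H_denominator k" using g unfolding HW_def by blast
      ultimately have "g k \<in> o.den k s" by (intro H_denominator_weight[OF O \<mu>])
      then show ?thesis using gk C(3)[of k] by blast
    qed
    then have "g = 0" by (intro ext) simp
    then show "g \<in> {0}" by simp
  qed
  have "class_of ` ?C = class_of ` (HX s \<inter> Qw.wt \<mu>)"
  proof
    show "class_of ` ?C \<subseteq> class_of ` (HX s \<inter> Qw.wt \<mu>)" using sub by (rule image_mono)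
    show "class_of ` (HX s \<inter> Qw.wt \<mu>) \<subseteq> class_of ` ?C"
    proof
      fix f assume "f \<in> class_of ` (HX s \<inter> Qw.wt \<mu>)"
      then obtain g where g: "f = class_of g" "g \<in> HX s" "g \<in> Qw.wt \<mu>" by blast
      have gK: "g k \<in> o.K (2 * k + 1) s" for k
      proof -
        have "g k \<in> ker_D (2 * k + 1)" "g k \<in> TS s" using g(2) unfolding HX_def by blast+
        moreover have "g k \<in> Tw.wt \<mu>" using g(3) unfolding Qwt_iff by blast
        ultimately show ?thesis unfolding o.K_def V_def ker_D_def by blast
      qed
      have "\<forall>k. \<exists>c. c \<in> C k \<and> g k - c \<in> o.den k s"
      proof
        fix k
        obtain c w where "g k = c + w" "c \<in> C k" "w \<in> o.den k s" using gK[of k] C(4)[of k] by blast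
        then show "\<exists>c. c \<in> C k \<and> g k - c \<in> o.den k s" by (intro exI[of _ c]) simp
      qed
      from choice[OF this] obtain c where c: "\<forall>k. c k \<in> C k \<and> g k - c k \<in> o.den k s" by (rule exE)
      define g' where "g' k = (if k < N then c k else 0)" for k
      have g'C: "g' \<in> ?C" unfolding Q.finite_seqs_def g'_def using c by simp
      have "g k - g' k \<in> H_denominator k" for k
      proof (cases "k < N")
        case True
        then show ?thesis unfolding g'_def using c den_sub by auto
      next
        case False
        then have "g k \<in> o.den k s" using gK[of k] N by (simp add: not_less)
        then show ?thesis unfolding g'_def using False den_sub by auto
      qed
      then have "g - g' \<in> HW" unfolding HW_def by simp
      then have "class_of g = class_of g'" using R.\<Phi>_eq[OF g(2)] sub g'C by blast
      then show "f \<in> class_of ` ?C" unfolding g(1) using g'C by blast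
    qed
  qed
  then have "R.section_of (class_of ` (HX s \<inter> Qw.wt \<mu>)) ?C"
    unfolding R.section_of_def using Q.subspace_finite_seqs[of C N, OF C(1)] sub inj
      Q.finite_seqs_dim[of C N, OF C(1) fin] by blast
  moreover have "Q.seq.dim ?C = (\<Sum>k<N. T.dim (o.K (2 * k + 1) s) - T.dim (o.den k s))"
  proof -
    have "T.dim (C k) = T.dim (o.K (2 * k + 1) s) - T.dim (o.den k s)" for k using C(5)[of k] by simp
    then show ?thesis using Q.finite_seqs_dim[of C N, OF C(1) fin] by simp
  qed
  ultimately show ?thesis by blast
qed

section \<open>The tensor product as an image and the comparison of characters\<close>

definition M_part :: "bool \<Rightarrow> ('g, nat set \<Rightarrow> 'm) rep" where
  "M_part s = sub_rep tensor_scale tensor_act (TS s)"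

lemma M_S_even_eq: "M_S_even = M_part True" and M_S_odd_eq: "M_S_odd = M_part False"
  unfolding M_S_even_def M_S_odd_def M_part_def TS_even TS_odd by (rule refl)+

lemma rep_image_M:
  assumes O: category_O
  shows "rep_image scale br tensor_scale tensor_act t h (TS s) {0} (M_part s) (\<lambda>x. x)"
proof (intro rep_image.intro rep_image_axioms.intro)
  show "complex_lie_algebra scale br" by (rule complex_lie_algebra_axioms)
  show "weight_ops tensor_scale tensor_act t (dual t)" by (rule Tw.weight_ops_axioms)
  show "subalgebra h" by (rule subalgebra_h)
  show "t \<subseteq> h" by (rule cartan(2))
  show "T.subspace (TS s)" by (rule subspace_TS)
  show "tensor_act x u \<in> TS s" if "x \<in> h" "u \<in> TS s" for x u by (rule tensor_act_TS[OF that])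
  show "Vector_Spaces.linear tensor_scale tensor_scale (tensor_act x)" for x by (rule linear_tensor_act)
  show "tensor_act (x + y) u = tensor_act x u + tensor_act y u" if "x \<in> h" "y \<in> h" for x y u
    by (rule tensor_act_add_left[OF that])
  show "tensor_act (c *s x) u = tensor_scale c (tensor_act x u)" if "x \<in> h" for c x u
    by (rule tensor_act_scale_left[OF that])
  show "tensor_act x (tensor_act y u) = tensor_act (br x y) u + tensor_act y (tensor_act x u)"
    if "x \<in> h" "y \<in> h" for x y u by (rule tensor_act_br[OF that])
  show "car (M_part s) = (\<lambda>x. x) ` TS s" by (simp add: M_part_def sub_rep_def)
  show "rep.zero (M_part s) = 0" by (simp add: M_part_def sub_rep_def)
  show "rep.add (M_part s) u v = u + v" for u v by (simp only: M_part_def sub_rep_def rep.select_convs)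
  show "smul (M_part s) c u = tensor_scale c u" for c u by (simp only: M_part_def sub_rep_def rep.select_convs)
  show "act (M_part s) x u = tensor_act x u" for x u by (simp only: M_part_def sub_rep_def rep.select_convs)
  show "Tw.stable {0}" unfolding Tw.stable_def using tensor_act_zero by simp
  show "u = v \<longleftrightarrow> u - v \<in> {0}" for u v :: "nat set \<Rightarrow> 'm" by simp
  show "TS s \<subseteq> T.span (\<Union>\<nu>\<in>dual t. TS s \<inter> Tw.wt \<nu>)"
    by (rule stable_span_weights[OF O stable_TS TS_subset])
qed

lemma M_section:
  assumes O: category_O and \<mu>: "\<mu> \<in> dual t"
  shows "rep_image.section_of tensor_scale (TS s) {0} (\<lambda>x. x) ((\<lambda>x. x) ` (TS s \<inter> Tw.wt \<mu>)) (V \<mu> s)"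
proof -
  interpret R: rep_image scale br tensor_scale tensor_act t h "TS s" "{0}" "M_part s" "\<lambda>x. x"
    by (rule rep_image_M[OF O])
  show ?thesis
    unfolding R.section_of_def using subspace_V fin_span_V[OF O \<mu>] unfolding V_def by blast
qed

text \<open>Both parities use the same \<open>N\<close>, so that the dimensions of their sections
  are the two sums in \<open>index_formula\<close>. The same sections show that the weight spaces of
  the cohomology are finite-dimensional, which admissibility requires.\<close>

theorem index_character:
  assumes O: category_O
  shows "virtual_eq h t H_top_even H_top_odd M_S_even M_S_odd"
proof -
  interpret H: rep_image scale br "seq_scale tensor_scale" seq_act t h "HX s" HW "H_part s" class_of for s
    by (rule rep_image_H[OF O])
  interpret M: rep_image scale br tensor_scale tensor_act t h "TS s" "{0}" "M_part s" "\<lambda>x. x" for s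
    by (rule rep_image_M[OF O])
  have admM: "admissible h t (M_part s)" for s
    by (rule M.admissible) (rule exI, rule M_section[OF O])
  have "\<exists>N. (\<forall>k\<ge>N. \<forall>s. odd_operator.den (V \<mu>) D k s = odd_operator.K (V \<mu>) D (2 * k + 1) s) \<and>
    (\<Sum>k<N. int (T.dim (odd_operator.K (V \<mu>) D (2 * k + 1) True) - T.dim (odd_operator.den (V \<mu>) D k True))) -
    (\<Sum>k<N. int (T.dim (odd_operator.K (V \<mu>) D (2 * k + 1) False) - T.dim (odd_operator.den (V \<mu>) D k False))) =
      int (T.dim (V \<mu> True)) - int (T.dim (V \<mu> False))" if \<mu>: "\<mu> \<in> dual t" for \<mu>
  proof -
    interpret o: odd_operator tensor_scale "V \<mu>" D by (rule odd_operator_V[OF O \<mu>])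
    show ?thesis using o.index_formula[of True] by simp
  qed
  then have main: "\<exists>C. (\<forall>s. H.section_of s (class_of ` (HX s \<inter> Qw.wt \<mu>)) (C s)) \<and>
    int (Q.seq.dim (C True)) - int (Q.seq.dim (C False)) = int (T.dim (V \<mu> True)) - int (T.dim (V \<mu> False))"
    if \<mu>: "\<mu> \<in> dual t" for \<mu>
  proof -
    obtain N where N: "\<forall>k\<ge>N. \<forall>s. odd_operator.den (V \<mu>) D k s = odd_operator.K (V \<mu>) D (2 * k + 1) s"
      "(\<Sum>k<N. int (T.dim (odd_operator.K (V \<mu>) D (2 * k + 1) True) - T.dim (odd_operator.den (V \<mu>) D k True))) -
      (\<Sum>k<N. int (T.dim (odd_operator.K (V \<mu>) D (2 * k + 1) False) - T.dim (odd_operator.den (V \<mu>) D k False))) =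
      int (T.dim (V \<mu> True)) - int (T.dim (V \<mu> False))"
      using \<open>\<And>\<mu>. \<mu> \<in> dual t \<Longrightarrow> _\<close>[OF \<mu>] by (elim exE conjE)
    have "\<forall>s. \<exists>C. H.section_of s (class_of ` (HX s \<inter> Qw.wt \<mu>)) C \<and>
      Q.seq.dim C = (\<Sum>k<N. T.dim (odd_operator.K (V \<mu>) D (2 * k + 1) s) - T.dim (odd_operator.den (V \<mu>) D k s))"
      using H_section[OF O \<mu>] N(1) by simp
    from choice[OF this] obtain C where C: "\<forall>s. H.section_of s (class_of ` (HX s \<inter> Qw.wt \<mu>)) (C s) \<and>
      Q.seq.dim (C s) = (\<Sum>k<N. T.dim (odd_operator.K (V \<mu>) D (2 * k + 1) s) - T.dim (odd_operator.den (V \<mu>) D k s))"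
      by (rule exE)
    then have "int (Q.seq.dim (C True)) - int (Q.seq.dim (C False)) = int (T.dim (V \<mu> True)) - int (T.dim (V \<mu> False))"
      using N(2) by (simp only: of_nat_sum)
    then show ?thesis using C by blast
  qed
  have admH: "admissible h t (H_part s)" for s
    by (rule H.admissible) (use main in blast)
  have "int (rep_dim (H_part True) (rep_weight_space t (H_part True) \<mu>)) -
      int (rep_dim (H_part False) (rep_weight_space t (H_part False) \<mu>)) =
      int (rep_dim (M_part True) (rep_weight_space t (M_part True) \<mu>)) -
      int (rep_dim (M_part False) (rep_weight_space t (M_part False) \<mu>))" if \<mu>: "\<mu> \<in> dual t" for \<mu>
  proof -
    obtain C where C: "\<And>s. H.section_of s (class_of ` (HX s \<inter> Qw.wt \<mu>)) (C s)"
      "int (Q.seq.dim (C True)) - int (Q.seq.dim (C False)) = int (T.dim (V \<mu> True)) - int (T.dim (V \<mu> False))"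
      using main[OF \<mu>] by blast
    have "rep_dim (M_part s) (rep_weight_space t (M_part s) \<mu>) = T.dim (V \<mu> s)" for s
      unfolding M.rep_weight_space_eq[OF \<mu>] by (rule M.rep_dim_section(1)[OF M_section[OF O \<mu>]])
    moreover have "rep_dim (H_part s) (rep_weight_space t (H_part s) \<mu>) = Q.seq.dim (C s)" for s
      unfolding H.rep_weight_space_eq[OF \<mu>] by (rule H.rep_dim_section(1)[OF C(1)])
    ultimately show ?thesis using C(2) by (simp only:)
  qed
  then show ?thesis
    unfolding virtual_eq_def H_top_even_eq H_top_odd_eq M_S_even_eq M_S_odd_eq
    by (intro conjI ballI admH admM)
qed

end

theorem mainTheorem8:
  fixes scale :: "complex \<Rightarrow> 'g::ab_group_add \<Rightarrow> 'g"
    and br :: "'g \<Rightarrow> 'g \<Rightarrow> 'g"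
    and \<theta> :: "'g \<Rightarrow> 'g"
    and h t :: "'g set"
    and \<Delta>p :: "('g \<Rightarrow> complex) set"
    and ys zs :: "'g list"
    and scaleM :: "complex \<Rightarrow> 'm::ab_group_add \<Rightarrow> 'm"
    and \<pi> :: "'g \<Rightarrow> 'm \<Rightarrow> 'm"
  assumes "dirac_module scale br \<theta> h t \<Delta>p ys zs scaleM \<pi>"
    and "dirac_module.category_O scale br t \<Delta>p scaleM \<pi>"
  shows "complex_lie_algebra.virtual_eq scale br h t
           (dirac_module.H_top_even scale br h t \<Delta>p ys zs scaleM \<pi>)
           (dirac_module.H_top_odd scale br h t \<Delta>p ys zs scaleM \<pi>)
           (dirac_module.M_S_even scale br h t \<Delta>p ys scaleM \<pi>)
           (dirac_module.M_S_odd scale br h t \<Delta>p ys scaleM \<pi>)"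
  by (rule dirac_module.index_character[OF assms])

end
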